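(* Let $k$ be a field with $\mathrm{char}\,k\ne3$, let $M\supset k$ be an infinite field, and let $\mathbf a,\mathbf b\in M^3$ with $D_{\mathbf a}D_{\mathbf b}\ne0$. Put $L_{\mathbf a}=\mathrm{Spl}_Mf_3(\mathbf a;X)$, $L_{\mathbf b}=\mathrm{Spl}_Mf_3(\mathbf b;X)$, $G_{\mathbf a}=\mathrm{Gal}(L_{\mathbf a}/M)$, $G_{\mathbf b}=\mathrm{Gal}(L_{\mathbf b}/M)$, and suppose $\#G_{\mathbf a}\ge\#G_{\mathbf b}$. Assume that $f_3(\mathbf a;X)$ is irreducible over $M$, $A_{\mathbf a}A_{\mathbf b}\neq0$ and $A_{\mathbf a}^3B_{\mathbf b}^2-27A_{\mathbf b}^3D_{\mathbf a}\ne0$. Then the list of degrees of the irreducible factors over $M$ of the sextic $F_2(\mathbf a,\mathbf b;X)$ is as follows. Case $G_{\mathbf a}\cong\mathfrak S_3$: - $G_{\mathbf b}\cong\mathfrak S_3$: $(6)$ if $L_{\mathbf a}\cap L_{\mathbf b}=M$; $(3)(3)$ if $[L_{\mathbf a}\cap L_{\mathbf b}:M]=2$; $(1)(2)(3)$ if $L_{\mathbf a}=L_{\mathbf b}$; - $G_{\mathbf b}\cong C_3$ (then $L_{\mathbf a}\cap L_{\mathbf b}=M$): $(6)$; - $G_{\mathbf b}\cong C_2$: $(6)$ if $L_{\mathbf a}\not\supset L_{\mathbf b}$; $(3)(3)$ if $L_{\mathbf a}\supset L_{\mathbf b}$; - $G_{\mathbf b}=\{1\}$: $(6)$. Case $G_{\mathbf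 a}\cong C_3$: - $G_{\mathbf b}\cong C_3$: $(3)(3)$ if $L_{\mathbf a}\ne L_{\mathbf b}$; $(1)(1)(1)(3)$ if $L_{\mathbf a}=L_{\mathbf b}$; - $G_{\mathbf b}\cong C_2$ (then $L_{\mathbf a}\cap L_{\mathbf b}=M$): $(6)$; - $G_{\mathbf b}=\{1\}$: $(3)(3)$. Moreover, for each irreducible factor $h_\mu(X)$ of $F_2(\mathbf a,\mathbf b;X)$ over $M$, a root field $M_\mu$ of $h_\mu(X)$ (the field generated over $M$ by one root of $h_\mu$) satisfies $\mathrm{Spl}_{M_\mu}f_3(\mathbf a;X)=\mathrm{Spl}_{M_\mu}f_3(\mathbf b;X)$.
   Context: For $\mathbf a=(a_1,a_2,a_3)$ put $f_3(\mathbf a;X)=X^3-a_1X^2+a_2X-a_3$, $A_{\mathbf a}=a_1^2-3a_2$, $B_{\mathbf a}=2a_1^3-9a_1a_2+27a_3$, and let $D_{\mathbf a}=a_1^2a_2^2-4a_2^3-4a_1^3a_3+18a_1a_2a_3-27a_3^2$ be the discriminant of $f_3(\mathbf a;X)$; similarly for $\mathbf b$. All fields are taken in a fixed algebraic closure of $M$; $\mathrm{Spl}_N f$ is the splitting field of $f$ over $N$. Define $$F_2(\mathbf a,\mathbf b;X)=X^6-\frac{2A_{\mathbf a}A_{\mathbf b}}{D_{\mathbf a}}X^4+\frac{B_{\mathbf b}}{D_{\mathbf a}}X^3+\frac{A_{\mathbf a}^2A_{\mathbf b}^2}{D_{\mathbf a}^2}X^2-\frac{A_{\mathbf a}A_{\mathbf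 b}B_{\mathbf b}}{D_{\mathbf a}^2}X+\frac{A_{\mathbf b}^3D_{\mathbf a}-A_{\mathbf a}^3D_{\mathbf b}}{D_{\mathbf a}^3}.$$ The notation $(d_1)(d_2)\cdots$ means that the irreducible factors have degrees $d_1,d_2,\ldots$. *)

theory Defs
  imports
    "HOL-Algebra.Algebraic_Closure_Type"
    "HOL-Algebra.Generated_Fields"
    "HOL-Algebra.Sym_Groups"
    "HOL-Algebra.Elementary_Groups"
    "HOL-Algebra.Bij"
begin

fun f3 :: "'a \<times> 'a \<times> 'a \<Rightarrow> 'a::comm_ring_1 poly" where
  "f3 (a1, a2, a3) = [:-a3, a2, -a1, 1:]"

fun inv_A :: "'a \<times> 'a \<times> 'a \<Rightarrow> 'a::comm_ring_1" where
  "inv_A (a1, a2, a3) = a1 ^ 2 - 3 * a2"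

fun inv_B :: "'a \<times> 'a \<times> 'a \<Rightarrow> 'a::comm_ring_1" where
  "inv_B (a1, a2, a3) = 2 * a1 ^ 3 - 9 * a1 * a2 + 27 * a3"

text \<open>The discriminant of \<open>f3\<close>.\<close>

fun inv_D :: "'a \<times> 'a \<times> 'a \<Rightarrow> 'a::comm_ring_1" where
  "inv_D (a1, a2, a3) =
     a1 ^ 2 * a2 ^ 2 - 4 * a2 ^ 3 - 4 * a1 ^ 3 * a3 + 18 * a1 * a2 * a3 - 27 * a3 ^ 2"

definition F2 :: "'a \<times> 'a \<times> 'a \<Rightarrow> 'a \<times> 'a \<times> 'a \<Rightarrow> 'a::field poly" where
  "F2 a b =
     [: (inv_A b ^ 3 * inv_D a - inv_A a ^ 3 * inv_D b) / inv_D a ^ 3,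
        - (inv_A a * inv_A b * inv_B b / inv_D a ^ 2),
        inv_A a ^ 2 * inv_A b ^ 2 / inv_D a ^ 2,
        inv_B b / inv_D a,
        - (2 * inv_A a * inv_A b / inv_D a),
        0,
        1 :]"

text \<open>
  A field \<open>M\<close> is represented by a type of class \<open>field\<close>, and the fixed algebraic
  closure by the type \<open>alg_closure\<close> over it.  Fields between the two are subsets of the closure;
  \<open>M\<close> itself is then the image of the embedding \<open>to_ac\<close>.
\<close>

abbreviation Cl :: "'m::field alg_closure ring" where
  "Cl \<equiv> ring_of_type_algebra"

abbreviation base_field :: "'m::field alg_closure set" where
  "base_field \<equiv> range to_ac"

abbreviation roots_in_closure :: "'m::field poly \<Rightarrow> 'm alg_closure set" where
  "roots_in_closure f \<equiv> {x. poly (map_poly to_ac f) x = 0}"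

definition Spl :: "'m alg_closure set \<Rightarrow> 'm::field poly \<Rightarrow> 'm alg_closure set" where
  "Spl N f = generate_field Cl (N \<union> roots_in_closure f)"

definition root_field :: "'m::field alg_closure \<Rightarrow> 'm alg_closure set" where
  "root_field x = generate_field Cl (base_field \<union> {x})"

text \<open>
  As in \<open>Bij\<close>, automorphisms of \<open>L\<close> are extensional functions, so that distinct
  functions are distinct automorphisms.
\<close>

definition Gal :: "'m::field alg_closure set \<Rightarrow> ('m alg_closure \<Rightarrow> 'm alg_closure) monoid" where
  "Gal L = (BijGroup L)
     \<lparr>carrier := {\<sigma> \<in> Bij L.
        \<sigma> \<in> ring_hom (Cl\<lparr>carrier := L\<rparr>) (Cl\<lparr>carrier := L\<rparr>) \<and>
        (\<forall>x\<in>base_field. \<sigma> x = x)}\<rparr>"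

text \<open>
  \<open>ds\<close> is the multiset of the degrees of the irreducible factors of the nonconstant polynomial
  \<open>p\<close>, counted with multiplicity.  No unit factor is needed: over a field it can be absorbed into
  one of the factors.
\<close>

definition has_factor_degrees :: "'a::field poly \<Rightarrow> nat multiset \<Rightarrow> bool" where
  "has_factor_degrees p ds \<longleftrightarrow>
     (\<exists>hs. (\<forall>h\<in>#hs. Factorial_Ring.irreducible h) \<and> p = prod_mset hs \<and>
           image_mset Polynomial.degree hs = ds)"

end

theory Submission
  imports Defs
begin

text \<open>
  Let \<open>x\<close> and \<open>y\<close> list the roots of the two cubics.  For each permutation \<open>p\<close> of the indices let
  \<open>\<theta> p\<close> be the leading coefficient of the quadratic polynomial that takes \<open>x i\<close> to \<open>y (p i)\<close>.
  Then \<open>F2 a b\<close> is the product of the \<open>X - \<theta> p\<close>, and these six roots are distinct: up to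
  a power of the Vandermonde product of \<open>x\<close>, differences of two roots of equal parity are factors
  of \<open>A\<^sub>a\<^sup>3 B\<^sub>b\<^sup>2 - 27 A\<^sub>b\<^sup>3 D\<^sub>a\<close>, and differences of two roots of opposite parity are factors of
  \<open>B\<^sub>a D\<^sub>b\<close>, where \<open>B\<^sub>a\<close> is a nonzero multiple of the value of the
  irreducible cubic at \<open>a\<^sub>1/3\<close>.  An automorphism that permutes the \<open>x i\<close> by \<open>\<alpha>\<close> and the \<open>y i\<close> by
  \<open>\<beta>\<close> takes \<open>\<theta> p\<close> to \<open>\<theta> (\<beta> p \<alpha>\<inverse>)\<close>.  So the irreducible factors correspond to the orbits on \<open>S\<^sub>3\<close>
  of a subgroup \<open>H\<close> of \<open>S\<^sub>3 \<times> S\<^sub>3\<close>, and in each case \<open>H\<close> is determined by its projections and by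
  the position of the two splitting fields.  An automorphism that fixes \<open>\<theta> p\<close> has
  \<open>\<beta> = p \<alpha> p\<inverse>\<close>, so it fixes all \<open>x i\<close> iff it fixes all \<open>y i\<close>.
\<close>

text \<open>\<open>M\<close> may be imperfect or of characteristic 2, so the elements of the closure
  that are fixed by all its automorphisms can be more than \<open>M\<close>. The fixed-field
  argument is therefore made only for fields generated by separable elements. The roots of the
  cubics qualify because the discriminants are nonzero, those of the sextic because the six values
  \<open>\<theta> p\<close> are distinct.

  All Galois actions are those of homomorphisms of the whole closure. A single map then acts on both
  cubics and on the sextic, and \<open>H\<close> is the Galois group of the compositum although no
  compositum is formed. The position of the splitting fields is read off the kernels of the two
  projections of \<open>H\<close>: \<open>L_b\<close> lies in \<open>L_a\<close> iff
  \<open>(Id3, q)\<close> occurs in \<open>H\<close> for \<open>q = Id3\<close> only, and the two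
  fields meet in \<open>M\<close> if \<open>H\<close> is the product of its projections. If both
  groups are \<open>S_3\<close>, this kernel decides between (6), (3)(3) and (1)(2)(3), according to
  whether it contains an odd permutation, nontrivial but only even ones, or the identity
  alone.\<close>

section \<open>Homomorphisms over the base field\<close>

text \<open>Two closure conditions describe an intermediate field here: negation comes from
  \<open>-1\<close> in \<open>M\<close>, and inverses from algebraicity. Fixed sets, preimages and
  images of homomorphisms are then quickly seen to qualify.\<close>

definition intermediate_ring :: "'m::field alg_closure set \<Rightarrow> bool" where
  "intermediate_ring E \<longleftrightarrow> base_field \<subseteq> E \<and> (\<forall>x\<in>E. \<forall>y\<in>E. x + y \<in> E \<and> x * y \<in> E)"

text \<open>Values outside \<open>E\<close> are left arbitrary. With \<open>E = UNIV\<close> these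
  are the endomorphisms of the closure over \<open>M\<close>; being injective, they permute every
  finite stable set.\<close>

definition base_hom :: "'m::field alg_closure set \<Rightarrow> ('m alg_closure \<Rightarrow> 'm alg_closure) \<Rightarrow> bool" where
  "base_hom E \<phi> \<longleftrightarrow> intermediate_ring E \<and>
     (\<forall>x\<in>E. \<forall>y\<in>E. \<phi> (x + y) = \<phi> x + \<phi> y \<and> \<phi> (x * y) = \<phi> x * \<phi> y) \<and>
     (\<forall>c. \<phi> (to_ac c) = to_ac c)"

text \<open>\<open>E\<close> is a set inside the closure and not a type, so the polynomials over it
  are singled out among those over the closure.\<close>

definition polys_over :: "'a::comm_ring_1 set \<Rightarrow> 'a poly set" where
  "polys_over E = {p. \<forall>i. Polynomial.coeff p i \<in> E}"

definition min_poly_over :: "'a::field set \<Rightarrow> 'a \<Rightarrow> 'a poly \<Rightarrow> bool" where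
  "min_poly_over E z p \<longleftrightarrow> p \<in> polys_over E \<and> Polynomial.lead_coeff p = 1 \<and> poly p z = 0 \<and>
     (\<forall>q\<in>polys_over E. q \<noteq> 0 \<longrightarrow> poly q z = 0 \<longrightarrow> Polynomial.degree p \<le> Polynomial.degree q)"

text \<open>Stated through a full list of distinct roots instead of a derivative: the cubics and the
  sextic come in this shape, and the roots of a minimal polynomial can then be counted by
  \<open>card_roots_of_separable_divisor\<close>.\<close>

definition separable :: "'m::field alg_closure \<Rightarrow> bool" where
  "separable z \<longleftrightarrow> (\<exists>S f. finite S \<and> z \<in> S \<and> map_poly to_ac f = (\<Prod>s\<in>S. [:-s, 1:]))"

lemma map_poly_to_ac_mult: "map_poly to_ac (p * q) = map_poly to_ac p * map_poly to_ac q"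
  by (rule poly_eqI) (simp add: coeff_map_poly coeff_mult to_ac_sum)

lemma map_poly_to_ac_eq_iff [simp]:
  "map_poly to_ac p = map_poly to_ac q \<longleftrightarrow> p = q"
  by (simp add: poly_eq_iff coeff_map_poly)

lemma degree_map_poly_to_ac [simp]:
  "Polynomial.degree (map_poly to_ac p) = Polynomial.degree p"
  by (rule degree_map_poly) simp

context
  fixes E :: "'m::field alg_closure set"
  assumes E: "intermediate_ring E"
begin

lemma intermediate_ring_to_ac [simp]: "to_ac c \<in> E"
  using E by (auto simp: intermediate_ring_def)

lemma intermediate_ring_add: "x \<in> E \<Longrightarrow> y \<in> E \<Longrightarrow> x + y \<in> E"
  and intermediate_ring_mult: "x \<in> E \<Longrightarrow> y \<in> E \<Longrightarrow> x * y \<in> E"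
  using E by (auto simp: intermediate_ring_def)

lemma intermediate_ring_0: "0 \<in> E" and intermediate_ring_1: "1 \<in> E"
  using intermediate_ring_to_ac[of 0] intermediate_ring_to_ac[of 1] by auto

lemma intermediate_ring_uminus: "x \<in> E \<Longrightarrow> - x \<in> E"
  using intermediate_ring_mult[OF intermediate_ring_to_ac[of "-1"], of x] by simp

lemma intermediate_ring_diff: "x \<in> E \<Longrightarrow> y \<in> E \<Longrightarrow> x - y \<in> E"
  using intermediate_ring_add intermediate_ring_uminus by fastforce

lemma intermediate_ring_sum: "(\<And>i. i \<in> I \<Longrightarrow> f i \<in> E) \<Longrightarrow> sum f I \<in> E"
  by (induction I rule: infinite_finite_induct) (auto intro: intermediate_ring_0 intermediate_ring_add)

lemma polys_over_0: "0 \<in> polys_over E"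
  by (simp add: polys_over_def intermediate_ring_0)

lemma polys_over_add: "p \<in> polys_over E \<Longrightarrow> q \<in> polys_over E \<Longrightarrow> p + q \<in> polys_over E"
  and polys_over_diff: "p \<in> polys_over E \<Longrightarrow> q \<in> polys_over E \<Longrightarrow> p - q \<in> polys_over E"
  and polys_over_mult: "p \<in> polys_over E \<Longrightarrow> q \<in> polys_over E \<Longrightarrow> p * q \<in> polys_over E"
  by (auto simp: polys_over_def coeff_mult
      intro!: intermediate_ring_add intermediate_ring_diff intermediate_ring_sum intermediate_ring_mult)

lemma polys_over_pCons: "c \<in> E \<Longrightarrow> p \<in> polys_over E \<Longrightarrow> pCons c p \<in> polys_over E"
  by (auto simp: polys_over_def coeff_pCons split: nat.splits)

lemma polys_over_monom: "c \<in> E \<Longrightarrow> Polynomial.monom c n \<in> polys_over E"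
  by (auto simp: polys_over_def intermediate_ring_0)

lemma polys_over_map_poly_to_ac: "map_poly to_ac f \<in> polys_over E"
  by (simp add: polys_over_def coeff_map_poly)

lemma poly_closed: "q \<in> polys_over E \<Longrightarrow> z \<in> E \<Longrightarrow> poly q z \<in> E"
proof (induction q)
  case (pCons a p)
  then have "a \<in> E" "p \<in> polys_over E"
    unfolding polys_over_def by (auto simp: coeff_pCons split: nat.splits)
  then show ?case using pCons by (auto intro!: intermediate_ring_add intermediate_ring_mult)
qed (simp add: intermediate_ring_0)

text \<open>Since the closure is algebraic over the base field, intermediate rings are fields.\<close>

lemma intermediate_ring_inverse: "x \<in> E \<Longrightarrow> inverse x \<in> E"
proof (cases "x = 0")
  case False
  assume x: "x \<in> E"
  obtain p :: "'m poly" where "p \<noteq> 0" "poly (map_poly to_ac p) x = 0"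
    by (rule alg_closure_algebraic)
  then show ?thesis
  proof (induction p)
    case (pCons a p)
    have eq: "to_ac a + x * poly (map_poly to_ac p) x = 0"
      using pCons by (simp add: map_poly_pCons)
    show ?case
    proof (cases "a = 0")
      case True
      then show ?thesis using pCons False eq by auto
    next
      case a: False
      define y where "y = poly (map_poly to_ac p) x"
      have y: "y \<in> E" unfolding y_def by (intro poly_closed polys_over_map_poly_to_ac x)
      \<comment> \<open>With a nonzero constant term, \<open>a + x * y = 0\<close> expresses the
        inverse of \<open>x\<close> as a polynomial in \<open>x\<close>. A zero constant term lets
        the factor \<open>x\<close> be cancelled, and the induction hypothesis applies.\<close>
      have "inverse x = - (to_ac (inverse a) * y)"
        using eq False a unfolding y_def[symmetric] by (simp add: field_simps eq_neg_iff_add_eq_0)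
      then show ?thesis
        using y by (simp add: intermediate_ring_uminus intermediate_ring_mult del: to_ac_inverse)
    qed
  qed auto
qed (use intermediate_ring_0 in auto)

lemma min_poly_over_exists: "\<exists>p. min_poly_over E z p"
proof -
  let ?P = "\<lambda>q. q \<in> polys_over E \<and> q \<noteq> 0 \<and> poly q z = 0"
  obtain p :: "'m poly" where "p \<noteq> 0" "poly (map_poly to_ac p) z = 0"
    by (rule alg_closure_algebraic)
  then have "?P (map_poly to_ac p)"
    using polys_over_map_poly_to_ac by (auto simp: map_poly_eq_0_iff)
  then obtain q where q: "?P q" and min: "\<And>r. ?P r \<Longrightarrow> Polynomial.degree q \<le> Polynomial.degree r"
    using ex_has_least_nat[of ?P _ Polynomial.degree] by blast
  let ?c = "inverse (Polynomial.lead_coeff q)"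
  have "?c \<in> E" using q by (intro intermediate_ring_inverse) (auto simp: polys_over_def)
  then have "min_poly_over E z (Polynomial.smult ?c q)"
    unfolding min_poly_over_def using q min
    by (auto simp: polys_over_def intermediate_ring_mult)
  then show ?thesis ..
qed

text \<open>Dividing by a monic polynomial uses only ring operations on the coefficients, so
  quotient and remainder stay over \<open>E\<close>. The disjunct \<open>r = 0\<close> is separate
  because zero has degree 0, which is not below the degree of \<open>p = 1\<close>.\<close>

lemma monic_division:
  assumes p: "p \<in> polys_over E" "Polynomial.lead_coeff p = 1" and q: "q \<in> polys_over E"
  shows "\<exists>u\<in>polys_over E. \<exists>r\<in>polys_over E.
           q = u * p + r \<and> (r = 0 \<or> Polynomial.degree r < Polynomial.degree p)"
  using q
proof (induction "Polynomial.degree q" arbitrary: q rule: less_induct)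
  case less
  show ?case
  proof (cases "q = 0 \<or> Polynomial.degree q < Polynomial.degree p")
    case True
    then show ?thesis using less.prems polys_over_0 by (intro bexI[of _ 0] bexI[of _ q]) auto
  next
    case False
    define m where "m = Polynomial.monom (Polynomial.lead_coeff q)
      (Polynomial.degree q - Polynomial.degree p)"
    have m: "m \<in> polys_over E"
      unfolding m_def using less.prems by (intro polys_over_monom) (auto simp: polys_over_def)
    define q' where "q' = q - m * p"
    have q': "q' \<in> polys_over E"
      unfolding q'_def using m p less.prems by (intro polys_over_diff polys_over_mult)
    have p0: "p \<noteq> 0" using p by auto
    have m0: "m \<noteq> 0" using False by (auto simp: m_def monom_eq_0_iff)
    have deg_mp: "Polynomial.degree (m * p) = Polynomial.degree q"
      using False m0 p0 by (subst degree_mult_eq) (auto simp: m_def degree_monom_eq)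
    have "Polynomial.lead_coeff m = Polynomial.lead_coeff q"
      using False by (simp add: m_def degree_monom_eq)
    then have "Polynomial.coeff (m * p) (Polynomial.degree q) = Polynomial.lead_coeff q"
      by (subst deg_mp[symmetric], subst lead_coeff_mult) (use p in simp)
    then have c0: "Polynomial.coeff q' (Polynomial.degree q) = 0" by (simp add: q'_def)
    have le: "Polynomial.degree q' \<le> Polynomial.degree q"
      unfolding q'_def using deg_mp by (intro degree_diff_le) auto
    have "\<exists>u\<in>polys_over E. \<exists>r\<in>polys_over E.
           q' = u * p + r \<and> (r = 0 \<or> Polynomial.degree r < Polynomial.degree p)"
    proof (cases "q' = 0")
      case True
      then show ?thesis using polys_over_0 by (intro bexI[of _ 0]) auto
    next
      case False
      then have "Polynomial.degree q' \<noteq> Polynomial.degree q"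
        using c0 by (metis leading_coeff_0_iff)
      with le have "Polynomial.degree q' < Polynomial.degree q" by simp
      from less.hyps[OF this q'] show ?thesis .
    qed
    then obtain u r where ur: "u \<in> polys_over E" "r \<in> polys_over E" "q' = u * p + r"
      "r = 0 \<or> Polynomial.degree r < Polynomial.degree p" by blast
    then have "q = (u + m) * p + r" by (simp add: q'_def algebra_simps)
    then show ?thesis using ur(2,4) polys_over_add[OF ur(1) m] by blast
  qed
qed

lemma min_poly_over_dvd:
  assumes p: "min_poly_over E z p" and q: "q \<in> polys_over E" "poly q z = 0"
  shows "\<exists>u\<in>polys_over E. q = u * p"
proof -
  obtain u r where ur: "u \<in> polys_over E" "r \<in> polys_over E" "q = u * p + r"
    "r = 0 \<or> Polynomial.degree r < Polynomial.degree p"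
    using monic_division[of p q] p q by (auto simp: min_poly_over_def)
  have "poly r z = 0" using ur(3) q p by (simp add: min_poly_over_def)
  then have "r = 0" using p ur(2,4) by (auto simp: min_poly_over_def)
  then show ?thesis using ur by auto
qed

end

context
  fixes E :: "'m::field alg_closure set" and \<phi>
  assumes hom: "base_hom E \<phi>"
begin

lemma base_hom_domain: "intermediate_ring E"
  using hom by (simp add: base_hom_def)

lemma base_hom_to_ac: "\<phi> (to_ac c) = to_ac c"
  and base_hom_add: "x \<in> E \<Longrightarrow> y \<in> E \<Longrightarrow> \<phi> (x + y) = \<phi> x + \<phi> y"
  and base_hom_mult: "x \<in> E \<Longrightarrow> y \<in> E \<Longrightarrow> \<phi> (x * y) = \<phi> x * \<phi> y"
  using hom by (auto simp: base_hom_def)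

lemma base_hom_0: "\<phi> 0 = 0" and base_hom_1: "\<phi> 1 = 1"
  using base_hom_to_ac[of 0] base_hom_to_ac[of 1] by auto

lemma base_hom_uminus: "x \<in> E \<Longrightarrow> \<phi> (- x) = - \<phi> x"
  using base_hom_mult[of "to_ac (-1)" x] intermediate_ring_to_ac[OF base_hom_domain, of "-1"]
    base_hom_to_ac[of "-1"] by simp

lemma base_hom_diff: "x \<in> E \<Longrightarrow> y \<in> E \<Longrightarrow> \<phi> (x - y) = \<phi> x - \<phi> y"
  using base_hom_add[of x "-y"] base_hom_uminus intermediate_ring_uminus[OF base_hom_domain]
  by simp

lemma base_hom_inverse:
  assumes "x \<in> E"
  shows "\<phi> (inverse x) = inverse (\<phi> x)"
proof (cases "x = 0")
  case False
  then have "\<phi> x * \<phi> (inverse x) = 1"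
    using base_hom_mult[OF assms intermediate_ring_inverse[OF base_hom_domain assms]]
    by (simp add: base_hom_1)
  then show ?thesis by (metis inverse_unique)
qed (simp add: base_hom_0)

lemma base_hom_inj_on: "inj_on \<phi> E"
proof (rule inj_onI)
  fix x y assume xy: "x \<in> E" "y \<in> E" "\<phi> x = \<phi> y"
  then have d: "x - y \<in> E" "\<phi> (x - y) = 0"
    using intermediate_ring_diff[OF base_hom_domain] by (auto simp: base_hom_diff)
  show "x = y"
  proof (rule ccontr)
    assume "x \<noteq> y"
    then have "\<phi> (inverse (x - y) * (x - y)) = 1" by (simp add: base_hom_1)
    then show False
      using base_hom_mult[OF intermediate_ring_inverse[OF base_hom_domain d(1)] d(1)] d by simp
  qed
qed

lemma base_hom_sum: "(\<And>i. i \<in> I \<Longrightarrow> f i \<in> E) \<Longrightarrow> \<phi> (sum f I) = (\<Sum>i\<in>I. \<phi> (f i))"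
proof (induction I rule: infinite_finite_induct)
  case (insert i I)
  then show ?case
    using base_hom_add[of "f i" "sum f I"] intermediate_ring_sum[OF base_hom_domain, of I f] by auto
qed (auto simp: base_hom_0)

lemma coeff_map_poly_base_hom: "Polynomial.coeff (map_poly \<phi> p) i = \<phi> (Polynomial.coeff p i)"
  by (rule coeff_map_poly) (rule base_hom_0)

lemma map_poly_base_hom_add:
  "p \<in> polys_over E \<Longrightarrow> q \<in> polys_over E \<Longrightarrow> map_poly \<phi> (p + q) = map_poly \<phi> p + map_poly \<phi> q"
  by (rule poly_eqI) (auto simp: coeff_map_poly_base_hom polys_over_def intro!: base_hom_add)

lemma map_poly_base_hom_diff:
  "p \<in> polys_over E \<Longrightarrow> q \<in> polys_over E \<Longrightarrow> map_poly \<phi> (p - q) = map_poly \<phi> p - map_poly \<phi> q"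
  by (rule poly_eqI) (auto simp: coeff_map_poly_base_hom polys_over_def intro!: base_hom_diff)

lemma map_poly_base_hom_mult:
  "p \<in> polys_over E \<Longrightarrow> q \<in> polys_over E \<Longrightarrow> map_poly \<phi> (p * q) = map_poly \<phi> p * map_poly \<phi> q"
proof (rule poly_eqI)
  fix i assume pq: "p \<in> polys_over E" "q \<in> polys_over E"
  have "\<phi> (\<Sum>j\<le>i. Polynomial.coeff p j * Polynomial.coeff q (i - j)) =
     (\<Sum>j\<le>i. \<phi> (Polynomial.coeff p j) * \<phi> (Polynomial.coeff q (i - j)))"
    using pq by (subst base_hom_sum)
      (auto simp: polys_over_def base_hom_mult intro!: intermediate_ring_mult[OF base_hom_domain])
  then show "Polynomial.coeff (map_poly \<phi> (p * q)) i =
      Polynomial.coeff (map_poly \<phi> p * map_poly \<phi> q) i"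
    by (simp add: coeff_map_poly_base_hom coeff_mult)
qed

lemma base_hom_poly:
  "q \<in> polys_over E \<Longrightarrow> z \<in> E \<Longrightarrow> \<phi> (poly q z) = poly (map_poly \<phi> q) (\<phi> z)"
proof (induction q)
  case (pCons a p)
  then have a: "a \<in> E" and p: "p \<in> polys_over E"
    unfolding polys_over_def by (auto simp: coeff_pCons split: nat.splits)
  have pz: "poly p z \<in> E" using poly_closed[OF base_hom_domain p] pCons by auto
  have "map_poly \<phi> (pCons a p) = pCons (\<phi> a) (map_poly \<phi> p)"
    by (rule poly_eqI) (auto simp: coeff_map_poly_base_hom coeff_pCons split: nat.splits)
  then show ?case
    using pCons a p pz intermediate_ring_mult[OF base_hom_domain]
    by (simp add: base_hom_add base_hom_mult)
qed (simp add: base_hom_0)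

lemma map_poly_base_hom_to_ac: "map_poly \<phi> (map_poly to_ac f) = map_poly to_ac f"
  by (rule poly_eqI) (simp add: coeff_map_poly_base_hom coeff_map_poly base_hom_to_ac)

lemma base_hom_root:
  "z \<in> E \<Longrightarrow> poly (map_poly to_ac f) z = 0 \<Longrightarrow> poly (map_poly to_ac f) (\<phi> z) = 0"
  using base_hom_poly[OF polys_over_map_poly_to_ac[OF base_hom_domain], of z f]
  by (simp add: map_poly_base_hom_to_ac base_hom_0)

end

section \<open>Extending homomorphisms to the whole closure\<close>

definition adjoin :: "'m::field alg_closure set \<Rightarrow> 'm alg_closure \<Rightarrow> 'm alg_closure set" where
  "adjoin E z = (\<lambda>q. poly q z) ` polys_over E"

lemma
  assumes E: "intermediate_ring E"
  shows intermediate_ring_adjoin: "intermediate_ring (adjoin E z)"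
    and subset_adjoin: "E \<subseteq> adjoin E z"
    and self_in_adjoin: "z \<in> adjoin E z"
proof -
  have 1: "x \<in> adjoin E z" if "x \<in> E" for x
  proof -
    have "[:x:] \<in> polys_over E"
      using that polys_over_0[OF E] by (intro polys_over_pCons[OF E]) auto
    then show ?thesis unfolding adjoin_def by (rule image_eqI[rotated]) simp
  qed
  then show "E \<subseteq> adjoin E z" by auto
  have "[:0, 1:] \<in> polys_over E"
    using intermediate_ring_0[OF E] intermediate_ring_1[OF E] polys_over_0[OF E]
    by (intro polys_over_pCons[OF E]) auto
  then show "z \<in> adjoin E z" unfolding adjoin_def by (rule image_eqI[rotated]) simp
  have "x + y \<in> adjoin E z \<and> x * y \<in> adjoin E z" if xy: "x \<in> adjoin E z" "y \<in> adjoin E z" for x y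
  proof -
    obtain p q where pq: "p \<in> polys_over E" "q \<in> polys_over E" "x = poly p z" "y = poly q z"
      using xy by (auto simp: adjoin_def)
    have "poly (p + q) z \<in> adjoin E z" "poly (p * q) z \<in> adjoin E z"
      unfolding adjoin_def using pq polys_over_add[OF E] polys_over_mult[OF E] by blast+
    then show ?thesis using pq by simp
  qed
  then show "intermediate_ring (adjoin E z)"
    using 1[OF intermediate_ring_to_ac[OF E]] by (auto simp: intermediate_ring_def)
qed

text \<open>The value at \<open>poly q z\<close> is that of the image of \<open>q\<close> at
  \<open>z'\<close>. It does not depend on \<open>q\<close>: two choices differ by a multiple of
  \<open>p\<close>, whose image vanishes at \<open>z'\<close>.\<close>

lemma base_hom_extend_step:
  assumes hom: "base_hom E \<phi>" and p: "min_poly_over E z p" and z': "poly (map_poly \<phi> p) z' = 0"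
  shows "\<exists>\<psi>. base_hom (adjoin E z) \<psi> \<and> \<psi> z = z' \<and> (\<forall>x\<in>E. \<psi> x = \<phi> x)"
proof -
  note E = base_hom_domain[OF hom]
  define \<psi> where "\<psi> w = poly (map_poly \<phi> (SOME q. q \<in> polys_over E \<and> poly q z = w)) z'" for w
  have well_defined: "poly (map_poly \<phi> q) z' = poly (map_poly \<phi> r) z'"
    if qr: "q \<in> polys_over E" "r \<in> polys_over E" "poly q z = poly r z" for q r
  proof -
    have d: "q - r \<in> polys_over E" using qr polys_over_diff[OF E] by blast
    have "poly (q - r) z = 0" using qr(3) by simp
    then obtain u where u: "u \<in> polys_over E" "q - r = u * p"
      using min_poly_over_dvd[OF E p d] by blast
    have "p \<in> polys_over E" using p by (simp add: min_poly_over_def)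
    then have "map_poly \<phi> q - map_poly \<phi> r = map_poly \<phi> u * map_poly \<phi> p"
      using map_poly_base_hom_diff[OF hom qr(1,2)] map_poly_base_hom_mult[OF hom u(1)] u(2) by simp
    then have "poly (map_poly \<phi> q - map_poly \<phi> r) z' = poly (map_poly \<phi> u * map_poly \<phi> p) z'" by simp
    then show ?thesis using z' by simp
  qed
  have \<psi>: "\<psi> (poly q z) = poly (map_poly \<phi> q) z'" if "q \<in> polys_over E" for q
    unfolding \<psi>_def by (rule someI2[of _ q]) (use that well_defined in blast)+
  have on_E: "\<psi> x = \<phi> x" if "x \<in> E" for x
  proof -
    have "[:x:] \<in> polys_over E"
      using that polys_over_0[OF E] by (intro polys_over_pCons[OF E]) auto
    from \<psi>[OF this] show ?thesis by (simp add: map_poly_pCons base_hom_0[OF hom])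
  qed
  have "[:0, 1:] \<in> polys_over E"
    using intermediate_ring_0[OF E] intermediate_ring_1[OF E] polys_over_0[OF E]
    by (intro polys_over_pCons[OF E]) auto
  from \<psi>[OF this] have "\<psi> z = z'"
    by (simp add: map_poly_pCons base_hom_0[OF hom] base_hom_1[OF hom])
  moreover have "base_hom (adjoin E z) \<psi>"
    unfolding base_hom_def
  proof (intro conjI ballI allI)
    show "intermediate_ring (adjoin E z)" by (rule intermediate_ring_adjoin[OF E])
    show "\<psi> (to_ac c) = to_ac c" for c
      using on_E[of "to_ac c"] intermediate_ring_to_ac[OF E] base_hom_to_ac[OF hom] by simp
    fix x y assume xy: "x \<in> adjoin E z" "y \<in> adjoin E z"
    obtain q r where qr: "q \<in> polys_over E" "r \<in> polys_over E" "x = poly q z" "y = poly r z"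
      using xy by (auto simp: adjoin_def)
    show "\<psi> (x + y) = \<psi> x + \<psi> y"
      using \<psi>[OF polys_over_add[OF E qr(1,2)]] \<psi>[OF qr(1)] \<psi>[OF qr(2)]
      by (simp add: qr map_poly_base_hom_add[OF hom])
    show "\<psi> (x * y) = \<psi> x * \<psi> y"
      using \<psi>[OF polys_over_mult[OF E qr(1,2)]] \<psi>[OF qr(1)] \<psi>[OF qr(2)]
      by (simp add: qr map_poly_base_hom_mult[OF hom])
  qed
  ultimately show ?thesis using on_E by blast
qed

text \<open>Homomorphisms with varying domains are kept as graphs, so that extension is inclusion
  and the union of a chain is an upper bound for Zorn's lemma.\<close>

definition hom_graph :: "('m::field alg_closure \<times> 'm alg_closure) set \<Rightarrow> bool" where
  "hom_graph g \<longleftrightarrow> single_valued g \<and> (\<forall>c. (to_ac c, to_ac c) \<in> g) \<and>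
     (\<forall>(x, x')\<in>g. \<forall>(y, y')\<in>g. (x + y, x' + y') \<in> g \<and> (x * y, x' * y') \<in> g)"

lemma hom_graph_base_hom:
  assumes "base_hom E \<phi>"
  shows "hom_graph ((\<lambda>x. (x, \<phi> x)) ` E)"
proof -
  let ?g = "(\<lambda>x. (x, \<phi> x)) ` E"
  have mem: "(x, y) \<in> ?g \<longleftrightarrow> x \<in> E \<and> y = \<phi> x" for x y
    by auto
  have E: "to_ac c \<in> E" "x \<in> E \<Longrightarrow> y \<in> E \<Longrightarrow> x + y \<in> E \<and> x * y \<in> E" for c x y
    using base_hom_domain[OF assms] by (auto simp: intermediate_ring_def)
  show ?thesis
    unfolding hom_graph_def single_valued_def
  proof (intro conjI allI)
    show "(to_ac c, to_ac c) \<in> ?g" for c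
      unfolding mem using E(1) base_hom_to_ac[OF assms] by metis
    show "\<forall>(x, x')\<in>?g. \<forall>(y, y')\<in>?g. (x + y, x' + y') \<in> ?g \<and> (x * y, x' * y') \<in> ?g"
    proof (intro ballI, clarify)
      fix x y assume "x \<in> E" "y \<in> E"
      then show "(x + y, \<phi> x + \<phi> y) \<in> ?g \<and> (x * y, \<phi> x * \<phi> y) \<in> ?g"
        unfolding mem using E(2) base_hom_add[OF assms] base_hom_mult[OF assms] by simp
    qed
  qed auto
qed

lemma base_hom_hom_graph:
  assumes g: "hom_graph g"
  shows "\<exists>\<phi>. base_hom (Domain g) \<phi> \<and> g = (\<lambda>x. (x, \<phi> x)) ` Domain g"
proof -
  define \<phi> where "\<phi> x = (THE y. (x, y) \<in> g)" for x
  have \<phi>: "\<phi> x = y" if "(x, y) \<in> g" for x y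
    unfolding \<phi>_def using g that by (intro the_equality) (auto simp: hom_graph_def single_valued_def)
  have in_g: "(x, \<phi> x) \<in> g" if "x \<in> Domain g" for x
    using that \<phi> by auto
  have cl: "(x + y, \<phi> x + \<phi> y) \<in> g" "(x * y, \<phi> x * \<phi> y) \<in> g"
    if "x \<in> Domain g" "y \<in> Domain g" for x y
    using g in_g[OF that(1)] in_g[OF that(2)] unfolding hom_graph_def by auto
  have c: "(to_ac c, to_ac c) \<in> g" for c
    using g unfolding hom_graph_def by auto
  have "g = (\<lambda>x. (x, \<phi> x)) ` Domain g"
    using \<phi> in_g by (auto simp: image_iff)
  moreover have "intermediate_ring (Domain g)"
    unfolding intermediate_ring_def using DomainI[OF c] DomainI[OF cl(1)] DomainI[OF cl(2)] by blast
  then have "base_hom (Domain g) \<phi>"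
    unfolding base_hom_def using \<phi>[OF c] \<phi>[OF cl(1)] \<phi>[OF cl(2)] by blast
  ultimately show ?thesis by blast
qed

text \<open>Zorn's lemma gives a maximal graph. For any \<open>z\<close>, algebraic closedness
  supplies a root of the image of the minimal polynomial of \<open>z\<close> over the domain, so one
  more step extends the graph to \<open>z\<close>; by maximality \<open>z\<close> was in the domain
  already.\<close>

lemma base_hom_extend:
  assumes hom: "base_hom E \<phi>"
  shows "\<exists>\<sigma>. base_hom UNIV \<sigma> \<and> (\<forall>x\<in>E. \<sigma> x = \<phi> x)"
proof -
  let ?g = "(\<lambda>x. (x, \<phi> x)) ` E"
  let ?A = "{g. hom_graph g \<and> ?g \<subseteq> g}"
  have "\<exists>M\<in>?A. \<forall>h\<in>?A. M \<subseteq> h \<longrightarrow> h = M"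
  proof (rule subset_Zorn_nonempty)
    show "?A \<noteq> {}" using hom_graph_base_hom[OF hom] by blast
    fix C assume C: "C \<noteq> {}" "subset.chain ?A C"
    \<comment> \<open>Two pairs from the union already lie in one member of the chain, from which
      every closure condition is inherited.\<close>
    have pair: "\<exists>h\<in>C. u \<in> h \<and> v \<in> h" if "u \<in> \<Union>C" "v \<in> \<Union>C" for u v
      using that C(2) unfolding subset_chain_def by blast
    have h: "hom_graph h" if "h \<in> C" for h
      using that C(2) by (auto simp: subset_chain_def)
    have "hom_graph (\<Union>C)"
      unfolding hom_graph_def
    proof (intro conjI allI)
      show "single_valued (\<Union>C)"
        unfolding single_valued_def
      proof safe
        fix x y z' h1 h2 assume "(x, y) \<in> h1" "h1 \<in> C" "(x, z') \<in> h2" "h2 \<in> C"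
        then obtain k where "k \<in> C" "(x, y) \<in> k" "(x, z') \<in> k" using pair by blast
        then show "y = z'" using h[of k] unfolding hom_graph_def single_valued_def by blast
      qed
      show "(to_ac c, to_ac c) \<in> \<Union>C" for c
        using C(1) h unfolding hom_graph_def by blast
      show "\<forall>(x, x')\<in>\<Union>C. \<forall>(y, y')\<in>\<Union>C. (x + y, x' + y') \<in> \<Union>C \<and> (x * y, x' * y') \<in> \<Union>C"
      proof safe
        fix x x' y y' h1 h2 assume "(x, x') \<in> h1" "h1 \<in> C" "(y, y') \<in> h2" "h2 \<in> C"
        then obtain k where "k \<in> C" "(x, x') \<in> k" "(y, y') \<in> k" using pair by blast
        then have "k \<in> C" "(x + y, x' + y') \<in> k" "(x * y, x' * y') \<in> k"
          using h[of k] unfolding hom_graph_def by auto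
        then show "(x + y, x' + y') \<in> \<Union>C" "(x * y, x' * y') \<in> \<Union>C" by blast+
      qed
    qed
    then show "\<Union>C \<in> ?A" using C unfolding subset_chain_def by blast
  qed
  then obtain g where "g \<in> ?A" and max': "\<forall>h\<in>?A. g \<subseteq> h \<longrightarrow> h = g" ..
  then have g: "hom_graph g" "?g \<subseteq> g" by simp_all
  have max: "k = g" if "hom_graph k" "g \<subseteq> k" for k
    using max' that g(2) by (metis (no_types, lifting) mem_Collect_eq subset_trans)
  obtain \<psi> where \<psi>: "base_hom (Domain g) \<psi>" and g_eq: "g = (\<lambda>x. (x, \<psi> x)) ` Domain g"
    using base_hom_hom_graph[OF g(1)] by blast
  have g_mem: "y = \<psi> x" if "(x, y) \<in> g" for x y
    using that by (subst (asm) g_eq) auto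
  note D = base_hom_domain[OF \<psi>]
  have "z \<in> Domain g" for z
  proof -
    obtain p where p: "min_poly_over (Domain g) z p" using min_poly_over_exists[OF D] by blast
    have lc: "Polynomial.lead_coeff p = 1" and pz: "poly p z = 0"
      using p by (auto simp: min_poly_over_def)
    have "Polynomial.degree p \<noteq> 0"
    proof
      assume "Polynomial.degree p = 0"
      then obtain c where "p = [:c:]" by (rule degree_eq_zeroE)
      then show False using lc pz by simp
    qed
    \<comment> \<open>\<open>\<psi>\<close> keeps the leading coefficient 1, so the image polynomial
      is not constant and has a root.\<close>
    moreover have "Polynomial.coeff (map_poly \<psi> p) (Polynomial.degree p) = 1"
      using lc by (simp add: coeff_map_poly_base_hom[OF \<psi>] base_hom_1[OF \<psi>])
    ultimately have "Polynomial.degree (map_poly \<psi> p) > 0"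
      using le_degree[of "map_poly \<psi> p" "Polynomial.degree p"] by simp
    then obtain z' where "poly (map_poly \<psi> p) z' = 0"
      using alg_closed_imp_poly_has_root by blast
    then obtain \<psi>' where \<psi>': "base_hom (adjoin (Domain g) z) \<psi>'" "\<forall>x\<in>Domain g. \<psi>' x = \<psi> x"
      using base_hom_extend_step[OF \<psi> p] by blast
    have "g \<subseteq> (\<lambda>x. (x, \<psi>' x)) ` adjoin (Domain g) z"
    proof clarify
      fix x y assume xy: "(x, y) \<in> g"
      then have "x \<in> Domain g" by blast
      then have "x \<in> adjoin (Domain g) z" "y = \<psi>' x"
        using subset_adjoin[OF D, of z] g_mem[OF xy] \<psi>'(2) by auto
      then show "(x, y) \<in> (\<lambda>x. (x, \<psi>' x)) ` adjoin (Domain g) z" by simp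
    qed
    then have "(\<lambda>x. (x, \<psi>' x)) ` adjoin (Domain g) z = g"
      by (rule max[OF hom_graph_base_hom[OF \<psi>'(1)]])
    then show ?thesis using self_in_adjoin[OF D, of z] by blast
  qed
  then have "Domain g = UNIV" by blast
  then have "base_hom UNIV \<psi>" using \<psi> by simp
  moreover have "\<psi> x = \<phi> x" if "x \<in> E" for x
  proof -
    have "(x, \<phi> x) \<in> g" using g(2) that by blast
    then show ?thesis using g_mem by metis
  qed
  ultimately show ?thesis by blast
qed

lemma min_poly_over_conjugate:
  assumes E: "intermediate_ring E" and p: "min_poly_over E z p" and z': "poly p z' = 0"
  shows "\<exists>\<sigma>. base_hom UNIV \<sigma> \<and> (\<forall>x\<in>E. \<sigma> x = x) \<and> \<sigma> z = z'"
proof -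
  have "base_hom E (\<lambda>x. x)" using E by (simp add: base_hom_def)
  then obtain \<psi> where \<psi>: "base_hom (adjoin E z) \<psi>" "\<psi> z = z'" "\<forall>x\<in>E. \<psi> x = x"
    using base_hom_extend_step[of E "\<lambda>x. x" z p z'] p z' by (auto simp: map_poly_idI)
  then show ?thesis
    using base_hom_extend[OF \<psi>(1)] self_in_adjoin[OF E] subset_adjoin[OF E]
    by (metis subsetD)
qed

section \<open>Fixed elements of separable extensions\<close>

lemma card_roots_of_separable_divisor:
  fixes u p :: "'a::field poly"
  assumes "finite S" "u * p = (\<Prod>s\<in>S. [:-s, 1:])"
  shows "card {s. poly p s = 0} = Polynomial.degree p"
proof -
  have ne: "u * p \<noteq> 0" using assms by (auto simp: prod_zero_iff)
  then have fin: "finite {s. poly p s = 0}" "finite {s. poly u s = 0}"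
    by (auto intro!: poly_roots_finite)
  have "S \<subseteq> {s. poly u s = 0} \<union> {s. poly p s = 0}"
  proof
    fix s assume "s \<in> S"
    then have "poly (u * p) s = 0" using assms by (auto simp: poly_prod prod_zero_iff)
    then show "s \<in> {s. poly u s = 0} \<union> {s. poly p s = 0}" by auto
  qed
  \<comment> \<open>The roots of \<open>u\<close> and \<open>p\<close> cover \<open>S\<close>, and
    \<open>card S\<close> is the sum of the two degrees, so neither polynomial can have fewer roots
    than its degree.\<close>
  then have "card S \<le> card {s. poly u s = 0} + card {s. poly p s = 0}"
    using fin by (meson card_Un_le card_mono finite_UnI le_trans)
  moreover have "card S = Polynomial.degree u + Polynomial.degree p"
  proof -
    have "card S = Polynomial.degree (u * p)"
      unfolding assms(2) by (subst degree_prod_eq_sum_degree) auto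
    then show ?thesis using ne by (subst (asm) degree_mult_eq) auto
  qed
  moreover have "card {s. poly u s = 0} \<le> Polynomial.degree u"
    "card {s. poly p s = 0} \<le> Polynomial.degree p"
    using ne by (auto intro!: card_poly_roots_bound)
  ultimately show ?thesis by simp
qed

text \<open>Write \<open>w\<close> as \<open>poly r t\<close> with \<open>r\<close> of degree below
  that of the minimal polynomial \<open>p\<close> of \<open>t\<close>. Every root of
  \<open>p\<close> is an image of \<open>t\<close> over \<open>E\<close>, so
  \<open>r - [:w:]\<close> vanishes at all of them. By separability there are as many as the degree
  of \<open>p\<close>, so \<open>r\<close> is the constant \<open>w\<close>.\<close>

lemma adjoin_separable_fixed:
  assumes E: "intermediate_ring E" and t: "separable t" and w: "w \<in> adjoin E t"
    and fixed: "\<And>\<sigma>. base_hom UNIV \<sigma> \<Longrightarrow> \<forall>x\<in>E. \<sigma> x = x \<Longrightarrow> \<sigma> w = w"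
  shows "w \<in> E"
proof -
  obtain p where p: "min_poly_over E t p" using min_poly_over_exists[OF E] by blast
  obtain S f where S: "finite S" "t \<in> S" "map_poly to_ac f = (\<Prod>s\<in>S. [:-s, 1:])"
    using t by (auto simp: separable_def)
  have "poly (map_poly to_ac f) t = 0" using S by (auto simp: poly_prod prod_zero_iff)
  then obtain u where "map_poly to_ac f = u * p"
    using min_poly_over_dvd[OF E p polys_over_map_poly_to_ac[OF E]] by blast
  then have card: "card {s. poly p s = 0} = Polynomial.degree p"
    using card_roots_of_separable_divisor[of S u p] S by simp
  have p0: "p \<noteq> 0" and pt: "poly p t = 0" using p by (auto simp: min_poly_over_def)
  obtain q where q: "q \<in> polys_over E" "w = poly q t" using w by (auto simp: adjoin_def)
  obtain v r where vr: "v \<in> polys_over E" "r \<in> polys_over E" "q = v * p + r"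
    "r = 0 \<or> Polynomial.degree r < Polynomial.degree p"
    using monic_division[OF E, of p q] p q by (auto simp: min_poly_over_def)
  have wr: "w = poly r t" using q vr p by (simp add: min_poly_over_def)
  have "poly (r - [:w:]) s = 0" if s: "poly p s = 0" for s
  proof -
    obtain \<sigma> where \<sigma>: "base_hom UNIV \<sigma>" "\<forall>x\<in>E. \<sigma> x = x" "\<sigma> t = s"
      using min_poly_over_conjugate[OF E p s] by blast
    have "map_poly \<sigma> r = r"
      using \<sigma>(2) vr(2) by (intro poly_eqI) (simp add: coeff_map_poly_base_hom[OF \<sigma>(1)] polys_over_def)
    then have "\<sigma> w = poly r s"
      using base_hom_poly[OF \<sigma>(1), of r t] \<sigma>(3) by (simp add: wr polys_over_def)
    then show ?thesis using fixed[OF \<sigma>(1,2)] by simp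
  qed
  then have sub: "{s. poly p s = 0} \<subseteq> {s. poly (r - [:w:]) s = 0}" by blast
  have "card {s. poly p s = 0} > 0"
    using pt poly_roots_finite[OF p0] by (auto simp: card_gt_0_iff)
  then have "Polynomial.degree (r - [:w:]) < Polynomial.degree p"
    using vr(4) card by (intro degree_diff_less) auto
  have "r - [:w:] = 0"
  proof (rule ccontr)
    assume "r - [:w:] \<noteq> 0"
    then have "card {s. poly p s = 0} \<le> Polynomial.degree (r - [:w:])"
      using card_mono[OF poly_roots_finite sub] card_poly_roots_bound le_trans by blast
    then show False using card \<open>Polynomial.degree (r - [:w:]) < Polynomial.degree p\<close> by simp
  qed
  then have "w = Polynomial.coeff r 0" by (metis coeff_pCons_0 eq_iff_diff_eq_0)
  then show ?thesis using vr(2) by (simp add: polys_over_def)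
qed

text \<open>The elements of \<open>T\<close> are adjoined one at a time, and a fixed
  \<open>w\<close> descends through the tower: maps that fix \<open>adjoin E t\<close> also fix
  \<open>E\<close>, so the induction hypothesis puts \<open>w\<close> into
  \<open>adjoin E t\<close>, and \<open>adjoin_separable_fixed\<close> brings it down to
  \<open>E\<close>.\<close>

lemma separable_extension_fixed:
  assumes "finite T" "\<forall>t\<in>T. separable t" "intermediate_ring E"
  shows "\<exists>E'. intermediate_ring E' \<and> E \<subseteq> E' \<and> T \<subseteq> E' \<and>
    (\<forall>w\<in>E'. (\<forall>\<sigma>. base_hom UNIV \<sigma> \<longrightarrow> (\<forall>x\<in>E. \<sigma> x = x) \<longrightarrow> \<sigma> w = w) \<longrightarrow> w \<in> E)"
  using assms
proof (induction T arbitrary: E rule: finite_induct)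
  case (insert t T)
  note E = insert.prems(2)
  have "\<exists>E'. intermediate_ring E' \<and> adjoin E t \<subseteq> E' \<and> T \<subseteq> E' \<and>
    (\<forall>w\<in>E'. (\<forall>\<sigma>. base_hom UNIV \<sigma> \<longrightarrow> (\<forall>x\<in>adjoin E t. \<sigma> x = x) \<longrightarrow> \<sigma> w = w) \<longrightarrow> w \<in> adjoin E t)"
    using insert.prems by (intro insert.IH intermediate_ring_adjoin) auto
  then obtain E' where E': "intermediate_ring E'" "adjoin E t \<subseteq> E'" "T \<subseteq> E'"
    "\<And>w. w \<in> E' \<Longrightarrow> (\<And>\<sigma>. base_hom UNIV \<sigma> \<Longrightarrow> \<forall>x\<in>adjoin E t. \<sigma> x = x \<Longrightarrow> \<sigma> w = w) \<Longrightarrow> w \<in> adjoin E t"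
    by auto
  have "w \<in> E" if w: "w \<in> E'" "\<And>\<sigma>. base_hom UNIV \<sigma> \<Longrightarrow> \<forall>x\<in>E. \<sigma> x = x \<Longrightarrow> \<sigma> w = w" for w
  proof (rule adjoin_separable_fixed[OF E])
    show "separable t" using insert.prems by auto
    show "w \<in> adjoin E t"
      using E'(4)[OF w(1)] w(2) subset_adjoin[OF E, of t] by (meson subsetD)
  qed (use w in auto)
  then show ?case
    using E' self_in_adjoin[OF E] subset_adjoin[OF E, of t] by (intro exI[of _ E']) auto
qed auto

section \<open>Splitting fields and Galois orbits\<close>

lemma map_poly_to_ac_prod_mset:
  "map_poly to_ac (prod_mset hs) = (\<Prod>h\<in>#hs. map_poly to_ac h)"
  by (induction hs) (simp_all add: map_poly_to_ac_mult)

lemma intermediate_ring_base_field: "intermediate_ring base_field"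
  unfolding intermediate_ring_def by (auto simp flip: to_ac_add to_ac_mult)

lemma Cl_simps:
  "monoid.mult Cl = (*)" "ring.add Cl = (+)" "monoid.one Cl = 1" "ring.zero Cl = 0"
  "carrier Cl = UNIV"
  by (simp_all add: ring_of_type_algebra_def)

lemma Cl_a_inv: "\<ominus>\<^bsub>Cl\<^esub> x = - (x :: 'a::field alg_closure)"
proof -
  interpret cring "Cl :: 'a alg_closure ring" by (rule cring_from_type_algebra)
  show ?thesis by (rule minus_equality) (auto simp: Cl_simps)
qed

lemma Cl_m_inv: "(x :: 'a::field alg_closure) \<noteq> 0 \<Longrightarrow> inv\<^bsub>Cl\<^esub> x = inverse x"
proof -
  interpret cring "Cl :: 'a alg_closure ring" by (rule cring_from_type_algebra)
  show "x \<noteq> 0 \<Longrightarrow> inv\<^bsub>Cl\<^esub> x = inverse x"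
    by (rule comm_inv_char) (auto simp: Cl_simps)
qed

lemma intermediate_ring_generate_field:
  assumes "base_field \<subseteq> H"
  shows "intermediate_ring (generate_field Cl H)"
  using assms generate_field.eng_add[of _ Cl H] generate_field.eng_mult[of _ Cl H]
    generate_field.incl[of _ H Cl]
  by (auto simp: intermediate_ring_def Cl_simps)

lemma generate_field_subset:
  assumes E: "intermediate_ring E" and "H \<subseteq> E"
  shows "generate_field Cl H \<subseteq> E"
proof
  fix x assume "x \<in> generate_field Cl H"
  then show "x \<in> E"
  proof induction
    case (m_inv h)
    then show ?case
      using intermediate_ring_inverse[OF E] by (simp add: Cl_m_inv Cl_simps)
  qed (use assms intermediate_ring_1[OF E] intermediate_ring_uminus[OF E] in
      \<open>auto simp: Cl_simps Cl_a_inv intermediate_ring_add intermediate_ring_mult\<close>)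
qed

lemma generate_field_separable_fixed:
  assumes "intermediate_ring E" "finite T" "\<forall>t\<in>T. separable t"
    and "w \<in> generate_field Cl (E \<union> T)"
    and "\<And>\<sigma>. base_hom UNIV \<sigma> \<Longrightarrow> \<forall>x\<in>E. \<sigma> x = x \<Longrightarrow> \<sigma> w = w"
  shows "w \<in> E"
proof -
  obtain E' where E': "intermediate_ring E'" "E \<subseteq> E'" "T \<subseteq> E'"
    "\<forall>w\<in>E'. (\<forall>\<sigma>. base_hom UNIV \<sigma> \<longrightarrow> (\<forall>x\<in>E. \<sigma> x = x) \<longrightarrow> \<sigma> w = w) \<longrightarrow> w \<in> E"
    using separable_extension_fixed[OF assms(2,3,1)] by blast
  then have "w \<in> E'" using generate_field_subset[OF E'(1), of "E \<union> T"] assms(4) by blast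
  then show ?thesis using E'(4) assms(5) by blast
qed

text \<open>The set on which two homomorphisms agree is an intermediate ring.\<close>

lemma base_hom_eq_on_generate_field:
  assumes \<sigma>: "base_hom UNIV \<sigma>" and \<tau>: "base_hom UNIV \<tau>" and "\<forall>x\<in>H. \<sigma> x = \<tau> x"
  shows "\<forall>x\<in>generate_field Cl H. \<sigma> x = \<tau> x"
proof -
  have "intermediate_ring {x. \<sigma> x = \<tau> x}"
    unfolding intermediate_ring_def
    by (auto simp: base_hom_to_ac[OF \<sigma>] base_hom_to_ac[OF \<tau>] base_hom_add[OF \<sigma>]
        base_hom_add[OF \<tau>] base_hom_mult[OF \<sigma>] base_hom_mult[OF \<tau>])
  from generate_field_subset[OF this, of H] show ?thesis using assms(3) by blast
qed

lemma base_hom_fixes_generate_field: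
  assumes "base_hom UNIV \<sigma>" and "\<forall>x\<in>H. \<sigma> x = x"
  shows "\<forall>x\<in>generate_field Cl (base_field \<union> H). \<sigma> x = x"
proof -
  have "base_hom UNIV (\<lambda>x. x)" by (simp add: base_hom_def intermediate_ring_def)
  moreover have "\<forall>x\<in>base_field \<union> H. \<sigma> x = x"
    using assms base_hom_to_ac[OF assms(1)] by auto
  ultimately show ?thesis using base_hom_eq_on_generate_field[OF assms(1)] by blast
qed

lemma base_hom_id: "base_hom UNIV (\<lambda>x. x)"
  by (simp add: base_hom_def intermediate_ring_def)

lemma base_hom_comp: "base_hom UNIV \<sigma> \<Longrightarrow> base_hom UNIV \<tau> \<Longrightarrow> base_hom UNIV (\<lambda>x. \<sigma> (\<tau> x))"
  by (simp add: base_hom_def)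

section \<open>Galois groups of splitting fields\<close>

lemma base_hom_image_roots:
  assumes \<sigma>: "base_hom UNIV \<sigma>" and "f \<noteq> 0"
  shows "\<sigma> ` roots_in_closure f = roots_in_closure f"
proof (rule endo_inj_surj)
  have "map_poly to_ac f \<noteq> 0" using \<open>f \<noteq> 0\<close> by (simp add: map_poly_eq_0_iff)
  then show "finite (roots_in_closure f)" by (rule poly_roots_finite)
  show "\<sigma> ` roots_in_closure f \<subseteq> roots_in_closure f" using base_hom_root[OF \<sigma>] by auto
  show "inj_on \<sigma> (roots_in_closure f)"
    using base_hom_inj_on[OF \<sigma>] by (rule inj_on_subset) simp
qed

lemma subset_generate_field: "H \<subseteq> generate_field Cl H"
  by (rule subsetI) (rule generate_field.incl)

lemma roots_subset_Spl: "roots_in_closure f \<subseteq> Spl N f"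
  unfolding Spl_def using subset_generate_field by (rule order_trans[rotated]) simp

lemma intermediate_ring_Spl: "base_field \<subseteq> N \<Longrightarrow> intermediate_ring (Spl N f)"
  unfolding Spl_def by (rule intermediate_ring_generate_field) auto

text \<open>Normality: the preimage and the image of the splitting field under
  \<open>\<sigma>\<close> are both intermediate rings, and both contain the roots because
  \<open>\<sigma>\<close> permutes these.\<close>

lemma base_hom_image_Spl:
  assumes \<sigma>: "base_hom UNIV \<sigma>" and "f \<noteq> 0"
  shows "\<sigma> ` Spl base_field f = Spl base_field f"
proof
  let ?L = "Spl base_field f"
  have L: "intermediate_ring ?L"
    by (rule intermediate_ring_Spl) simp
  note roots = roots_subset_Spl[of f base_field]
  have 1: "intermediate_ring {x. \<sigma> x \<in> ?L}"
    using L unfolding intermediate_ring_def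
    by (auto simp: base_hom_to_ac[OF \<sigma>] base_hom_add[OF \<sigma>] base_hom_mult[OF \<sigma>])
  have "roots_in_closure f \<subseteq> {x. \<sigma> x \<in> ?L}"
    using roots base_hom_image_roots[OF assms] by blast
  then have "base_field \<union> roots_in_closure f \<subseteq> {x. \<sigma> x \<in> ?L}"
    using intermediate_ring_to_ac[OF 1] by blast
  then have "?L \<subseteq> {x. \<sigma> x \<in> ?L}"
    by (subst Spl_def) (rule generate_field_subset[OF 1])
  then show "\<sigma> ` ?L \<subseteq> ?L" by blast
  have 2: "intermediate_ring (\<sigma> ` ?L)"
    unfolding intermediate_ring_def
  proof (intro conjI ballI)
    show "base_field \<subseteq> \<sigma> ` ?L"
    proof clarify
      fix c
      have "\<sigma> (to_ac c) \<in> \<sigma> ` ?L" using intermediate_ring_to_ac[OF L] by (rule imageI)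
      then show "to_ac c \<in> \<sigma> ` ?L" by (simp add: base_hom_to_ac[OF \<sigma>])
    qed
    fix x y assume "x \<in> \<sigma> ` ?L" "y \<in> \<sigma> ` ?L"
    then obtain u v where uv: "u \<in> ?L" "v \<in> ?L" "x = \<sigma> u" "y = \<sigma> v" by blast
    have "\<sigma> (u + v) \<in> \<sigma> ` ?L" "\<sigma> (u * v) \<in> \<sigma> ` ?L"
      using uv intermediate_ring_add[OF L] intermediate_ring_mult[OF L] by blast+
    then show "x + y \<in> \<sigma> ` ?L" "x * y \<in> \<sigma> ` ?L"
      using uv by (simp_all add: base_hom_add[OF \<sigma>] base_hom_mult[OF \<sigma>])
  qed
  have "roots_in_closure f \<subseteq> \<sigma> ` ?L"
    using base_hom_image_roots[OF assms] roots by blast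
  then have "base_field \<union> roots_in_closure f \<subseteq> \<sigma> ` ?L"
    using intermediate_ring_to_ac[OF 2] by blast
  from generate_field_subset[OF 2 this] show "?L \<subseteq> \<sigma> ` ?L"
    by (subst (1) Spl_def)
qed

text \<open>Each automorphism of the splitting field extends to the closure, and each endomorphism
  of the closure restricts by normality. Both Galois groups thus become images of one and the same
  set of maps.\<close>

lemma carrier_Gal_Spl:
  assumes "f \<noteq> 0"
  shows "carrier (Gal (Spl base_field f)) =
    (\<lambda>\<sigma>. restrict \<sigma> (Spl base_field f)) ` {\<sigma>. base_hom UNIV \<sigma>}"
proof (intro equalityI subsetI)
  let ?L = "Spl base_field f"
  have L: "intermediate_ring ?L"
    by (rule intermediate_ring_Spl) simp
  fix \<sigma>
  {
    assume "\<sigma> \<in> carrier (Gal ?L)"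
    then have ext: "\<sigma> \<in> extensional ?L" and hom: "\<sigma> \<in> ring_hom (Cl\<lparr>carrier := ?L\<rparr>) (Cl\<lparr>carrier := ?L\<rparr>)"
      and fix_base: "\<forall>x\<in>base_field. \<sigma> x = x"
      by (auto simp: Gal_def Bij_def)
    have "base_hom ?L \<sigma>"
      using L ring_hom_add[OF hom] ring_hom_mult[OF hom] fix_base
      by (auto simp: base_hom_def Cl_simps)
    from base_hom_extend[OF this] obtain \<tau> where \<tau>: "base_hom UNIV \<tau>" "\<forall>x\<in>?L. \<tau> x = \<sigma> x"
      by blast
    have "\<sigma> = restrict \<tau> ?L"
      by (rule extensionalityI[OF ext]) (use \<tau>(2) in auto)
    then show "\<sigma> \<in> (\<lambda>\<sigma>. restrict \<sigma> ?L) ` {\<sigma>. base_hom UNIV \<sigma>}" using \<tau>(1) by blast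
  next
    assume "\<sigma> \<in> (\<lambda>\<sigma>. restrict \<sigma> ?L) ` {\<sigma>. base_hom UNIV \<sigma>}"
    then obtain \<tau> where \<tau>: "base_hom UNIV \<tau>" and \<sigma>: "\<sigma> = restrict \<tau> ?L" by blast
    have img: "\<tau> ` ?L = ?L" by (rule base_hom_image_Spl[OF \<tau> assms])
    have "inj_on \<tau> ?L" using base_hom_inj_on[OF \<tau>] by (rule inj_on_subset) simp
    then have "\<sigma> \<in> Bij ?L"
      unfolding \<sigma> Bij_def using img by (auto simp: bij_betw_def inj_on_def)
    moreover have "\<sigma> \<in> ring_hom (Cl\<lparr>carrier := ?L\<rparr>) (Cl\<lparr>carrier := ?L\<rparr>)"
      unfolding ring_hom_def \<sigma> using img intermediate_ring_add[OF L] intermediate_ring_mult[OF L]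
        intermediate_ring_1[OF L] base_hom_add[OF \<tau>] base_hom_mult[OF \<tau>] base_hom_1[OF \<tau>]
      by (auto simp: Cl_simps)
    moreover have "\<forall>x\<in>base_field. \<sigma> x = x"
      using intermediate_ring_to_ac[OF L] base_hom_to_ac[OF \<tau>] by (auto simp: \<sigma>)
    ultimately show "\<sigma> \<in> carrier (Gal ?L)" by (simp add: Gal_def)
  }
qed

lemma card_image_eq_card_image:
  assumes "\<And>x y. x \<in> A \<Longrightarrow> y \<in> A \<Longrightarrow> f x = f y \<longleftrightarrow> g x = g y"
  shows "card (f ` A) = card (g ` A)"
proof -
  define h where "h u = g (inv_into A f u)" for u
  have h: "h (f x) = g x" if "x \<in> A" for x
    unfolding h_def using that assms by (metis f_inv_into_f imageI inv_into_into)
  then have "g ` A = h ` f ` A" by (auto simp: image_iff)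
  moreover have "inj_on h (f ` A)"
    using assms h by (auto simp: inj_on_def)
  ultimately show ?thesis by (metis card_image)
qed

text \<open>\<open>g\<close> stands for any description of a homomorphism that distinguishes exactly
  as much as its values on the roots do; it is applied to \<open>root_perm\<close>.\<close>

lemma order_Gal_Spl:
  assumes "f \<noteq> 0"
    and "\<And>\<sigma> \<tau>. base_hom UNIV \<sigma> \<Longrightarrow> base_hom UNIV \<tau> \<Longrightarrow>
      g \<sigma> = g \<tau> \<longleftrightarrow> (\<forall>x\<in>roots_in_closure f. \<sigma> x = \<tau> x)"
  shows "Coset.order (Gal (Spl base_field f)) = card (g ` {\<sigma>. base_hom UNIV \<sigma>})"
  unfolding Coset.order_def carrier_Gal_Spl[OF assms(1)]
proof (rule card_image_eq_card_image)
  fix \<sigma> \<tau> :: "'a alg_closure \<Rightarrow> 'a alg_closure"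
  let ?L = "Spl base_field f"
  assume "\<sigma> \<in> {\<sigma>. base_hom UNIV \<sigma>}" "\<tau> \<in> {\<sigma>. base_hom UNIV \<sigma>}"
  then have st: "base_hom UNIV \<sigma>" "base_hom UNIV \<tau>" by auto
  have "restrict \<sigma> ?L = restrict \<tau> ?L \<longleftrightarrow> (\<forall>x\<in>?L. \<sigma> x = \<tau> x)"
    by (auto simp: restrict_def fun_eq_iff)
  also have "\<dots> \<longleftrightarrow> (\<forall>x\<in>roots_in_closure f. \<sigma> x = \<tau> x)"
  proof
    assume "\<forall>x\<in>?L. \<sigma> x = \<tau> x"
    then show "\<forall>x\<in>roots_in_closure f. \<sigma> x = \<tau> x"
      using roots_subset_Spl[of f base_field] by blast
  next
    assume "\<forall>x\<in>roots_in_closure f. \<sigma> x = \<tau> x"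
    then have "\<forall>x\<in>base_field \<union> roots_in_closure f. \<sigma> x = \<tau> x"
      using base_hom_to_ac[OF st(1)] base_hom_to_ac[OF st(2)] by auto
    then show "\<forall>x\<in>?L. \<sigma> x = \<tau> x"
      unfolding Spl_def by (rule base_hom_eq_on_generate_field[OF st])
  qed
  finally show "restrict \<sigma> ?L = restrict \<tau> ?L \<longleftrightarrow> g \<sigma> = g \<tau>"
    using assms(2)[OF st] by simp
qed

section \<open>Irreducible polynomials from Galois orbits\<close>

definition galois_orbit :: "'m::field alg_closure set \<Rightarrow> bool" where
  "galois_orbit Z \<longleftrightarrow> finite Z \<and> Z \<noteq> {} \<and>
     (\<forall>\<sigma>. base_hom UNIV \<sigma> \<longrightarrow> (\<forall>z\<in>Z. \<sigma> z \<in> Z)) \<and>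
     (\<forall>z\<in>Z. \<forall>z'\<in>Z. \<exists>\<sigma>. base_hom UNIV \<sigma> \<and> \<sigma> z = z')"

text \<open>Every homomorphism permutes the linear factors, so the coefficients are fixed and, by
  separability, lie in \<open>M\<close>. A factor over \<open>M\<close> with one root in
  \<open>Z\<close> has all of \<open>Z\<close> as roots by transitivity, hence full degree, which
  gives irreducibility.\<close>

lemma galois_orbit_poly:
  assumes orbit: "galois_orbit Z" and sep: "\<forall>z\<in>Z. separable z"
  shows "\<exists>h. Factorial_Ring.irreducible h \<and> Polynomial.degree h = card Z \<and>
    map_poly to_ac h = (\<Prod>z\<in>Z. [:-z, 1:])"
proof -
  let ?P = "\<lambda>Z. \<Prod>z\<in>Z. [:-z, 1:] :: 'a alg_closure poly"
  have fin: "finite Z" and ne: "Z \<noteq> {}"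
    and stable: "\<And>\<sigma> z. base_hom UNIV \<sigma> \<Longrightarrow> z \<in> Z \<Longrightarrow> \<sigma> z \<in> Z"
    and trans: "\<And>z z'. z \<in> Z \<Longrightarrow> z' \<in> Z \<Longrightarrow> \<exists>\<sigma>. base_hom UNIV \<sigma> \<and> \<sigma> z = z'"
    using orbit by (auto simp: galois_orbit_def)
  obtain E where E: "intermediate_ring E" "Z \<subseteq> E"
    and fixed: "\<And>w. w \<in> E \<Longrightarrow> (\<And>\<sigma>. base_hom UNIV \<sigma> \<Longrightarrow> \<sigma> w = w) \<Longrightarrow> w \<in> base_field"
    using separable_extension_fixed[OF fin sep intermediate_ring_base_field]
      by (metis (no_types, lifting))
  have P_E: "?P Z \<in> polys_over E"
    using fin E(2)
  proof (induction Z rule: finite_induct)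
    case empty
    show ?case
      using polys_over_map_poly_to_ac[OF E(1), of 1] by simp
  next
    case (insert z Z)
    then have "[:-z, 1:] \<in> polys_over E"
      using intermediate_ring_uminus[OF E(1)] intermediate_ring_1[OF E(1)] polys_over_0[OF E(1)]
      by (intro polys_over_pCons[OF E(1)]) auto
    then have "[:-z, 1:] * ?P Z \<in> polys_over E"
      using insert by (intro polys_over_mult[OF E(1)]) auto
    then show ?case using insert.hyps by (simp del: mult_pCons_left)
  qed
  have P_fixed: "map_poly \<sigma> (?P Z) = ?P Z" if \<sigma>: "base_hom UNIV \<sigma>" for \<sigma>
  proof -
    have "map_poly \<sigma> (?P Z) = (\<Prod>z\<in>Z. [:- \<sigma> z, 1:])"
      using fin
    proof (induction Z rule: finite_induct)
      case empty
      show ?case by (simp add: base_hom_1[OF \<sigma>])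
    next
      case (insert z Z)
      have "map_poly \<sigma> ([:-z, 1:] * ?P Z) = map_poly \<sigma> [:-z, 1:] * map_poly \<sigma> (?P Z)"
        by (rule map_poly_base_hom_mult[OF \<sigma>]) (simp_all add: polys_over_def)
      moreover have "map_poly \<sigma> [:-z, 1:] = [:- \<sigma> z, 1:]"
        by (simp add: map_poly_pCons base_hom_0[OF \<sigma>] base_hom_1[OF \<sigma>] base_hom_uminus[OF \<sigma>])
      ultimately show ?case using insert by (simp del: mult_pCons_left)
    qed
    also have "\<dots> = ?P (\<sigma> ` Z)"
      using base_hom_inj_on[OF \<sigma>]
      by (subst prod.reindex) (auto intro: inj_on_subset)
    also have "\<sigma> ` Z = Z"
      using fin stable[OF \<sigma>] base_hom_inj_on[OF \<sigma>]
      by (intro endo_inj_surj) (auto intro: inj_on_subset)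
    finally show ?thesis .
  qed
  have coeff: "Polynomial.coeff (?P Z) i \<in> base_field" for i
  proof (rule fixed)
    show "Polynomial.coeff (?P Z) i \<in> E" using P_E by (simp add: polys_over_def)
    fix \<sigma> :: "'a alg_closure \<Rightarrow> 'a alg_closure" assume \<sigma>: "base_hom UNIV \<sigma>"
    show "\<sigma> (Polynomial.coeff (?P Z) i) = Polynomial.coeff (?P Z) i"
      using arg_cong[OF P_fixed[OF \<sigma>], of "\<lambda>p. Polynomial.coeff p i"]
      by (simp add: coeff_map_poly_base_hom[OF \<sigma>])
  qed
  define h where "h = map_poly of_ac (?P Z)"
  have h: "map_poly to_ac h = ?P Z"
    by (rule poly_eqI) (simp add: h_def coeff_map_poly to_ac_of_ac[OF coeff])
  have deg: "Polynomial.degree h = card Z"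
  proof -
    have "Polynomial.degree h = Polynomial.degree (?P Z)" by (simp flip: h)
    also have "\<dots> = card Z" by (subst degree_prod_eq_sum_degree) auto
    finally show ?thesis .
  qed
  have roots: "poly (map_poly to_ac h) z = 0 \<longleftrightarrow> z \<in> Z" for z
    unfolding h using fin by (auto simp: poly_prod prod_zero_iff)
  have h0: "h \<noteq> 0" using deg fin ne by auto
  have "Factorial_Ring.irreducible h"
  proof (rule Factorial_Ring.irreducibleI[OF h0])
    show "\<not> h dvd 1" using deg fin ne by (auto simp: is_unit_iff_degree[OF h0])
    fix u v assume uv: "h = u * v"
    have u0: "u \<noteq> 0" and v0: "v \<noteq> 0" using uv h0 by auto
    have huv: "map_poly to_ac h = map_poly to_ac u * map_poly to_ac v"
      by (simp add: uv map_poly_to_ac_mult)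
    have full: "Polynomial.degree h \<le> Polynomial.degree w"
      if w: "w \<noteq> 0" "z \<in> Z" "poly (map_poly to_ac w) z = 0" for w z
    proof -
      have w0: "map_poly to_ac w \<noteq> 0" using w(1) by (simp add: map_poly_eq_0_iff)
      have "Z \<subseteq> {z. poly (map_poly to_ac w) z = 0}"
        using trans[OF w(2)] base_hom_root w(3) by fast
      then have "card Z \<le> Polynomial.degree (map_poly to_ac w)"
        using card_mono[OF poly_roots_finite[OF w0]] card_poly_roots_bound[OF w0] le_trans by blast
      then show ?thesis using deg by simp
    qed
    obtain z where z: "z \<in> Z" using ne by blast
    then have "poly (map_poly to_ac u) z = 0 \<or> poly (map_poly to_ac v) z = 0"
      using roots[of z] huv by simp
    moreover have "Polynomial.degree h = Polynomial.degree u + Polynomial.degree v"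
      unfolding uv by (rule degree_mult_eq[OF u0 v0])
    ultimately have "Polynomial.degree u = 0 \<or> Polynomial.degree v = 0"
      using full[OF u0 z] full[OF v0 z] by linarith
    then show "u dvd 1 \<or> v dvd 1"
      using is_unit_iff_degree[OF u0] is_unit_iff_degree[OF v0] by blast
  qed
  then show ?thesis using deg h by blast
qed

lemma has_factor_degrees_orbits:
  assumes "\<forall>Z\<in>#Zs. galois_orbit Z \<and> (\<forall>z\<in>Z. separable z)"
    and "map_poly to_ac f = (\<Prod>Z\<in>#Zs. \<Prod>z\<in>Z. [:-z, 1:])"
  shows "has_factor_degrees f (image_mset card Zs)"
proof -
  have "\<forall>Z\<in>set_mset Zs. \<exists>h. Factorial_Ring.irreducible h \<and> Polynomial.degree h = card Z \<and>
    map_poly to_ac h = (\<Prod>z\<in>Z. [:-z, 1:])"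
    using assms(1) galois_orbit_poly by blast
  then obtain h where h: "\<forall>Z\<in>set_mset Zs. Factorial_Ring.irreducible (h Z) \<and>
    Polynomial.degree (h Z) = card Z \<and> map_poly to_ac (h Z) = (\<Prod>z\<in>Z. [:-z, 1:])"
    by metis
  have "map_poly to_ac (\<Prod>Z\<in>#Zs. h Z) = (\<Prod>Z\<in>#Zs. map_poly to_ac (h Z))"
    by (simp add: map_poly_to_ac_prod_mset image_mset.compositionality o_def)
  also have "\<dots> = (\<Prod>Z\<in>#Zs. \<Prod>z\<in>Z. [:-z, 1:])"
    using h by (intro arg_cong[where f = prod_mset] image_mset_cong) blast
  finally have "f = (\<Prod>Z\<in>#Zs. h Z)" using assms(2) by (metis map_poly_to_ac_eq_iff)
  moreover have "image_mset Polynomial.degree (image_mset h Zs) = image_mset card Zs"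
    unfolding image_mset.compositionality using h by (intro image_mset_cong) auto
  ultimately show ?thesis
    unfolding has_factor_degrees_def using h by (intro exI[of _ "image_mset h Zs"]) auto
qed

section \<open>Subgroups of \<open>S\<^sub>3 \<times> S\<^sub>3\<close>\<close>

datatype idx3 = I0 | I1 | I2

text \<open>Constructors instead of functions turn identities and orbits in \<open>S_3\<close> into
  finite case distinctions. \<open>Swap0\<close>, \<open>Swap1\<close> and \<open>Swap2\<close> are
  named after the index that they fix.\<close>

datatype perm3 = Id3 | Rot1 | Rot2 | Swap0 | Swap1 | Swap2

lemma UNIV_idx3: "UNIV = {I0, I1, I2}"
  by (auto intro: idx3.exhaust)

lemma UNIV_perm3: "UNIV = {Id3, Rot1, Rot2, Swap0, Swap1, Swap2}"
  by (auto intro: perm3.exhaust)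

instance idx3 :: finite
  by standard (simp add: UNIV_idx3)

instance perm3 :: finite
  by standard (simp add: UNIV_perm3)

lemma all_idx3: "(\<forall>i. P i) \<longleftrightarrow> P I0 \<and> P I1 \<and> P I2"
  by (metis idx3.exhaust)

lemma all_perm3: "(\<forall>p. P p) \<longleftrightarrow> P Id3 \<and> P Rot1 \<and> P Rot2 \<and> P Swap0 \<and> P Swap1 \<and> P Swap2"
  by (metis perm3.exhaust)

lemma ex_perm3: "(\<exists>p. P p) \<longleftrightarrow> P Id3 \<or> P Rot1 \<or> P Rot2 \<or> P Swap0 \<or> P Swap1 \<or> P Swap2"
  by (metis perm3.exhaust)

fun act3 :: "perm3 \<Rightarrow> idx3 \<Rightarrow> idx3" where
  "act3 Id3 i = i"
| "act3 Rot1 i = (case i of I0 \<Rightarrow> I1 | I1 \<Rightarrow> I2 | I2 \<Rightarrow> I0)"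
| "act3 Rot2 i = (case i of I0 \<Rightarrow> I2 | I1 \<Rightarrow> I0 | I2 \<Rightarrow> I1)"
| "act3 Swap0 i = (case i of I0 \<Rightarrow> I0 | I1 \<Rightarrow> I2 | I2 \<Rightarrow> I1)"
| "act3 Swap1 i = (case i of I0 \<Rightarrow> I2 | I1 \<Rightarrow> I1 | I2 \<Rightarrow> I0)"
| "act3 Swap2 i = (case i of I0 \<Rightarrow> I1 | I1 \<Rightarrow> I0 | I2 \<Rightarrow> I2)"

text \<open>A permutation is determined by its values at \<open>I0\<close> and \<open>I1\<close>.
  The result carries no meaning for a map that is not injective.\<close>

definition perm3_of :: "(idx3 \<Rightarrow> idx3) \<Rightarrow> perm3" where
  "perm3_of f =
     (case f I0 of
        I0 \<Rightarrow> (if f I1 = I1 then Id3 else Swap0)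
      | I1 \<Rightarrow> (if f I1 = I2 then Rot1 else Swap2)
      | I2 \<Rightarrow> (if f I1 = I0 then Rot2 else Swap1))"

lemma act3_perm3_of:
  assumes "inj f"
  shows "act3 (perm3_of f) = f"
proof -
  have "f I0 \<noteq> f I1" "f I0 \<noteq> f I2" "f I1 \<noteq> f I2"
    using assms by (auto dest: injD)
  then have "\<forall>i. act3 (perm3_of f) i = f i"
    unfolding all_idx3
    by (cases "f I0"; cases "f I1"; cases "f I2") (simp_all add: perm3_of_def)
  then show ?thesis by (simp add: fun_eq_iff)
qed

lemma act3_inj: "act3 p = act3 q \<longleftrightarrow> p = q"
proof -
  have "perm3_of (act3 p) = p" for p
    by (cases p) (simp_all add: perm3_of_def)
  then show ?thesis by metis
qed

instantiation perm3 :: monoid_mult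
begin

definition one_perm3 :: perm3 where
  "one_perm3 = Id3"

definition times_perm3 :: "perm3 \<Rightarrow> perm3 \<Rightarrow> perm3" where
  "times_perm3 p q = perm3_of (\<lambda>i. act3 p (act3 q i))"

lemma inj_act3: "inj (act3 p)"
  unfolding inj_def all_idx3 by (cases p) simp_all

lemma act3_times: "act3 (p * q) i = act3 p (act3 q i)"
proof -
  have "inj (\<lambda>i. act3 p (act3 q i))"
    using inj_compose[OF inj_act3[of p] inj_act3[of q]] by (simp add: o_def)
  then show ?thesis unfolding times_perm3_def by (simp add: act3_perm3_of)
qed

instance
proof
  fix p q r :: perm3
  show "p * q * r = p * (q * r)" "1 * p = p" "p * 1 = p"
    by (simp_all add: act3_inj[symmetric] fun_eq_iff act3_times one_perm3_def)
qed

end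

lemma times_perm3_simps [simp]:
  "Id3 * p = p" "p * Id3 = p"
  "Rot1 * Rot1 = Rot2" "Rot1 * Rot2 = Id3" "Rot1 * Swap0 = Swap2" "Rot1 * Swap1 = Swap0" "Rot1 * Swap2 = Swap1"
  "Rot2 * Rot1 = Id3" "Rot2 * Rot2 = Rot1" "Rot2 * Swap0 = Swap1" "Rot2 * Swap1 = Swap2" "Rot2 * Swap2 = Swap0"
  "Swap0 * Rot1 = Swap1" "Swap0 * Rot2 = Swap2" "Swap0 * Swap0 = Id3" "Swap0 * Swap1 = Rot1" "Swap0 * Swap2 = Rot2"
  "Swap1 * Rot1 = Swap2" "Swap1 * Rot2 = Swap0" "Swap1 * Swap0 = Rot2" "Swap1 * Swap1 = Id3" "Swap1 * Swap2 = Rot1"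
  "Swap2 * Rot1 = Swap0" "Swap2 * Rot2 = Swap1" "Swap2 * Swap0 = Rot1" "Swap2 * Swap1 = Rot2" "Swap2 * Swap2 = Id3"
  by (simp_all add: act3_inj[symmetric] fun_eq_iff all_idx3 act3_times)

fun inv3 :: "perm3 \<Rightarrow> perm3" where
  "inv3 Rot1 = Rot2"
| "inv3 Rot2 = Rot1"
| "inv3 p = p"

definition even3 :: "perm3 set" where
  "even3 = {Id3, Rot1, Rot2}"

lemma even3_iff [simp]:
  "Id3 \<in> even3" "Rot1 \<in> even3" "Rot2 \<in> even3" "Swap0 \<notin> even3" "Swap1 \<notin> even3" "Swap2 \<notin> even3"
  by (simp_all add: even3_def)

lemma inv3_mult [simp]: "inv3 p * p = Id3" "p * inv3 p = Id3"
  by (cases p; simp)+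

lemma mult_even3: "p * q \<in> even3 \<longleftrightarrow> (p \<in> even3 \<longleftrightarrow> q \<in> even3)"
  by (cases p; cases q; simp)

lemma inv3_even3: "inv3 p \<in> even3 \<longleftrightarrow> p \<in> even3"
  by (cases p; simp)

text \<open>\<open>S_3\<close> has exponent 6. This makes sets closed under products closed under
  inverses, see \<open>subgroup33_inv\<close>.\<close>

lemma perm3_power5: "p * (p * (p * (p * p))) = inv3 p"
  by (cases p; simp)

lemma perm3_powers:
  "p \<in> even3 \<Longrightarrow> p * (p * p) = Id3" "p \<notin> even3 \<Longrightarrow> p * p = Id3"
  "p \<notin> even3 \<Longrightarrow> p * (p * p) = p" "p \<in> even3 \<Longrightarrow> p \<noteq> Id3 \<Longrightarrow> p * p \<noteq> Id3"
  "p \<in> even3 \<Longrightarrow> p * p \<in> even3"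
  by (cases p; simp)+

definition submonoid3 :: "perm3 set \<Rightarrow> bool" where
  "submonoid3 K \<longleftrightarrow> Id3 \<in> K \<and> (\<forall>p\<in>K. \<forall>q\<in>K. p * q \<in> K)"

text \<open>The order of a subgroup of \<open>S_3\<close> determines it, except for the choice of
  the transposition in order 2: one rotation gives the other, two transpositions give a rotation,
  and a rotation with one transposition gives all three.\<close>

lemma submonoid3_cases:
  assumes "submonoid3 K"
  shows "card K = 6 \<Longrightarrow> K = UNIV" "card K = 3 \<Longrightarrow> K = even3"
    "card K = 2 \<Longrightarrow> \<exists>t. t \<notin> even3 \<and> K = {Id3, t}" "card K = 1 \<Longrightarrow> K = {Id3}"
proof -
  have K: "Id3 \<in> K" "p \<in> K \<Longrightarrow> q \<in> K \<Longrightarrow> p * q \<in> K" for p q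
    using assms by (auto simp: submonoid3_def)
  have card: "card K = (\<Sum>p\<in>UNIV. if p \<in> K then 1 else 0)"
    by (simp add: sum.If_cases)
  have rot: "Rot1 \<in> K \<longleftrightarrow> Rot2 \<in> K"
    using K(2)[of Rot1 Rot1] K(2)[of Rot2 Rot2] by auto
  have swaps: "Swap0 \<in> K \<Longrightarrow> Swap1 \<in> K \<Longrightarrow> Rot1 \<in> K" "Swap0 \<in> K \<Longrightarrow> Swap2 \<in> K \<Longrightarrow> Rot1 \<in> K"
    "Swap1 \<in> K \<Longrightarrow> Swap2 \<in> K \<Longrightarrow> Rot1 \<in> K"
    using K(2)[of Swap0 Swap1] K(2)[of Swap2 Swap0] K(2)[of Swap1 Swap2] by auto
  have mixed: "Rot1 \<in> K \<Longrightarrow> (Swap0 \<in> K \<longleftrightarrow> Swap1 \<in> K) \<and> (Swap0 \<in> K \<longleftrightarrow> Swap2 \<in> K)"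
    using K(2)[of Rot1 Swap0] K(2)[of Rot1 Swap1] K(2)[of Rot1 Swap2] by auto
  have card6: "card K = of_bool (Id3 \<in> K) + of_bool (Rot1 \<in> K) + of_bool (Rot2 \<in> K)
      + of_bool (Swap0 \<in> K) + of_bool (Swap1 \<in> K) + of_bool (Swap2 \<in> K)"
    unfolding card UNIV_perm3 by simp
  have configurations:
    "Rot1 \<in> K \<and> Rot2 \<in> K \<and> Swap0 \<in> K \<and> Swap1 \<in> K \<and> Swap2 \<in> K \<or>
     Rot1 \<in> K \<and> Rot2 \<in> K \<and> Swap0 \<notin> K \<and> Swap1 \<notin> K \<and> Swap2 \<notin> K \<or>
     Rot1 \<notin> K \<and> Rot2 \<notin> K \<and> Swap0 \<in> K \<and> Swap1 \<notin> K \<and> Swap2 \<notin> K \<or>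
     Rot1 \<notin> K \<and> Rot2 \<notin> K \<and> Swap0 \<notin> K \<and> Swap1 \<in> K \<and> Swap2 \<notin> K \<or>
     Rot1 \<notin> K \<and> Rot2 \<notin> K \<and> Swap0 \<notin> K \<and> Swap1 \<notin> K \<and> Swap2 \<in> K \<or>
     Rot1 \<notin> K \<and> Rot2 \<notin> K \<and> Swap0 \<notin> K \<and> Swap1 \<notin> K \<and> Swap2 \<notin> K"
    using rot swaps mixed by metis
  have mem: "K = L \<longleftrightarrow> (\<forall>p. p \<in> K \<longleftrightarrow> p \<in> L)" for L
    by blast
  have "(card K = 6 \<longrightarrow> K = UNIV) \<and> (card K = 3 \<longrightarrow> K = even3) \<and>
    (card K = 2 \<longrightarrow> K = {Id3, Swap0} \<or> K = {Id3, Swap1} \<or> K = {Id3, Swap2}) \<and>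
    (card K = 1 \<longrightarrow> K = {Id3})"
    using configurations K(1) unfolding card6 mem all_perm3 by (elim disjE conjE) simp_all
  then show "card K = 6 \<Longrightarrow> K = UNIV" "card K = 3 \<Longrightarrow> K = even3"
    "card K = 2 \<Longrightarrow> \<exists>t. t \<notin> even3 \<and> K = {Id3, t}" "card K = 1 \<Longrightarrow> K = {Id3}"
    using even3_iff by blast+
qed

section \<open>Subgroups of the product with given projections\<close>

definition subgroup33 :: "(perm3 \<times> perm3) set \<Rightarrow> bool" where
  "subgroup33 H \<longleftrightarrow> (Id3, Id3) \<in> H \<and>
     (\<forall>(a, b)\<in>H. \<forall>(a', b')\<in>H. (a * a', b * b') \<in> H)"

text \<open>The group acts on \<^typ>\<open>perm3\<close> by \<open>(a, b) p = b p a\<inverse>\<close>; see \<open>theta_image\<close>.\<close>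

definition orbit33 :: "(perm3 \<times> perm3) set \<Rightarrow> perm3 set \<Rightarrow> bool" where
  "orbit33 H Z \<longleftrightarrow> Z \<noteq> {} \<and> (\<forall>(a, b)\<in>H. \<forall>p\<in>Z. b * p * inv3 a \<in> Z) \<and>
     (\<forall>p\<in>Z. \<forall>q\<in>Z. \<exists>(a, b)\<in>H. b * p * inv3 a = q)"

lemma subgroup33_converse: "subgroup33 H \<Longrightarrow> subgroup33 (H\<inverse>)"
  unfolding subgroup33_def by auto

context
  fixes H :: "(perm3 \<times> perm3) set"
  assumes H: "subgroup33 H"
begin

lemma subgroup33_one: "(Id3, Id3) \<in> H"
  using H by (simp add: subgroup33_def)

lemma subgroup33_mult: "(a, b) \<in> H \<Longrightarrow> (a', b') \<in> H \<Longrightarrow> (a * a', b * b') \<in> H"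
  using H by (auto simp: subgroup33_def)

lemma subgroup33_inv: "(a, b) \<in> H \<Longrightarrow> (inv3 a, inv3 b) \<in> H"
  unfolding perm3_power5[symmetric] by (intro subgroup33_mult)

text \<open>Cubing kills an even component and leaves an odd one unchanged, so a pair of mixed
  parity yields a pair with one trivial component.\<close>

lemma subgroup33_cube: "(a, b) \<in> H \<Longrightarrow> (a * (a * a), b * (b * b)) \<in> H"
  by (intro subgroup33_mult)

text \<open>Dividing \<open>(a, b')\<close> by \<open>(Id3, b')\<close> isolates
  \<open>(a, Id3)\<close>, and \<open>(Id3, b)\<close> then supplies any second component.\<close>

lemma subgroup33_Times:
  assumes "\<And>b. b \<in> snd ` H \<Longrightarrow> (Id3, b) \<in> H"
  shows "H = fst ` H \<times> snd ` H"
proof -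
  have "(a, b) \<in> H" if "a \<in> fst ` H" "b \<in> snd ` H" for a b
  proof -
    obtain b' where b': "(a, b') \<in> H" using \<open>a \<in> fst ` H\<close> by force
    then have "(Id3, inv3 b') \<in> H" using subgroup33_inv[of a b'] assms by force
    from subgroup33_mult[OF this b'] show ?thesis
      using subgroup33_mult[OF assms[OF \<open>b \<in> snd ` H\<close>] subgroup33_mult[OF \<open>(Id3, inv3 b') \<in> H\<close> b']]
      by simp
  qed
  then show ?thesis by force
qed

lemma subgroup33_even:
  assumes "(Id3, b) \<in> H" "b \<in> even3" "b \<noteq> Id3" "c \<in> even3"
  shows "(Id3, c) \<in> H"
proof -
  have "c = Id3 \<or> c = b \<or> c = b * b"
    using assms(2-4) by (cases b; cases c) simp_all
  then show ?thesis using subgroup33_mult[OF assms(1,1)] subgroup33_one assms(1) by auto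
qed

text \<open>The kernel of the first projection is normalised by the second projection, here all of
  \<open>S_3\<close>. All transpositions are conjugate there, and an even permutation is a product
  of two of them.\<close>

lemma subgroup33_all:
  assumes "(Id3, t) \<in> H" "t \<notin> even3" "snd ` H = UNIV"
  shows "(Id3, b) \<in> H"
proof -
  have odd: "(Id3, s) \<in> H" if s: "s \<notin> even3" for s
  proof -
    have "\<forall>s t. s \<notin> even3 \<longrightarrow> t \<notin> even3 \<longrightarrow> (\<exists>b. b * (t * inv3 b) = s)"
      unfolding all_perm3 ex_perm3 by simp
    then obtain b where b: "b * (t * inv3 b) = s" using s assms(2) by blast
    obtain a where a: "(a, b) \<in> H" using assms(3) by force
    have "(a * (Id3 * inv3 a), b * (t * inv3 b)) \<in> H"
      by (intro subgroup33_mult subgroup33_inv a assms(1))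
    then show ?thesis using b by simp
  qed
  show ?thesis
  proof (cases "b \<in> even3")
    case True
    then have "Swap0 * b \<notin> even3" by (simp add: mult_even3)
    from subgroup33_mult[OF odd[of Swap0] odd[OF this]] show ?thesis
      by (simp flip: mult.assoc)
  qed (rule odd)
qed

end

lemma image_converse [simp]: "fst ` (H\<inverse>) = snd ` H" "snd ` (H\<inverse>) = fst ` H"
  by force+

text \<open>The converse relation exchanges the two factors, so the primed lemmas are mirror images
  of the unprimed ones.\<close>

lemma subgroup33_Times':
  assumes H: "subgroup33 H" and "\<And>a. a \<in> fst ` H \<Longrightarrow> (a, Id3) \<in> H"
  shows "H = fst ` H \<times> snd ` H"
proof -
  have "H\<inverse> = fst ` (H\<inverse>) \<times> snd ` (H\<inverse>)"
    by (rule subgroup33_Times[OF subgroup33_converse[OF H]]) (use assms(2) in auto)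
  then have "H\<inverse> = snd ` H \<times> fst ` H" by simp
  then show ?thesis by (metis converse_converse converse_Times)
qed

lemma subgroup33_even':
  assumes "subgroup33 H" "(a, Id3) \<in> H" "a \<in> even3" "a \<noteq> Id3" "c \<in> even3"
  shows "(c, Id3) \<in> H"
  using subgroup33_even[OF subgroup33_converse[OF assms(1)], of a c] assms by simp

lemma subgroup33_all':
  assumes "subgroup33 H" "(t, Id3) \<in> H" "t \<notin> even3" "fst ` H = UNIV"
  shows "(a, Id3) \<in> H"
  using subgroup33_all[OF subgroup33_converse[OF assms(1)], of t a] assms by simp

lemma subgroup33_full:
  assumes "subgroup33 H" "(Id3, t) \<in> H" "t \<notin> even3" "fst ` H = UNIV" "snd ` H = UNIV"
  shows "H = UNIV"
  using subgroup33_Times[OF assms(1)] subgroup33_all[OF assms(1,2,3,5)] assms(4,5) by simp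

text \<open>The fibre product of two copies of \<open>S_3\<close> over the sign. A pair of even
  \<open>p\<close> and odd \<open>q\<close> would by cubing give \<open>(Id3, q)\<close>, which is
  excluded. A pair of odd \<open>p\<close> and even \<open>q\<close> could be corrected to
  \<open>(p, Id3)\<close>, whose conjugates generate the first factor, and \<open>H\<close> would be
  everything.\<close>

lemma subgroup33_same_parity:
  assumes H: "subgroup33 H" and fst: "fst ` H = UNIV" and snd: "snd ` H = UNIV"
    and no_odd: "\<And>t. (Id3, t) \<in> H \<Longrightarrow> t \<in> even3"
    and b: "(Id3, b) \<in> H" "b \<noteq> Id3"
  shows "H = {(p, q). p \<in> even3 \<longleftrightarrow> q \<in> even3}"
proof -
  have even: "(Id3, c) \<in> H" if "c \<in> even3" for c
    by (rule subgroup33_even[OF H b(1) no_odd[OF b(1)] b(2) that])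
  have parity: "p \<in> even3 \<longleftrightarrow> q \<in> even3" if pq: "(p, q) \<in> H" for p q
  proof (rule ccontr)
    assume ne: "\<not> (p \<in> even3 \<longleftrightarrow> q \<in> even3)"
    show False
    proof (cases "p \<in> even3")
      case True
      then have "(Id3, q) \<in> H"
        using subgroup33_cube[OF H pq] ne by (simp add: perm3_powers)
      then show False using no_odd True ne by blast
    next
      case False
      then have "(Id3, inv3 q) \<in> H" using ne by (intro even) (simp add: inv3_even3)
      from subgroup33_mult[OF H this pq] have "(p, Id3) \<in> H" by simp
      then have "(a, Id3) \<in> H" for a by (rule subgroup33_all'[OF H _ False fst])
      then have "H = UNIV" using subgroup33_Times'[OF H] fst snd by simp
      then show False using no_odd[of Swap0] by simp
    qed
  qed
  have "(p, q) \<in> H" if pq: "p \<in> even3 \<longleftrightarrow> q \<in> even3" for p q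
  proof -
    obtain r where r: "(p, r) \<in> H" using fst by (metis (no_types, lifting) UNIV_I image_iff prod.collapse)
    have "q * inv3 r \<in> even3" using parity[OF r] pq by (simp add: mult_even3 inv3_even3)
    from subgroup33_mult[OF H even[OF this] r] show ?thesis by (simp add: mult.assoc)
  qed
  then have "(p, q) \<in> H \<longleftrightarrow> (p \<in> even3 \<longleftrightarrow> q \<in> even3)" for p q
    using parity by blast
  then show ?thesis by auto
qed

text \<open>With both kernels trivial, \<open>H\<close> is the graph of an automorphism of
  \<open>S_3\<close>, and every automorphism of \<open>S_3\<close> is inner.\<close>

lemma subgroup33_conj:
  assumes H: "subgroup33 H" and fst: "fst ` H = UNIV"
    and "\<And>b. (Id3, b) \<in> H \<Longrightarrow> b = Id3" and "\<And>a. (a, Id3) \<in> H \<Longrightarrow> a = Id3"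
  shows "\<exists>r. H = {(p, q). q = r * p * inv3 r}"
proof -
  have unique: "q = q'" if "(p, q) \<in> H" "(p, q') \<in> H" for p q q'
  proof -
    have "(Id3, q' * inv3 q) \<in> H"
      using subgroup33_mult[OF H that(2) subgroup33_inv[OF H that(1)]] by simp
    then have "q' * inv3 q = Id3" by (rule assms(3))
    then have "q' * inv3 q * q = q" by simp
    then show ?thesis by (simp add: mult.assoc)
  qed
  have ex: "\<exists>q. (p, q) \<in> H" for p
    using fst by (metis (no_types, lifting) UNIV_I image_iff prod.collapse)
  obtain c where c: "(Rot1, c) \<in> H" using ex by blast
  obtain s where s: "(Swap0, s) \<in> H" using ex by blast
  have "c * (c * c) = Id3"
    using subgroup33_cube[OF H c] assms(3) by simp
  moreover have "c \<noteq> Id3" using c assms(4) by force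
  ultimately have c': "c = Rot1 \<or> c = Rot2" by (cases c) simp_all
  have "s * s = Id3"
    using subgroup33_mult[OF H s s] assms(3) by simp
  moreover have "s \<noteq> Id3" using s assms(4) by force
  ultimately have s': "s = Swap0 \<or> s = Swap1 \<or> s = Swap2" by (cases s) simp_all
  \<comment> \<open>There are six possible pairs \<open>(c, s)\<close>. As \<open>S_3\<close> has
    trivial centre and is generated by \<open>Rot1\<close> and \<open>Swap0\<close>, the six
    conjugations produce six different pairs, hence all of them.\<close>
  have "\<exists>r. c = r * Rot1 * inv3 r \<and> s = r * Swap0 * inv3 r"
    unfolding ex_perm3 using c' s' by auto
  then obtain r where r: "c = r * Rot1 * inv3 r" "s = r * Swap0 * inv3 r" by blast
  let ?\<phi> = "\<lambda>p. r * p * inv3 r"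
  have hom: "?\<phi> p * ?\<phi> q = ?\<phi> (p * q)" for p q
  proof -
    have "?\<phi> p * ?\<phi> q = r * p * (inv3 r * r) * q * inv3 r" by (simp only: mult.assoc)
    then show ?thesis by (simp add: mult.assoc)
  qed
  have mult: "(p * q, ?\<phi> (p * q)) \<in> H" if "(p, ?\<phi> p) \<in> H" "(q, ?\<phi> q) \<in> H" for p q
    using subgroup33_mult[OF H that] by (simp add: hom)
  have 1: "(Rot1, ?\<phi> Rot1) \<in> H" "(Swap0, ?\<phi> Swap0) \<in> H" using c s r by simp_all
  have 2: "(Rot2, ?\<phi> Rot2) \<in> H" "(Swap2, ?\<phi> Swap2) \<in> H" "(Id3, ?\<phi> Id3) \<in> H"
    using mult[OF 1(1) 1(1)] mult[OF 1] subgroup33_one[OF H] by simp_all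
  have 3: "(Swap1, ?\<phi> Swap1) \<in> H"
    using mult[OF 2(1) 1(2)] by simp
  have "(p, ?\<phi> p) \<in> H" for p by (cases p) (use 1 2 3 in simp_all)
  then have "(p, q) \<in> H \<longleftrightarrow> q = ?\<phi> p" for p q using unique by metis
  then have "H = {(p, q). q = ?\<phi> p}" by auto
  then show ?thesis by blast
qed

text \<open>\<open>S_3\<close> has no quotient of order 3 that the two factors could share.
  Concretely, squaring a pair with odd first and nontrivial second component gives
  \<open>(Id3, q * q)\<close>, whose second component generates \<open>even3\<close>.\<close>

lemma subgroup33_UNIV_even:
  assumes H: "subgroup33 H" and fst: "fst ` H = UNIV" and snd: "snd ` H = even3"
  shows "H = UNIV \<times> even3"
proof -
  have snd_even: "q \<in> even3" if "(p, q) \<in> H" for p q using snd that by force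
  have odd: "(Id3, c) \<in> H" if pq: "(p, q) \<in> H" "p \<notin> even3" "q \<noteq> Id3" "c \<in> even3" for p q c
  proof (rule subgroup33_even[OF H _ _ _ pq(4)])
    show "(Id3, q * q) \<in> H" 
      using subgroup33_mult[OF H pq(1,1)] pq(2) by (simp add: perm3_powers)
    show "q * q \<in> even3" "q * q \<noteq> Id3"
      using snd_even[OF pq(1)] pq(3) by (simp_all add: perm3_powers)
  qed
  have "Rot1 \<in> snd ` H" "Swap0 \<in> fst ` H" using fst snd by simp_all
  then obtain p q where p: "(p, Rot1) \<in> H" and q: "(Swap0, q) \<in> H" by force
  have "(Id3, c) \<in> H" if c: "c \<in> even3" for c
  \<comment> \<open>In this case neither of the two pairs has an odd first and a nontrivial second
    component, but their product has.\<close>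
  proof (cases "p \<in> even3 \<and> q = Id3")
    case True
    then show ?thesis
      using odd[OF subgroup33_mult[OF H q p] _ _ c] by (simp add: mult_even3)
  next
    case False
    then show ?thesis using odd[OF p _ _ c] odd[OF q _ _ c] by auto
  qed
  then show ?thesis using subgroup33_Times[OF H] fst snd by simp
qed

text \<open>The orders 3 and 2 are coprime: squaring kills the second component and takes the
  generator \<open>Rot1\<close> to the generator \<open>Rot2\<close>.\<close>

lemma subgroup33_even_swap:
  assumes H: "subgroup33 H" and fst: "fst ` H = even3" and snd: "snd ` H = {Id3, t}" and t: "t \<notin> even3"
  shows "H = even3 \<times> {Id3, t}"
proof -
  have "Rot1 \<in> fst ` H" using fst by simp
  then obtain q where q: "(Rot1, q) \<in> H" by force
  then have "q = Id3 \<or> q = t" using snd by force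
  then have "q * q = Id3" using t perm3_powers(2) by auto
  then have "(Rot2, Id3) \<in> H" using subgroup33_mult[OF H q q] by simp
  then have "(c, Id3) \<in> H" if "c \<in> even3" for c
    using subgroup33_even'[OF H] that by simp
  then show ?thesis using subgroup33_Times'[OF H] fst snd by simp
qed

lemma subgroup33_trivial:
  assumes H: "subgroup33 H" and "snd ` H = {Id3}"
  shows "H = fst ` H \<times> {Id3}"
  using subgroup33_Times[OF H] assms(2) subgroup33_one[OF H] by simp

text \<open>If \<open>(Id3, t)\<close> is missing, the second component is the sign of the first:
  cubing shows that even permutations go with \<open>Id3\<close>, and an odd one going with
  \<open>Id3\<close> would, multiplied by a partner of \<open>t\<close>, give an even one going with
  \<open>t\<close>.\<close>

lemma subgroup33_UNIV_swap:
  assumes H: "subgroup33 H" and fst: "fst ` H = UNIV" and snd: "snd ` H = {Id3, t}" and t: "t \<notin> even3"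
  shows "H = (if (Id3, t) \<in> H then UNIV \<times> {Id3, t} else {(p, q). q = (if p \<in> even3 then Id3 else t)})"
proof (cases "(Id3, t) \<in> H")
  case True
  then have "(Id3, b) \<in> H" if "b \<in> snd ` H" for b
    using that snd subgroup33_one[OF H] by auto
  from subgroup33_Times[OF H this] show ?thesis using True fst snd by simp
next
  case False
  have dom: "q = Id3 \<or> q = t" if "(p, q) \<in> H" for p q using snd that by force
  have t3: "t * (t * t) = t" using t by (rule perm3_powers)
  have even: "q = Id3" if "(p, q) \<in> H" "p \<in> even3" for p q
  proof (rule ccontr)
    assume "q \<noteq> Id3"
    then have "q = t" using dom that by blast
    then show False
      using subgroup33_cube[OF H that(1)] that(2) t3 False by (simp add: perm3_powers)
  qed
  have "t \<in> snd ` H" using snd by simp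
  then obtain s where s: "(s, t) \<in> H" by force
  have odd: "q = t" if pq: "(p, q) \<in> H" "p \<notin> even3" for p q
  proof (rule ccontr)
    assume "q \<noteq> t"
    then have q: "q = Id3" using dom that by blast
    have "s \<notin> even3" using even[OF s] t by auto
    then have "p * s \<in> even3" using pq(2) by (simp add: mult_even3)
    then have "t = Id3" using even[of "p * s" "q * t"] subgroup33_mult[OF H pq(1) s] q by simp
    then show False using t by simp
  qed
  have "\<exists>q. (p, q) \<in> H" for p
    using fst by (metis (no_types, lifting) UNIV_I image_iff prod.collapse)
  then have "(p, q) \<in> H \<longleftrightarrow> q = (if p \<in> even3 then Id3 else t)" for p q
    using even odd by (metis (full_types))
  then have "H = {(p, q). q = (if p \<in> even3 then Id3 else t)}" by auto
  then show ?thesis using False by simp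
qed

text \<open>In a group of order 3 each kernel is trivial or everything. With trivial kernels
  \<open>H\<close> is the graph of an automorphism, which is the identity or the inversion.\<close>

lemma subgroup33_even_even:
  assumes H: "subgroup33 H" and fst: "fst ` H = even3" and snd: "snd ` H = even3"
  shows "if (\<forall>b. (Id3, b) \<in> H \<longrightarrow> b = Id3) \<and> (\<forall>a. (a, Id3) \<in> H \<longrightarrow> a = Id3)
    then H = {(p, p) |p. p \<in> even3} \<or> H = {(p, inv3 p) |p. p \<in> even3}
    else H = even3 \<times> even3"
proof -
  have even: "p \<in> even3" "q \<in> even3" if "(p, q) \<in> H" for p q using fst snd that by force+
  have 1: "H = even3 \<times> even3" if b: "(Id3, b) \<in> H" "b \<noteq> Id3" for b
    using subgroup33_Times[OF H] subgroup33_even[OF H b(1) even(2)[OF b(1)] b(2)] fst snd by simp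
  have 2: "H = even3 \<times> even3" if a: "(a, Id3) \<in> H" "a \<noteq> Id3" for a
    using subgroup33_Times'[OF H] subgroup33_even'[OF H a(1) even(1)[OF a(1)] a(2)] fst snd by simp
  have 3: "H = {(p, p) |p. p \<in> even3} \<or> H = {(p, inv3 p) |p. p \<in> even3}"
    if triv: "\<And>b. (Id3, b) \<in> H \<Longrightarrow> b = Id3" "\<And>a. (a, Id3) \<in> H \<Longrightarrow> a = Id3"
  proof -
    have unique: "q = q'" if "(p, q) \<in> H" "(p, q') \<in> H" for p q q'
    proof -
      have "(Id3, q' * inv3 q) \<in> H"
        using subgroup33_mult[OF H that(2) subgroup33_inv[OF H that(1)]] by simp
      then have "q' * inv3 q = Id3" by (rule triv(1))
      then have "q' * inv3 q * q = q" by simp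
      then show ?thesis by (simp add: mult.assoc)
    qed
    have "Rot1 \<in> fst ` H" using fst by simp
    then obtain c where c: "(Rot1, c) \<in> H" by force
    have cc: "(Rot2, c * c) \<in> H" using subgroup33_mult[OF H c c] by simp
    note one = subgroup33_one[OF H]
    have "c \<noteq> Id3" using c triv(2) by force
    then have "c = Rot1 \<or> c = Rot2" using even(2)[OF c] by (cases c) simp_all
    then show ?thesis
    proof
      assume c_eq: "c = Rot1"
      have "(p, q) \<in> H \<longleftrightarrow> p \<in> even3 \<and> q = p" for p q
        using unique[of p q] even[of p q] one c cc c_eq by (cases p) auto
      then show ?thesis by (intro disjI1) auto
    next
      assume c_eq: "c = Rot2"
      have "(p, q) \<in> H \<longleftrightarrow> p \<in> even3 \<and> q = inv3 p" for p q
        using unique[of p q] even[of p q] one c cc c_eq by (cases p) auto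
      then show ?thesis by (intro disjI2) auto
    qed
  qed
  show ?thesis
  proof (cases "(\<forall>b. (Id3, b) \<in> H \<longrightarrow> b = Id3) \<and> (\<forall>a. (a, Id3) \<in> H \<longrightarrow> a = Id3)")
    case True
    then show ?thesis using 3 by simp
  next
    case False
    then have "H = even3 \<times> even3" using 1 2 by metis
    with False show ?thesis by (subst if_not_P)
  qed
qed

section \<open>Orbits of these subgroups on the six permutations\<close>

lemma orbit33_UNIV:
  "orbit33 UNIV UNIV" "orbit33 (UNIV \<times> even3) UNIV" "orbit33 (UNIV \<times> {Id3}) UNIV"
  "orbit33 (UNIV \<times> {Id3, t}) UNIV" "t \<notin> even3 \<Longrightarrow> orbit33 (even3 \<times> {Id3, t}) UNIV"
proof -
  \<comment> \<open>Right multiplication alone is transitive; the witness solves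
    \<open>p * inv3 a = q\<close> for \<open>a\<close>.\<close>
  have "\<exists>a. a \<in> UNIV \<and> p * inv3 a = q" for p q
    by (rule exI[of _ "inv3 q * p"]) (cases p; cases q; simp)
  then have *: "orbit33 (UNIV \<times> K) UNIV" if "Id3 \<in> K" for K
    using that unfolding orbit33_def by fastforce
  show "orbit33 (UNIV \<times> even3) UNIV" "orbit33 (UNIV \<times> {Id3}) UNIV" "orbit33 (UNIV \<times> {Id3, t}) UNIV"
    by (rule *; simp)+
  show "orbit33 UNIV UNIV" using *[of UNIV] by simp
  assume t: "t \<notin> even3"
  \<comment> \<open>Right multiplication by rotations is transitive on each parity class, and left
    multiplication by the odd \<open>t\<close> exchanges the classes.\<close>
  have "\<exists>a\<in>even3. \<exists>b\<in>{Id3, t}. b * p * inv3 a = q" for p q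
    unfolding even3_def by (cases p; cases q; cases t; use t in simp)
  then show "orbit33 (even3 \<times> {Id3, t}) UNIV"
    unfolding orbit33_def by fastforce
qed

text \<open>All four groups consist of pairs of equal parity, so the action preserves parity, and
  all contain \<open>(a, Id3)\<close> for even \<open>a\<close>, which is enough for transitivity on
  each class.\<close>

lemma orbit33_even_odd:
  assumes "H = {(p, q). p \<in> even3 \<longleftrightarrow> q \<in> even3} \<or> H = even3 \<times> even3 \<or> H = even3 \<times> {Id3} \<or>
    (\<exists>t. t \<notin> even3 \<and> H = {(p, q). q = (if p \<in> even3 then Id3 else t)})"
  shows "orbit33 H even3" "orbit33 H (- even3)"
proof -
  have parity: "a \<in> even3 \<longleftrightarrow> b \<in> even3" if "(a, b) \<in> H" for a b
    using assms that by (auto split: if_splits)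
  have even: "(a, Id3) \<in> H" if "a \<in> even3" for a
    using assms that by auto
  have 1: "b * p * inv3 a \<in> even3 \<longleftrightarrow> p \<in> even3" if "(a, b) \<in> H" for a b p
    using parity[OF that] by (auto simp: mult_even3 inv3_even3)
  have 2: "\<exists>(a, b)\<in>H. b * p * inv3 a = q" if "p \<in> even3 \<longleftrightarrow> q \<in> even3" for p q
  proof (rule bexI[of _ "(inv3 q * p, Id3)"])
    show "case (inv3 q * p, Id3) of (a, b) \<Rightarrow> b * p * inv3 a = q"
      by (cases p; cases q; simp)
    show "(inv3 q * p, Id3) \<in> H"
      using that by (intro even) (simp add: mult_even3 inv3_even3)
  qed
  have "Id3 \<in> even3" "Swap0 \<in> - even3" by simp_all
  then show "orbit33 H even3" "orbit33 H (- even3)"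
    unfolding orbit33_def using 1 2 by blast+
qed

text \<open>Writing permutations as \<open>r * p\<close> turns the action into conjugation of
  \<open>p\<close>. The orbits are the translates by \<open>r\<close> of the conjugacy classes, of
  sizes 1, 2 and 3.\<close>

lemma orbit33_conj:
  fixes r :: perm3
  assumes H: "H = {(p, q). q = r * p * inv3 r}"
  shows "orbit33 H {r}" "orbit33 H {r * Rot1, r * Rot2}" "orbit33 H {r * Swap0, r * Swap1, r * Swap2}"
proof -
  have conj: "r * a * inv3 r * (r * p) * inv3 a = r * (a * p * inv3 a)" for a p
  proof -
    have "r * a * inv3 r * (r * p) * inv3 a = r * a * (inv3 r * r) * p * inv3 a"
      by (simp only: mult.assoc)
    then show ?thesis by (simp add: mult.assoc)
  qed
  have *: "orbit33 H ((*) r ` Z)"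
    if Z: "Z \<noteq> {}" "\<And>a p. p \<in> Z \<Longrightarrow> a * p * inv3 a \<in> Z" "\<And>p q. p \<in> Z \<Longrightarrow> q \<in> Z \<Longrightarrow> \<exists>a. a * p * inv3 a = q" for Z
    unfolding orbit33_def
  proof (intro conjI ballI)
    show "(*) r ` Z \<noteq> {}" using Z(1) by simp
    show "case x of (a, b) \<Rightarrow> \<forall>p\<in>(*) r ` Z. b * p * inv3 a \<in> (*) r ` Z" if "x \<in> H" for x
      using that Z(2) unfolding H by (auto simp: conj)
    fix p q assume "p \<in> (*) r ` Z" "q \<in> (*) r ` Z"
    then obtain p' q' where pq: "p' \<in> Z" "q' \<in> Z" "p = r * p'" "q = r * q'" by blast
    then obtain a where a: "a * p' * inv3 a = q'" using Z(3) by blast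
    show "\<exists>(a, b)\<in>H. b * p * inv3 a = q"
      by (rule bexI[of _ "(a, r * a * inv3 r)"]) (simp_all add: H pq conj a)
  qed
  have "a * p * inv3 a \<in> {Rot1, Rot2}" if "p \<in> {Rot1, Rot2}" for a p
    using that by (cases a) auto
  moreover have "\<exists>a. a * p * inv3 a = q" if "p \<in> {Rot1, Rot2}" "q \<in> {Rot1, Rot2}" for p q
    using that unfolding ex_perm3 by auto
  ultimately show "orbit33 H {r * Rot1, r * Rot2}"
    using *[of "{Rot1, Rot2}"] by simp
  have "a * p * inv3 a \<in> {Swap0, Swap1, Swap2}" if "p \<in> {Swap0, Swap1, Swap2}" for a p
    using that by (cases a) auto
  moreover have "\<exists>a. a * p * inv3 a = q" if "p \<in> {Swap0, Swap1, Swap2}" "q \<in> {Swap0, Swap1, Swap2}" for p q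
    using that unfolding ex_perm3 by auto
  ultimately show "orbit33 H {r * Swap0, r * Swap1, r * Swap2}"
    using *[of "{Swap0, Swap1, Swap2}"] by simp
  show "orbit33 H {r}"
    using *[of "{Id3}"] by simp
qed

lemma orbit33_diagonal:
  assumes "H = {(p, p) |p. p \<in> even3}"
  shows "orbit33 H {Id3}" "orbit33 H {Rot1}" "orbit33 H {Rot2}" "orbit33 H {Swap0, Swap1, Swap2}"
proof -
  have "H = {(Id3, Id3), (Rot1, Rot1), (Rot2, Rot2)}"
    using assms by (auto simp: even3_def)
  then show "orbit33 H {Id3}" "orbit33 H {Rot1}" "orbit33 H {Rot2}" "orbit33 H {Swap0, Swap1, Swap2}"
    by (simp_all add: orbit33_def)
qed

text \<open>Here \<open>a\<close> acts by \<open>p \<mapsto> inv3 a * p * inv3 a\<close>. A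
  transposition inverts rotations under conjugation and so is fixed, while on the abelian group
  \<open>even3\<close> this is multiplication by \<open>a\<close>, the square of
  \<open>inv3 a\<close>.\<close>

lemma orbit33_antidiagonal:
  assumes "H = {(p, inv3 p) |p. p \<in> even3}"
  shows "orbit33 H {Swap0}" "orbit33 H {Swap1}" "orbit33 H {Swap2}" "orbit33 H {Id3, Rot1, Rot2}"
proof -
  have "H = {(Id3, Id3), (Rot1, Rot2), (Rot2, Rot1)}"
    using assms by (auto simp: even3_def)
  then show "orbit33 H {Swap0}" "orbit33 H {Swap1}" "orbit33 H {Swap2}" "orbit33 H {Id3, Rot1, Rot2}"
    by (simp_all add: orbit33_def)
qed

section \<open>The roots of the sextic\<close>

text \<open>The three invariants do not change when all roots are translated, so they are functions
  of the differences \<open>p\<close> and \<open>q\<close>.\<close>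

lemma
  fixes x0 x1 x2 :: "'a::comm_ring_1"
  defines "v \<equiv> (x0 + x1 + x2, x0 * x1 + x0 * x2 + x1 * x2, x0 * x1 * x2)"
  defines "p \<equiv> x0 - x1" and "q \<equiv> x1 - x2"
  shows inv_A_roots: "inv_A v = p ^ 2 + p * q + q ^ 2"
    and inv_B_roots: "inv_B v = (2 * p + q) * (p - q) * (p + 2 * q)"
    and inv_D_roots: "inv_D v = (p * q * (p + q)) ^ 2"
  unfolding v_def p_def q_def
  by (simp_all add: algebra_simps power2_eq_square power3_eq_cube)

text \<open>\<open>p\<close>, \<open>q\<close> and \<open>r\<close>, \<open>s\<close> are successive
  differences of the roots of the two cubics. \<open>e0\<close>, \<open>e1\<close>,
  \<open>e2\<close> are the numerators of the roots of the sextic at \<open>Id3\<close>,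
  \<open>Rot1\<close>, \<open>Rot2\<close>, and \<open>o0\<close>, \<open>o1\<close>,
  \<open>o2\<close> those at \<open>Swap2\<close>, \<open>Swap0\<close>, \<open>Swap1\<close>; see
  \<open>theta_num_simps\<close>.\<close>

context
  fixes p q r s A A' B' D D' e0 e1 e2 o0 o1 o2 :: "'a::comm_ring_1"
  defines "A \<equiv> p ^ 2 + p * q + q ^ 2" and "A' \<equiv> r ^ 2 + r * s + s ^ 2"
    and "D \<equiv> (p * q * (p + q)) ^ 2" and "D' \<equiv> (r * s * (r + s)) ^ 2"
    and "B' \<equiv> (2 * r + s) * (r - s) * (r + 2 * s)"
  defines "e0 \<equiv> q * r - p * s" and "e1 \<equiv> q * s + p * (r + s)" and "e2 \<equiv> - q * (r + s) - p * r"
  defines "o0 \<equiv> - q * r - p * (r + s)" and "o1 \<equiv> q * (r + s) + p * s" and "o2 \<equiv> - q * s + p * r"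
begin

lemma resolvent_sum_zero: "e0 + e1 + e2 = 0" "o0 + o1 + o2 = 0"
  unfolding e0_def e1_def e2_def o0_def o1_def o2_def by (simp_all add: algebra_simps)

lemma resolvent_quadratic:
  "e0 * e1 + e0 * e2 + e1 * e2 = - A * A'" "o0 * o1 + o0 * o2 + o1 * o2 = - A * A'"
  unfolding e0_def e1_def e2_def o0_def o1_def o2_def A_def A'_def
  by (simp_all add: algebra_simps power2_eq_square)

text \<open>Exchanging two roots of the first cubic turns the numerators of one parity class into
  the negatives of those of the other. So this sum is antisymmetric and contains the Vandermonde
  factor, while the product in \<open>resolvent_prod\<close> is symmetric.\<close>

lemma resolvent_sum: "e0 * e1 * e2 + o0 * o1 * o2 = - B' * (p * q * (p + q))"
  unfolding e0_def e1_def e2_def o0_def o1_def o2_def B'_def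
  by (simp add: algebra_simps)

lemma resolvent_prod: "(e0 * e1 * e2) * (o0 * o1 * o2) = A' ^ 3 * D - A ^ 3 * D'"
  unfolding e0_def e1_def e2_def o0_def o1_def o2_def A_def A'_def D_def D'_def
  by (simp add: algebra_simps power2_eq_square power3_eq_cube)

lemma resolvent_differences:
  "((e0 - e1) * (e1 - e2) * (e2 - e0)) * ((o0 - o1) * (o1 - o2) * (o2 - o0)) =
    A ^ 3 * B' ^ 2 - 27 * A' ^ 3 * D"
  unfolding e0_def e1_def e2_def o0_def o1_def o2_def A_def A'_def D_def B'_def
  by (simp add: algebra_simps power2_eq_square power3_eq_cube)

text \<open>Two permutations of opposite parity agree at exactly one index \<open>i\<close>. In the
  difference the terms for \<open>y\<close> at that index cancel, which leaves, up to sign, a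
  difference of two \<open>y\<close> times \<open>x j + x k - 2 * x i\<close>; the three values of
  the latter are the factors of the invariant \<open>B\<close> of the first cubic.\<close>

lemma resolvent_cross_differences:
  "e0 - o0 = r * (p + 2 * q)" "e0 - o1 = - (s * (2 * p + q))" "e0 - o2 = - ((r + s) * (p - q))"
  "e1 - o0 = (r + s) * (2 * p + q)" "e1 - o1 = r * (p - q)" "e1 - o2 = s * (p + 2 * q)"
  "e2 - o0 = s * (p - q)" "e2 - o1 = - ((r + s) * (p + 2 * q))" "e2 - o2 = - (r * (2 * p + q))"
  unfolding e0_def e1_def e2_def o0_def o1_def o2_def by (simp_all add: algebra_simps)

end

section \<open>Roots of a cubic and the interpolation coefficients\<close>

definition cubic_roots :: "'m::field \<times> 'm \<times> 'm \<Rightarrow> (idx3 \<Rightarrow> 'm alg_closure) \<Rightarrow> bool" where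
  "cubic_roots a x \<longleftrightarrow> map_poly to_ac (f3 a) = (\<Prod>i\<in>UNIV. [:- x i, 1:])"

lemma prod_idx3: "(\<Prod>i\<in>UNIV. g i) = g I0 * g I1 * g I2"
  by (simp add: UNIV_idx3 mult.assoc)

lemma degree_f3 [simp]: "Polynomial.degree (f3 a) = 3"
  by (cases a) simp

lemma f3_nonzero: "f3 a \<noteq> 0"
  by (cases a) simp

lemma cubic_roots_exist: "\<exists>x. cubic_roots a x"
proof -
  let ?p = "map_poly to_ac (f3 a)"
  have "?p \<noteq> 0" using f3_nonzero[of a] by (simp add: map_poly_eq_0_iff)
  then obtain R where R: "size R = Polynomial.degree ?p"
    "?p = Polynomial.smult (Polynomial.lead_coeff ?p) (\<Prod>u\<in>#R. [:-u, 1:])"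
    using alg_closed_imp_factorization[of ?p] by blast
  have "Polynomial.lead_coeff ?p = 1"
    by (cases a) (simp add: coeff_map_poly)
  moreover obtain u v w where "R = {#u, v, w#}"
  proof -
    have size: "size R = Suc (Suc (Suc 0))" using R(1) by simp
    obtain u R1 where u: "R = add_mset u R1" using size_eq_Suc_imp_eq_union[OF size] by auto
    then have size1: "size R1 = Suc (Suc 0)" using size by simp
    obtain v R2 where v: "R1 = add_mset v R2" using size_eq_Suc_imp_eq_union[OF size1] by auto
    then have size2: "size R2 = Suc 0" using size1 by simp
    obtain w R3 where w: "R2 = add_mset w R3" using size_eq_Suc_imp_eq_union[OF size2] by auto
    then have "R3 = {#}" using size2 by simp
    then show ?thesis using that u v w by simp
  qed
  ultimately have "?p = [:-u, 1:] * [:-v, 1:] * [:-w, 1:]" using R(2) by (simp add: mult.assoc del: mult_pCons_left mult_pCons_right)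
  then have "cubic_roots a (\<lambda>i. case i of I0 \<Rightarrow> u | I1 \<Rightarrow> v | I2 \<Rightarrow> w)"
    unfolding cubic_roots_def prod_idx3 by simp
  then show ?thesis by blast
qed

lemma cubic_roots_vieta:
  assumes "cubic_roots (a1, a2, a3) x"
  shows "to_ac a1 = x I0 + x I1 + x I2"
    "to_ac a2 = x I0 * x I1 + x I0 * x I2 + x I1 * x I2" "to_ac a3 = x I0 * x I1 * x I2"
proof -
  have "map_poly to_ac [:-a3, a2, -a1, 1:] = [:- x I0, 1:] * [:- x I1, 1:] * [:- x I2, 1:]"
    using assms by (simp add: cubic_roots_def prod_idx3)
  then have eq: "[:- to_ac a3, to_ac a2, - to_ac a1, 1:] =
    [:- (x I0 * x I1 * x I2), x I0 * x I1 + x I0 * x I2 + x I1 * x I2, - (x I0 + x I1 + x I2), 1:]"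
    by (simp add: map_poly_pCons algebra_simps)
  then show "to_ac a1 = x I0 + x I1 + x I2"
    "to_ac a2 = x I0 * x I1 + x I0 * x I2 + x I1 * x I2" "to_ac a3 = x I0 * x I1 * x I2"
    by (simp_all add: neg_equal_iff_equal del: minus_add_distrib)
qed

lemma to_ac_inv:
  assumes "cubic_roots a x"
  defines "p \<equiv> x I0 - x I1" and "q \<equiv> x I1 - x I2"
  shows "to_ac (inv_A a) = p ^ 2 + p * q + q ^ 2"
    and "to_ac (inv_B a) = (2 * p + q) * (p - q) * (p + 2 * q)"
    and "to_ac (inv_D a) = (p * q * (p + q)) ^ 2"
proof -
  obtain a1 a2 a3 where a: "a = (a1, a2, a3)" by (cases a)
  note v = cubic_roots_vieta[OF assms(1)[unfolded a]]
  have "to_ac (inv_A a) = inv_A (to_ac a1, to_ac a2, to_ac a3)"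
    "to_ac (inv_B a) = inv_B (to_ac a1, to_ac a2, to_ac a3)"
    "to_ac (inv_D a) = inv_D (to_ac a1, to_ac a2, to_ac a3)"
    by (simp_all add: a)
  then show "to_ac (inv_A a) = p ^ 2 + p * q + q ^ 2"
    "to_ac (inv_B a) = (2 * p + q) * (p - q) * (p + 2 * q)"
    "to_ac (inv_D a) = (p * q * (p + q)) ^ 2"
    unfolding v p_def q_def by (simp_all only: inv_A_roots inv_B_roots inv_D_roots)
qed

lemma cubic_roots_inj:
  assumes "cubic_roots a x" "inv_D a \<noteq> 0"
  shows "inj x"
proof -
  have "to_ac (inv_D a) \<noteq> 0" using assms(2) by simp
  then have "x I0 \<noteq> x I1 \<and> x I1 \<noteq> x I2 \<and> x I0 \<noteq> x I2"
    unfolding to_ac_inv(3)[OF assms(1)] by auto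
  then have "\<forall>i j. x i = x j \<longrightarrow> i = j" unfolding all_idx3 by auto
  then show ?thesis by (simp add: inj_def)
qed

lemma cubic_roots_range:
  assumes "cubic_roots a x"
  shows "roots_in_closure (f3 a) = range x"
  using assms by (auto simp: cubic_roots_def poly_prod prod_zero_iff)

lemma cubic_roots_separable:
  assumes "cubic_roots a x" "inj x"
  shows "separable (x i)"
proof -
  have "map_poly to_ac (f3 a) = (\<Prod>s\<in>range x. [:-s, 1:])"
    using assms by (simp add: cubic_roots_def prod.reindex)
  then show ?thesis unfolding separable_def
    by (intro exI[of _ "range x"] exI[of _ "f3 a"]) auto
qed

text \<open>
  The leading coefficient of the quadratic polynomial interpolating \<open>x i \<mapsto> y (p i)\<close>, that is, of
  the Tschirnhausen transformation that takes the root \<open>x i\<close> of one cubic to the root \<open>y (p i)\<close>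
  of the other.
\<close>

definition theta :: "(idx3 \<Rightarrow> 'a::field) \<Rightarrow> (idx3 \<Rightarrow> 'a) \<Rightarrow> perm3 \<Rightarrow> 'a" where
  "theta x y p = (\<Sum>i\<in>UNIV. y (act3 p i) / (\<Prod>j\<in>UNIV - {i}. x i - x j))"

text \<open>The numerator of \<open>theta\<close> over the Vandermonde product of \<open>x\<close>
  as common denominator; the polynomial identities for the resolvent apply to it.\<close>

definition theta_num :: "(idx3 \<Rightarrow> 'a::field) \<Rightarrow> (idx3 \<Rightarrow> 'a) \<Rightarrow> perm3 \<Rightarrow> 'a" where
  "theta_num x y p = y (act3 p I0) * (x I1 - x I2) + y (act3 p I1) * (x I2 - x I0)
     + y (act3 p I2) * (x I0 - x I1)"

lemma theta_eq:
  assumes "inj x"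
  shows "theta x y p = theta_num x y p / ((x I0 - x I1) * (x I1 - x I2) * (x I0 - x I2))"
proof -
  have ne: "x I0 - x I1 \<noteq> 0" "x I1 - x I2 \<noteq> 0" "x I0 - x I2 \<noteq> 0"
    using assms by (auto dest: injD)
  have sets: "UNIV - {I0} = {I1, I2}" "UNIV - {I1} = {I0, I2}" "UNIV - {I2} = {I0, I1}"
    by (auto simp: UNIV_idx3)
  have "theta x y p = y (act3 p I0) / ((x I0 - x I1) * (x I0 - x I2))
      + y (act3 p I1) / ((x I1 - x I0) * (x I1 - x I2)) + y (act3 p I2) / ((x I2 - x I0) * (x I2 - x I1))"
    unfolding theta_def UNIV_idx3 by (simp add: sets[unfolded UNIV_idx3] add.assoc)
  moreover have "(x I1 - x I0) * (x I1 - x I2) = - ((x I0 - x I1) * (x I1 - x I2))"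
    "(x I2 - x I0) * (x I2 - x I1) = (x I0 - x I2) * (x I1 - x I2)"
    by (simp_all add: algebra_simps)
  ultimately show ?thesis
    using ne by (simp add: theta_num_def divide_simps) (simp add: algebra_simps)
qed

lemma theta_num_simps:
  defines "p x \<equiv> x I0 - x I1" and "q x \<equiv> x I1 - x I2"
  shows
    "theta_num x y Id3 = q x * p y - p x * q y"
    "theta_num x y Rot1 = q x * q y + p x * (p y + q y)"
    "theta_num x y Rot2 = - q x * (p y + q y) - p x * p y"
    "theta_num x y Swap2 = - q x * p y - p x * (p y + q y)"
    "theta_num x y Swap0 = q x * (p y + q y) + p x * q y"
    "theta_num x y Swap1 = - q x * q y + p x * p y"
  unfolding p_def q_def theta_num_def by (simp_all add: algebra_simps)

lemma prod_three_linear: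
  fixes n0 n1 n2 d :: "'a::field"
  assumes "n0 + n1 + n2 = 0" "d \<noteq> 0"
  shows "[:- (n0 / d), 1:] * [:- (n1 / d), 1:] * [:- (n2 / d), 1:] =
    [:- (n0 * n1 * n2) / d ^ 3, (n0 * n1 + n0 * n2 + n1 * n2) / d ^ 2, 0, 1:]"
proof -
  have n2: "n2 = - n0 - n1" using assms(1) by (simp add: eq_neg_iff_add_eq_0 algebra_simps)
  show ?thesis using assms(2) unfolding n2
    by (simp add: field_simps power2_eq_square power3_eq_cube)
qed

lemma prod_two_cubics:
  fixes u v w :: "'a::comm_ring_1"
  shows "[:u, w, 0, 1:] * [:v, w, 0, 1:] = [:u * v, w * (u + v), w ^ 2, u + v, 2 * w, 0, 1:]"
  by (simp add: algebra_simps power2_eq_square)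

text \<open>Grouped by parity, the six factors form two cubics without square term and with the same
  linear coefficient \<open>- A * A' / D\<close>. Their constant terms are \<open>u / d ^ 3\<close>
  and \<open>v / d ^ 3\<close>, and the sextic involves these only through their sum and product,
  where \<open>d\<close> occurs only to even powers.\<close>

lemma F2_eq_prod_theta:
  assumes a: "cubic_roots a x" "inv_D a \<noteq> 0" and b: "cubic_roots b y"
  shows "map_poly to_ac (F2 a b) = (\<Prod>p\<in>UNIV. [:- theta x y p, 1:])"
proof -
  define p q r s where "p = x I0 - x I1" and "q = x I1 - x I2" and "r = y I0 - y I1" and "s = y I1 - y I2"
  define d where "d = p * q * (p + q)"
  define A A' B' D D' where "A = to_ac (inv_A a)" and "A' = to_ac (inv_A b)"
    and "B' = to_ac (inv_B b)" and "D = to_ac (inv_D a)" and "D' = to_ac (inv_D b)"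
  have eqs: "A = p ^ 2 + p * q + q ^ 2" "A' = r ^ 2 + r * s + s ^ 2"
    "B' = (2 * r + s) * (r - s) * (r + 2 * s)" "D = (p * q * (p + q)) ^ 2" "D' = (r * s * (r + s)) ^ 2"
    unfolding A_def A'_def B'_def D_def D'_def p_def q_def r_def s_def
    by (simp_all only: to_ac_inv[OF a(1)] to_ac_inv[OF b])
  have D: "D = d ^ 2" by (simp add: eqs d_def)
  have D0: "D \<noteq> 0" using a(2) by (simp add: D_def)
  then have d0: "d \<noteq> 0" by (auto simp: D)
  have d_eq: "(x I0 - x I1) * (x I1 - x I2) * (x I0 - x I2) = d"
    by (simp add: d_def p_def q_def)
  let ?t = "theta_num x y"
  note t = theta_num_simps[where x = x and y = y, folded p_def q_def r_def s_def]
  have th: "theta x y k = ?t k / d" for k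
    using theta_eq[OF cubic_roots_inj[OF a]] d_eq by simp
  have quad: "?t Id3 * ?t Rot1 + ?t Id3 * ?t Rot2 + ?t Rot1 * ?t Rot2 = - A * A'"
    "?t Swap2 * ?t Swap0 + ?t Swap2 * ?t Swap1 + ?t Swap0 * ?t Swap1 = - A * A'"
    unfolding t eqs by (rule resolvent_quadratic)+
  have zero: "?t Id3 + ?t Rot1 + ?t Rot2 = 0" "?t Swap2 + ?t Swap0 + ?t Swap1 = 0"
    unfolding t by (rule resolvent_sum_zero)+
  define u v where "u = - (?t Id3 * ?t Rot1 * ?t Rot2)" and "v = - (?t Swap2 * ?t Swap0 * ?t Swap1)"
  have "- u - v = - B' * d"
    unfolding u_def v_def d_def eqs t using resolvent_sum[where p = p and q = q and r = r and s = s] by simp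
  then have uv: "u + v = B' * d" by (simp add: algebra_simps) 
  have uv': "u * v = A' ^ 3 * D - A ^ 3 * D'"
    unfolding u_def v_def eqs t using resolvent_prod[where p = p and q = q and r = r and s = s] by simp
  have "(\<Prod>k\<in>UNIV. [:- theta x y k, 1:]) =
      ([:- (?t Id3 / d), 1:] * [:- (?t Rot1 / d), 1:] * [:- (?t Rot2 / d), 1:]) *
      ([:- (?t Swap2 / d), 1:] * [:- (?t Swap0 / d), 1:] * [:- (?t Swap1 / d), 1:])"
    unfolding UNIV_perm3 th by (simp add: mult_ac del: mult_pCons_left mult_pCons_right)
  also have "\<dots> = [:u / d ^ 3, - A * A' / d ^ 2, 0, 1:] * [:v / d ^ 3, - A * A' / d ^ 2, 0, 1:]"
    unfolding prod_three_linear[OF zero(1) d0] prod_three_linear[OF zero(2) d0] quad u_def v_def ..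
  also have "\<dots> = [:(u * v) / D ^ 3, - (A * A' * B' / D ^ 2), A ^ 2 * A' ^ 2 / D ^ 2,
      B' / D, - (2 * A * A' / D), 0, 1:]"
  proof -
    have "u / d ^ 3 + v / d ^ 3 = (u + v) / d ^ 3" by (simp add: add_divide_distrib)
    also have "\<dots> = B' / D" unfolding uv D using d0 by (simp add: power2_eq_square power3_eq_cube)
    finally have 1: "u / d ^ 3 + v / d ^ 3 = B' / D" .
    have 2: "(u / d ^ 3) * (v / d ^ 3) = (u * v) / D ^ 3"
      by (simp add: D flip: power_mult power_add)
    show ?thesis
      unfolding prod_two_cubics 1 2 D using d0
      by (simp add: power2_eq_square)
  qed
  also have "\<dots> = map_poly to_ac (F2 a b)"
    unfolding uv' A_def A'_def B'_def D_def D'_def F2_def by (simp add: map_poly_pCons)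
  finally show ?thesis ..
qed

lemma theta_inj:
  assumes a: "cubic_roots a x" "inv_D a \<noteq> 0" and b: "cubic_roots b y" "inv_D b \<noteq> 0"
    and B: "inv_B a \<noteq> 0"
    and AB: "inv_A a ^ 3 * inv_B b ^ 2 - 27 * inv_A b ^ 3 * inv_D a \<noteq> 0"
  shows "inj (theta x y)"
proof -
  define p q r s where "p = x I0 - x I1" and "q = x I1 - x I2" and "r = y I0 - y I1" and "s = y I1 - y I2"
  note inj_x = cubic_roots_inj[OF a] and inj_y = cubic_roots_inj[OF b]
  have "to_ac (inv_B a) \<noteq> 0" using B by simp
  then have B0: "2 * p + q \<noteq> 0" "p - q \<noteq> 0" "p + 2 * q \<noteq> 0"
    unfolding to_ac_inv(2)[OF a(1)] p_def q_def by auto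
  have rs: "r \<noteq> 0" "s \<noteq> 0" "r + s \<noteq> 0"
    using inj_y by (auto simp: r_def s_def dest: injD)
  let ?t = "theta_num x y"
  note t = theta_num_simps[where x = x and y = y, folded p_def q_def r_def s_def]
  have "to_ac (inv_A a ^ 3 * inv_B b ^ 2 - 27 * inv_A b ^ 3 * inv_D a) \<noteq> 0"
    using AB by (simp del: to_ac_diff to_ac_mult to_ac_power)
  then have "((?t Id3 - ?t Rot1) * (?t Rot1 - ?t Rot2) * (?t Rot2 - ?t Id3)) *
    ((?t Swap2 - ?t Swap0) * (?t Swap0 - ?t Swap1) * (?t Swap1 - ?t Swap2)) \<noteq> 0"
    unfolding t resolvent_differences by (simp add: to_ac_inv[OF a(1)] to_ac_inv[OF b(1)] p_def q_def r_def s_def)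
  then have same: "?t Id3 \<noteq> ?t Rot1" "?t Rot1 \<noteq> ?t Rot2" "?t Rot2 \<noteq> ?t Id3"
    "?t Swap2 \<noteq> ?t Swap0" "?t Swap0 \<noteq> ?t Swap1" "?t Swap1 \<noteq> ?t Swap2"
    by auto
  have cross: "?t i \<noteq> ?t j" if "i \<in> even3" "j \<notin> even3" for i j
  proof -
    have "?t i - ?t j \<noteq> 0"
      using that B0 rs resolvent_cross_differences[where p = p and q = q and r = r and s = s]
      by (cases i; cases j) (simp_all only: even3_iff t not_True_eq_False not_False_eq_True simp_thms
          mult_eq_0_iff neg_equal_0_iff_equal)
    then show ?thesis by simp
  qed
  have "\<forall>i j. ?t i = ?t j \<longrightarrow> i = j"
    unfolding all_perm3 using same same[symmetric] cross cross[symmetric] by auto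
  moreover have "(x I0 - x I1) * (x I1 - x I2) * (x I0 - x I2) \<noteq> 0"
    using inj_x by (auto dest: injD)
  ultimately show ?thesis
    unfolding inj_def theta_eq[OF inj_x] by auto
qed

lemma base_hom_prod:
  assumes \<sigma>: "base_hom UNIV \<sigma>"
  shows "\<sigma> (\<Prod>i\<in>I. g i) = (\<Prod>i\<in>I. \<sigma> (g i))"
  by (induction I rule: infinite_finite_induct)
    (simp_all add: base_hom_1[OF \<sigma>] base_hom_mult[OF \<sigma>])

text \<open>\<open>\<sigma>\<close> moves the nodes by \<open>a\<close> and the values by
  \<open>b\<close>; reindexing the sum along \<open>act3 a\<close> shows that the new interpolation
  problem belongs to \<open>b * p * inv3 a\<close>.\<close>

lemma theta_image:
  assumes \<sigma>: "base_hom UNIV \<sigma>"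
    and x: "\<And>i. \<sigma> (x i) = x (act3 a i)" and y: "\<And>i. \<sigma> (y i) = y (act3 b i)"
  shows "\<sigma> (theta x y p) = theta x y (b * p * inv3 a)"
proof -
  have bij: "bij (act3 a)"
    using inj_act3[of a] by (simp add: bij_def finite_UNIV_inj_surj)
  have "\<sigma> (theta x y p) = (\<Sum>i\<in>UNIV. y (act3 b (act3 p i)) / (\<Prod>j\<in>UNIV - {i}. x (act3 a i) - x (act3 a j)))"
    by (simp add: theta_def base_hom_sum[OF \<sigma>] divide_inverse base_hom_mult[OF \<sigma>]
        base_hom_inverse[OF \<sigma>] base_hom_prod[OF \<sigma>] base_hom_diff[OF \<sigma>] x y)
  also have "\<dots> = (\<Sum>i\<in>UNIV. y (act3 (b * p * inv3 a) (act3 a i)) /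
      (\<Prod>j\<in>UNIV - {act3 a i}. x (act3 a i) - x j))"
  proof (rule sum.cong[OF refl])
    fix i
    have "act3 (b * p * inv3 a) (act3 a i) = act3 (b * p * (inv3 a * a)) i"
      by (simp only: act3_times)
    then have "act3 (b * p * inv3 a) (act3 a i) = act3 b (act3 p i)" by (simp add: act3_times)
    moreover have "bij_betw (act3 a) (UNIV - {i}) (UNIV - {act3 a i})"
      using bij by (intro bij_betw_DiffI) (auto simp: bij_betw_def)
    then have "(\<Prod>j\<in>UNIV - {i}. x (act3 a i) - x (act3 a j)) =
        (\<Prod>j\<in>UNIV - {act3 a i}. x (act3 a i) - x j)"
      by (rule prod.reindex_bij_betw)
    ultimately show "y (act3 b (act3 p i)) / (\<Prod>j\<in>UNIV - {i}. x (act3 a i) - x (act3 a j)) =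
      y (act3 (b * p * inv3 a) (act3 a i)) / (\<Prod>j\<in>UNIV - {act3 a i}. x (act3 a i) - x j)"
      by simp
  qed
  also have "\<dots> = theta x y (b * p * inv3 a)"
    unfolding theta_def by (rule sum.reindex_bij_betw[OF bij])
  finally show ?thesis .
qed

section \<open>The Galois action on the roots of two cubics\<close>

definition root_perm :: "(idx3 \<Rightarrow> 'a) \<Rightarrow> ('a \<Rightarrow> 'a) \<Rightarrow> perm3" where
  "root_perm x \<sigma> = perm3_of (\<lambda>i. inv_into UNIV x (\<sigma> (x i)))"

lemma root_perm:
  assumes x: "cubic_roots a x" "inj x" and \<sigma>: "base_hom UNIV \<sigma>"
  shows "\<sigma> (x i) = x (act3 (root_perm x \<sigma>) i)"
proof -
  have "\<sigma> ` range x = range x"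
    using base_hom_image_roots[OF \<sigma> f3_nonzero[of a]] cubic_roots_range[OF x(1)] by simp
  then have img: "x (inv_into UNIV x (\<sigma> (x i))) = \<sigma> (x i)" for i
    by (metis f_inv_into_f imageI rangeI)
  have "inj (\<lambda>i. inv_into UNIV x (\<sigma> (x i)))"
  proof (rule injI)
    fix i j assume "inv_into UNIV x (\<sigma> (x i)) = inv_into UNIV x (\<sigma> (x j))"
    then have "\<sigma> (x i) = \<sigma> (x j)" using img by metis
    then show "i = j" using base_hom_inj_on[OF \<sigma>] x(2) by (simp add: inj_eq)
  qed
  then show ?thesis using img by (simp add: root_perm_def act3_perm3_of)
qed

lemma root_perm_unique:
  assumes "inj x" "\<And>i. \<sigma> (x i) = x (act3 p i)"
  shows "root_perm x \<sigma> = p"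
proof -
  have "root_perm x \<sigma> = perm3_of (act3 p)"
    using assms by (simp add: root_perm_def)
  then show ?thesis by (metis act3_inj act3_perm3_of inj_act3)
qed

locale cubic_pair =
  fixes a b :: "'m::field \<times> 'm \<times> 'm" and x y :: "idx3 \<Rightarrow> 'm alg_closure"
  assumes x: "cubic_roots a x" "inj x" and y: "cubic_roots b y" "inj y"
begin

abbreviation "Spl_a \<equiv> Spl base_field (f3 a)"
abbreviation "Spl_b \<equiv> Spl base_field (f3 b)"

text \<open>The Galois group of the compositum of both splitting fields, as it acts on the two
  triples of roots. Its projections are the two Galois groups as permutation groups.\<close>

definition H :: "(perm3 \<times> perm3) set" where
  "H = (\<lambda>\<sigma>. (root_perm x \<sigma>, root_perm y \<sigma>)) ` {\<sigma>. base_hom UNIV \<sigma>}"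

lemma HE:
  assumes "(p, q) \<in> H"
  obtains \<sigma> where "base_hom UNIV \<sigma>" "\<And>i. \<sigma> (x i) = x (act3 p i)" "\<And>i. \<sigma> (y i) = y (act3 q i)"
  using assms root_perm[OF x] root_perm[OF y] unfolding H_def by auto

lemma HI: "base_hom UNIV \<sigma> \<Longrightarrow> (root_perm x \<sigma>, root_perm y \<sigma>) \<in> H"
  by (auto simp: H_def)

lemma subgroup33_H: "subgroup33 H"
  unfolding subgroup33_def
proof (intro conjI, goal_cases)
  case 1
  have "root_perm x (\<lambda>z. z) = Id3" "root_perm y (\<lambda>z. z) = Id3"
    by (rule root_perm_unique[OF x(2)], simp, rule root_perm_unique[OF y(2)], simp)
  then show ?case using HI[OF base_hom_id] by simp
next
  case 2
  show ?case
  proof clarify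
    fix p q p' q' assume "(p, q) \<in> H" "(p', q') \<in> H"
    then obtain \<sigma> \<tau> where \<sigma>: "base_hom UNIV \<sigma>" "\<And>i. \<sigma> (x i) = x (act3 p i)" "\<And>i. \<sigma> (y i) = y (act3 q i)"
      and \<tau>: "base_hom UNIV \<tau>" "\<And>i. \<tau> (x i) = x (act3 p' i)" "\<And>i. \<tau> (y i) = y (act3 q' i)"
      using HE by metis
    have "root_perm x (\<lambda>z. \<sigma> (\<tau> z)) = p * p'" "root_perm y (\<lambda>z. \<sigma> (\<tau> z)) = q * q'"
      using \<sigma> \<tau> by (auto intro!: root_perm_unique x(2) y(2) simp: act3_times)
    then show "(p * p', q * q') \<in> H" using HI[OF base_hom_comp[OF \<sigma>(1) \<tau>(1)]] by simp
  qed
qed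

lemma root_perm_eq_iff:
  assumes "base_hom UNIV \<sigma>" "base_hom UNIV \<tau>" "cubic_roots c z" "inj z"
  shows "root_perm z \<sigma> = root_perm z \<tau> \<longleftrightarrow> (\<forall>u\<in>roots_in_closure (f3 c). \<sigma> u = \<tau> u)"
proof -
  have "(\<forall>u\<in>roots_in_closure (f3 c). \<sigma> u = \<tau> u) \<longleftrightarrow> (\<forall>i. \<sigma> (z i) = \<tau> (z i))"
    unfolding cubic_roots_range[OF assms(3)] by auto
  also have "\<dots> \<longleftrightarrow> (\<forall>i. act3 (root_perm z \<sigma>) i = act3 (root_perm z \<tau>) i)"
    using root_perm[OF assms(3,4,1)] root_perm[OF assms(3,4,2)] assms(4) by (simp add: inj_eq)
  also have "\<dots> \<longleftrightarrow> root_perm z \<sigma> = root_perm z \<tau>"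
    by (simp flip: act3_inj fun_eq_iff)
  finally show ?thesis by simp
qed

lemma order_Gal: "Coset.order (Gal Spl_a) = card (fst ` H)" "Coset.order (Gal Spl_b) = card (snd ` H)"
  unfolding H_def image_image fst_conv snd_conv
  by (intro order_Gal_Spl f3_nonzero root_perm_eq_iff x y; assumption)+

lemma submonoid3_H: "submonoid3 (fst ` H)" "submonoid3 (snd ` H)"
proof -
  have "Id3 \<in> fst ` H" "Id3 \<in> snd ` H"
    using subgroup33_one[OF subgroup33_H] by force+
  then show "submonoid3 (fst ` H)" "submonoid3 (snd ` H)"
    unfolding submonoid3_def using subgroup33_mult[OF subgroup33_H] by (auto; force)+
qed

lemmas fst_H_cases = submonoid3_cases[OF submonoid3_H(1)]
lemmas snd_H_cases = submonoid3_cases[OF submonoid3_H(2)]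

lemma roots_in_Spl: "x i \<in> Spl N (f3 a)" "y i \<in> Spl N (f3 b)"
  using roots_subset_Spl[of "f3 a" N] roots_subset_Spl[of "f3 b" N]
    cubic_roots_range[OF x(1)] cubic_roots_range[OF y(1)] by auto

lemma intermediate_ring_Spl_a: "intermediate_ring Spl_a" and intermediate_ring_Spl_b: "intermediate_ring Spl_b"
  by (rule intermediate_ring_Spl, simp)+

lemma fixes_Spl_a: "base_hom UNIV \<sigma> \<Longrightarrow> (\<And>i. \<sigma> (x i) = x i) \<Longrightarrow> \<forall>z\<in>Spl_a. \<sigma> z = z"
  and fixes_Spl_b: "base_hom UNIV \<sigma> \<Longrightarrow> (\<And>i. \<sigma> (y i) = y i) \<Longrightarrow> \<forall>z\<in>Spl_b. \<sigma> z = z"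
  unfolding Spl_def cubic_roots_range[OF x(1)] cubic_roots_range[OF y(1)]
  by (intro base_hom_fixes_generate_field; auto)+

section \<open>The position of the two splitting fields\<close>

lemma fixed_in:
  assumes "intermediate_ring E" "w \<in> generate_field Cl (E \<union> range x \<union> range y)"
    and "\<And>\<sigma>. base_hom UNIV \<sigma> \<Longrightarrow> \<forall>z\<in>E. \<sigma> z = z \<Longrightarrow> \<sigma> w = w"
  shows "w \<in> E"
proof (rule generate_field_separable_fixed[where T = "range x \<union> range y"])
  show "w \<in> generate_field Cl (E \<union> (range x \<union> range y))" using assms(2) by (simp add: Un_assoc)
  show "\<forall>t\<in>range x \<union> range y. separable t"
    using cubic_roots_separable[OF x] cubic_roots_separable[OF y] by auto
qed (use assms in auto)

text \<open>The pairs \<open>(Id3, q)\<close> come from the maps that fix \<open>Spl_a\<close>. If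
  all of these fix each \<open>y i\<close> as well, then \<open>y i\<close>, being separable, lies
  in \<open>Spl_a\<close>.\<close>

lemma Spl_b_subset_Spl_a_iff: "Spl_b \<subseteq> Spl_a \<longleftrightarrow> (\<forall>q. (Id3, q) \<in> H \<longrightarrow> q = Id3)"
proof
  assume sub: "Spl_b \<subseteq> Spl_a"
  show "\<forall>q. (Id3, q) \<in> H \<longrightarrow> q = Id3"
  proof clarify
    fix q assume "(Id3, q) \<in> H"
    then obtain \<sigma> where \<sigma>: "base_hom UNIV \<sigma>" "\<And>i. \<sigma> (x i) = x (act3 Id3 i)" "\<And>i. \<sigma> (y i) = y (act3 q i)"
      by (rule HE) (rule that)
    then have "\<forall>z\<in>Spl_a. \<sigma> z = z" by (intro fixes_Spl_a) auto
    moreover have "y i \<in> Spl_a" for i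
      using sub roots_in_Spl(2)[where N = base_field] by (rule subsetD)
    ultimately have "y (act3 q i) = y (act3 Id3 i)" for i using \<sigma>(3)[of i] by simp
    then have "act3 q = act3 Id3" using y(2) by (auto simp: inj_eq)
    then show "q = Id3" by (simp add: act3_inj)
  qed
next
  assume triv: "\<forall>q. (Id3, q) \<in> H \<longrightarrow> q = Id3"
  have "y i \<in> Spl_a" for i
  proof (rule fixed_in[OF intermediate_ring_Spl_a])
    show "y i \<in> generate_field Cl (Spl_a \<union> range x \<union> range y)"
      by (rule generate_field.incl) simp
    fix \<sigma> assume \<sigma>: "base_hom UNIV \<sigma>" "\<forall>z\<in>Spl_a. \<sigma> z = z"
    have "root_perm x \<sigma> = Id3"
      using \<sigma>(2) roots_in_Spl(1) by (intro root_perm_unique[OF x(2)]) auto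
    then have "root_perm y \<sigma> = Id3" using triv HI[OF \<sigma>(1)] by auto
    then show "\<sigma> (y i) = y i" using root_perm[OF y \<sigma>(1), of i] by simp
  qed
  then have "base_field \<union> roots_in_closure (f3 b) \<subseteq> Spl_a"
    using cubic_roots_range[OF y(1)] intermediate_ring_to_ac[OF intermediate_ring_Spl_a] by auto
  then show "Spl_b \<subseteq> Spl_a"
    by (subst (1) Spl_def) (rule generate_field_subset[OF intermediate_ring_Spl_a])
qed

text \<open>Given \<open>\<sigma>\<close>, the product form supplies a \<open>\<tau>\<close> that
  acts like \<open>\<sigma>\<close> on the first field and trivially on the second. On a common
  element \<open>z\<close> this gives \<open>\<sigma> z = \<tau> z = z\<close>, so \<open>z\<close>
  is fixed by everything and lies in \<open>M\<close>.\<close>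

lemma Times_imp_Int:
  assumes "H = fst ` H \<times> snd ` H"
  shows "Spl_a \<inter> Spl_b = base_field"
proof
  show "base_field \<subseteq> Spl_a \<inter> Spl_b"
    using intermediate_ring_to_ac[OF intermediate_ring_Spl_a] intermediate_ring_to_ac[OF intermediate_ring_Spl_b]
    by auto
  show "Spl_a \<inter> Spl_b \<subseteq> base_field"
  proof
    fix z assume z: "z \<in> Spl_a \<inter> Spl_b"
    show "z \<in> base_field"
    proof (rule fixed_in[OF intermediate_ring_base_field])
      have "generate_field Cl (base_field \<union> range x) \<subseteq> generate_field Cl (base_field \<union> range x \<union> range y)"
        by (rule field.mono_generate_field[OF field_from_type_algebra]) (auto simp: Cl_simps)
      then show "z \<in> generate_field Cl (base_field \<union> range x \<union> range y)"
        using z unfolding Spl_def cubic_roots_range[OF x(1)] by blast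
      fix \<sigma> :: "'m alg_closure \<Rightarrow> 'm alg_closure"
      assume \<sigma>: "base_hom UNIV \<sigma>"
      have "root_perm x \<sigma> \<in> fst ` H" "Id3 \<in> snd ` H"
        using HI[OF \<sigma>] submonoid3_H by (force, simp add: submonoid3_def)
      then have "(root_perm x \<sigma>, Id3) \<in> H" using assms by blast
      then obtain \<tau> where \<tau>: "base_hom UNIV \<tau>" "\<And>i. \<tau> (x i) = x (act3 (root_perm x \<sigma>) i)"
        "\<And>i. \<tau> (y i) = y (act3 Id3 i)"
        by (rule HE) (rule that)
      have "root_perm x \<tau> = root_perm x \<sigma>" by (rule root_perm_unique[OF x(2) \<tau>(2)])
      then have "\<forall>u\<in>roots_in_closure (f3 a). \<tau> u = \<sigma> u"
        using root_perm_eq_iff[OF \<tau>(1) \<sigma> x] by simp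
      then have "\<forall>u\<in>base_field \<union> roots_in_closure (f3 a). \<tau> u = \<sigma> u"
        using base_hom_to_ac[OF \<tau>(1)] base_hom_to_ac[OF \<sigma>] by auto
      then have "\<forall>u\<in>Spl_a. \<tau> u = \<sigma> u"
        unfolding Spl_def by (rule base_hom_eq_on_generate_field[OF \<tau>(1) \<sigma>])
      moreover have "\<forall>u\<in>Spl_b. \<tau> u = u" using \<tau> by (intro fixes_Spl_b) auto
      ultimately show "\<sigma> z = z" using z by auto
    qed
  qed
qed

text \<open>
  The element \<open>e\<close> below is fixed exactly by the even permutations of the roots; unlike the
  square root of the discriminant it also does so in characteristic 2.
\<close>

lemma Int_base_imp_odd:
  assumes "Spl_a \<inter> Spl_b = base_field" "snd ` H = UNIV"
  shows "\<exists>t. (Id3, t) \<in> H \<and> t \<notin> even3"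
proof (rule ccontr)
  assume "\<not> ?thesis"
  then have even: "t \<in> even3" if "(Id3, t) \<in> H" for t using that by blast
  define e where "e = y I0 * y I0 * y I1 + y I1 * y I1 * y I2 + y I2 * y I2 * y I0"
  \<comment> \<open>The image of \<open>e\<close> under every odd permutation. It differs from
    \<open>e\<close> because \<open>e - e'\<close> is the Vandermonde product.\<close>
  define e' where "e' = y I1 * y I1 * y I0 + y I2 * y I2 * y I1 + y I0 * y I0 * y I2"
  have "e - e' = (y I0 - y I1) * (y I1 - y I2) * (y I0 - y I2)"
    by (simp add: e_def e'_def algebra_simps)
  moreover have "(y I0 - y I1) * (y I1 - y I2) * (y I0 - y I2) \<noteq> 0"
    using y(2) by (auto dest: injD)
  ultimately have ne: "e \<noteq> e'" by auto
  have \<sigma>_e: "\<sigma> e = (if root_perm y \<sigma> \<in> even3 then e else e')" if \<sigma>: "base_hom UNIV \<sigma>" for \<sigma>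
    unfolding e_def e'_def
    by (cases "root_perm y \<sigma>")
      (simp_all add: base_hom_add[OF \<sigma>] base_hom_mult[OF \<sigma>] root_perm[OF y \<sigma>] ac_simps)
  have e_Spl_b: "e \<in> Spl_b"
    unfolding e_def using roots_in_Spl(2)
    by (intro intermediate_ring_add[OF intermediate_ring_Spl_b] intermediate_ring_mult[OF intermediate_ring_Spl_b])
  \<comment> \<open>Under the assumption to be refuted, a map that fixes \<open>Spl_a\<close>
    permutes the \<open>y i\<close> evenly and so fixes \<open>e\<close>. Then \<open>e\<close> lies
    in both fields, hence in \<open>M\<close>, although a map that acts as \<open>Swap0\<close>
    moves it.\<close>
  have "e \<in> Spl_a"
  proof (rule fixed_in[OF intermediate_ring_Spl_a])
    have "intermediate_ring (generate_field Cl (Spl_a \<union> range x \<union> range y))"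
      using intermediate_ring_to_ac[OF intermediate_ring_Spl_a]
      by (intro intermediate_ring_generate_field) auto
    moreover have "y i \<in> generate_field Cl (Spl_a \<union> range x \<union> range y)" for i
      by (rule generate_field.incl) simp
    ultimately show "e \<in> generate_field Cl (Spl_a \<union> range x \<union> range y)"
      unfolding e_def by (intro intermediate_ring_add intermediate_ring_mult)
    fix \<sigma> assume \<sigma>: "base_hom UNIV \<sigma>" "\<forall>z\<in>Spl_a. \<sigma> z = z"
    have "root_perm x \<sigma> = Id3"
      using \<sigma>(2) roots_in_Spl(1) by (intro root_perm_unique[OF x(2)]) auto
    then have "root_perm y \<sigma> \<in> even3" using even HI[OF \<sigma>(1)] by auto
    then show "\<sigma> e = e" using \<sigma>_e[OF \<sigma>(1)] by simp
  qed
  then obtain c where c: "e = to_ac c" using e_Spl_b assms(1) by blast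
  have "Swap0 \<in> snd ` H" using assms(2) by simp
  then obtain \<sigma> where \<sigma>: "base_hom UNIV \<sigma>" "root_perm y \<sigma> = Swap0"
    unfolding H_def by force
  have "\<sigma> e = e" using base_hom_to_ac[OF \<sigma>(1)] c by simp
  then show False using \<sigma>_e[OF \<sigma>(1)] \<sigma>(2) ne by simp
qed

text \<open>\<open>H\<close> acts transitively on the \<open>y i\<close>, so a polynomial over
  \<open>M\<close> that vanishes at one of them vanishes at all three. Hence \<open>1\<close>,
  \<open>y I0\<close> and its square are linearly independent over \<open>M\<close>.\<close>

lemma no_quadratic_relation:
  assumes "snd ` H = UNIV" "poly (map_poly to_ac g) (y I0) = 0" "Polynomial.degree g \<le> 2"
  shows "g = 0"
proof (rule ccontr)
  assume "g \<noteq> 0"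
  then have g: "map_poly to_ac g \<noteq> 0" by (simp add: map_poly_eq_0_iff)
  have "poly (map_poly to_ac g) (y (act3 q I0)) = 0" for q
  proof -
    obtain p where "(p, q) \<in> H" using assms(1) by (metis (no_types, lifting) UNIV_I image_iff prod.collapse)
    then obtain \<sigma> where "base_hom UNIV \<sigma>" "\<And>i. \<sigma> (y i) = y (act3 q i)" by (rule HE) (rule that)
    then show ?thesis using base_hom_root[of UNIV \<sigma> "y I0" g] assms(2) by simp
  qed
  from this[of Id3] this[of Rot1] this[of Rot2]
  have "range y \<subseteq> {z. poly (map_poly to_ac g) z = 0}"
    by (simp add: UNIV_idx3)
  then have "card (range y) \<le> Polynomial.degree (map_poly to_ac g)"
    using card_mono[OF poly_roots_finite[OF g]] card_poly_roots_bound[OF g] le_trans by blast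
  moreover have "card (range y) = 3"
    using y(2) by (simp add: card_image UNIV_idx3)
  ultimately show False using assms(3) by simp
qed

end

section \<open>Intersections of degree two\<close>

lemma subfield_base_field: "subfield base_field (Cl :: 'm::field alg_closure ring)"
proof -
  have "subfield (generate_field Cl base_field) (Cl :: 'm alg_closure ring)"
    by (rule field.generate_field_is_subfield[OF field_from_type_algebra]) (simp add: Cl_simps)
  moreover have "generate_field Cl base_field = (base_field :: 'm alg_closure set)"
    by (intro equalityI generate_field_subset[OF intermediate_ring_base_field]
        subset_generate_field order_refl)
  ultimately show ?thesis by simp
qed

context cubic_pair
begin

text \<open>An odd \<open>t\<close> would make \<open>H\<close> everything and the intersection
  equal to \<open>M\<close>, of dimension 1. A trivial kernel would make the intersection equal to
  \<open>Spl_b\<close>, which has three linearly independent elements.\<close>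

lemma dimension_2_imp:
  assumes snd: "snd ` H = UNIV" and fst: "fst ` H = UNIV"
    and dim: "ring.dimension Cl 2 base_field (Spl_a \<inter> Spl_b)"
  shows "(Id3, t) \<in> H \<Longrightarrow> t \<in> even3" "\<exists>q. (Id3, q) \<in> H \<and> q \<noteq> Id3"
proof -
  interpret cring "Cl :: 'm alg_closure ring" by (rule cring_from_type_algebra)
  note K = subfield_base_field[where 'm = 'm]
  have "Spl_a \<inter> Spl_b \<noteq> base_field"
  proof
    assume "Spl_a \<inter> Spl_b = base_field"
    then have "dimension 2 base_field base_field" using dim by simp
    then show False using dimension_is_inj[OF K _ dimension_one[OF K]] by fastforce
  qed
  then have "H \<noteq> UNIV" using Times_imp_Int fst snd by auto
  then show "(Id3, t) \<in> H \<Longrightarrow> t \<in> even3"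
    using subgroup33_full[OF subgroup33_H _ _ fst snd] by blast
  show "\<exists>q. (Id3, q) \<in> H \<and> q \<noteq> Id3"
  proof (rule ccontr)
    assume "\<not> ?thesis"
    then have "Spl_b \<subseteq> Spl_a" by (auto simp: Spl_b_subset_Spl_a_iff)
    then have dim_Spl_b: "dimension 2 base_field Spl_b" using dim by (simp add: Int_absorb1)
    let ?y = "y I0"
    have Span1: "Span base_field [1] = base_field"
      using subfieldE(3)[OF K]
      by (auto simp: line_extension_mem_iff Cl_simps)
    have Span2: "Span base_field [?y, 1] = {to_ac c * ?y + to_ac d | c d. True}"
      using Span1 by (auto simp: line_extension_mem_iff Cl_simps) blast
    have "?y \<notin> base_field"
    proof
      assume "?y \<in> base_field"
      then obtain c where "?y = to_ac c" by blast
      then have "[:-c, 1:] = 0"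
        by (intro no_quadratic_relation[OF snd]) (simp_all add: map_poly_pCons)
      then show False by simp
    qed
    moreover have "?y * ?y \<notin> Span base_field [?y, 1]"
    proof
      assume "?y * ?y \<in> Span base_field [?y, 1]"
      then obtain c d where "?y * ?y = to_ac c * ?y + to_ac d" unfolding Span2 by blast
      then have "[:-d, -c, 1:] = 0"
        by (intro no_quadratic_relation[OF snd]) (simp_all add: map_poly_pCons algebra_simps)
      then show False by simp
    qed
    moreover have "1 \<notin> Span base_field []" by (simp add: Cl_simps)
    ultimately have "independent base_field [?y * ?y, ?y, 1]"
      using Span1 by (intro li_Cons li_Nil) (simp_all add: Cl_simps del: Span.simps)
    moreover have "set [?y * ?y, ?y, 1] \<subseteq> Spl_b"
      using roots_in_Spl(2) intermediate_ring_mult[OF intermediate_ring_Spl_b]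
        intermediate_ring_1[OF intermediate_ring_Spl_b] by auto
    ultimately show False
      using independent_length_le_dimension[OF K dim_Spl_b] by fastforce
  qed
qed

end

section \<open>Factor degrees and root fields of the sextic\<close>

locale cubic_pair_resolvent = cubic_pair +
  assumes theta_inj: "inj (theta x y)"
    and F2_eq: "map_poly to_ac (F2 a b) = (\<Prod>p\<in>UNIV. [:- theta x y p, 1:])"
begin

lemma separable_theta: "separable (theta x y p)"
proof -
  have "map_poly to_ac (F2 a b) = (\<Prod>s\<in>range (theta x y). [:-s, 1:])"
    using F2_eq theta_inj by (simp add: prod.reindex)
  then show ?thesis unfolding separable_def
    by (intro exI[of _ "range (theta x y)"] exI[of _ "F2 a b"]) auto
qed

lemma galois_orbit_theta:
  assumes "orbit33 H Z"
  shows "galois_orbit (theta x y ` Z)"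
  unfolding galois_orbit_def
proof (intro conjI allI impI)
  note Z = assms[unfolded orbit33_def]
  show "theta x y ` Z \<noteq> {}" using Z by simp
  have image: "\<sigma> (theta x y p) = theta x y (root_perm y \<sigma> * p * inv3 (root_perm x \<sigma>))"
    if \<sigma>: "base_hom UNIV \<sigma>" for \<sigma> p
    by (rule theta_image[OF \<sigma>]) (rule root_perm[OF x \<sigma>], rule root_perm[OF y \<sigma>])
  show "\<forall>z\<in>theta x y ` Z. \<sigma> z \<in> theta x y ` Z" if \<sigma>: "base_hom UNIV \<sigma>" for \<sigma>
    using image[OF \<sigma>] Z HI[OF \<sigma>] by auto
  show "\<forall>z\<in>theta x y ` Z. \<forall>z'\<in>theta x y ` Z. \<exists>\<sigma>. base_hom UNIV \<sigma> \<and> \<sigma> z = z'"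
  proof clarify
    fix p q assume "p \<in> Z" "q \<in> Z"
    then obtain a' b' where H: "(a', b') \<in> H" and eq: "b' * p * inv3 a' = q"
      using Z by blast
    from H show "\<exists>\<sigma>. base_hom UNIV \<sigma> \<and> \<sigma> (theta x y p) = theta x y q"
      by (rule HE) (use theta_image eq in blast)
  qed
qed simp

text \<open>The equation between multisets says that the members of \<open>Zs\<close> partition the
  six permutations: none is missed and none is counted twice.\<close>

lemma has_factor_degrees_F2:
  assumes "\<forall>Z\<in>#Zs. orbit33 H Z" and "(\<Sum>Z\<in>#Zs. mset_set Z) = mset_set UNIV"
  shows "has_factor_degrees (F2 a b) (image_mset card Zs)"
proof -
  let ?f = "\<lambda>p. [:- theta x y p, 1:]"
  have inj: "inj_on (theta x y) Z" for Z using theta_inj by (rule inj_on_subset) simp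
  have "(\<Prod>Z\<in>#Zs. \<Prod>p\<in>Z. ?f p) = (\<Prod>p\<in>#(\<Sum>Z\<in>#Zs. mset_set Z). ?f p)"
    by (induction Zs) (simp_all add: prod_unfold_prod_mset)
  also have "\<dots> = (\<Prod>p\<in>UNIV. ?f p)"
    unfolding assms(2) by (simp add: prod_unfold_prod_mset)
  also have "\<dots> = map_poly to_ac (F2 a b)" by (rule F2_eq[symmetric])
  finally have "map_poly to_ac (F2 a b) = (\<Prod>Z\<in>#Zs. \<Prod>p\<in>Z. ?f p)" ..
  also have "\<dots> = (\<Prod>Z\<in>#image_mset ((`) (theta x y)) Zs. \<Prod>z\<in>Z. [:-z, 1:])"
    by (simp add: image_mset.compositionality o_def prod.reindex[OF inj])
  finally have "has_factor_degrees (F2 a b) (image_mset card (image_mset ((`) (theta x y)) Zs))"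
    by (rule has_factor_degrees_orbits[rotated])
      (use assms(1) galois_orbit_theta separable_theta in auto)
  then show ?thesis
    by (simp add: image_mset.compositionality o_def card_image[OF inj])
qed

lemma has_factor_degrees_6: "orbit33 H UNIV \<Longrightarrow> has_factor_degrees (F2 a b) {#6#}"
  using has_factor_degrees_F2[of "{#UNIV#}"] by (simp add: UNIV_perm3 numeral_eq_Suc)

lemma has_factor_degrees_33:
  assumes "orbit33 H even3" "orbit33 H (- even3)"
  shows "has_factor_degrees (F2 a b) {#3, 3#}"
proof -
  have odd: "- even3 = {Swap0, Swap1, Swap2}"
    unfolding even3_def using UNIV_perm3 by auto
  show ?thesis
    using has_factor_degrees_F2[of "{#even3, - even3#}"] assms
    unfolding odd by (simp add: UNIV_perm3 even3_def numeral_eq_Suc add_mset_commute)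
qed

lemma has_factor_degrees_123:
  assumes "H = {(p, q). q = r * p * inv3 r}"
  shows "has_factor_degrees (F2 a b) {#1, 2, 3#}"
  using has_factor_degrees_F2[of "{#{r}, {r * Rot1, r * Rot2}, {r * Swap0, r * Swap1, r * Swap2}#}"]
    orbit33_conj[OF assms]
  by (cases r) (simp_all add: UNIV_perm3 numeral_eq_Suc add_mset_commute)

lemma has_factor_degrees_1113:
  assumes "H = {(p, p) |p. p \<in> even3} \<or> H = {(p, inv3 p) |p. p \<in> even3}"
  shows "has_factor_degrees (F2 a b) {#1, 1, 1, 3#}"
  using assms
proof
  assume "H = {(p, p) |p. p \<in> even3}"
  from orbit33_diagonal[OF this] show ?thesis
    using has_factor_degrees_F2[of "{#{Id3}, {Rot1}, {Rot2}, {Swap0, Swap1, Swap2}#}"]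
    by (simp add: UNIV_perm3 numeral_eq_Suc add_mset_commute)
next
  assume "H = {(p, inv3 p) |p. p \<in> even3}"
  from orbit33_antidiagonal[OF this] show ?thesis
    using has_factor_degrees_F2[of "{#{Swap0}, {Swap1}, {Swap2}, {Id3, Rot1, Rot2}#}"]
    by (simp add: UNIV_perm3 numeral_eq_Suc add_mset_commute)
qed

lemma Spl_root_field_eq:
  assumes "\<theta> \<in> roots_in_closure (F2 a b)"
  shows "Spl (root_field \<theta>) (f3 a) = Spl (root_field \<theta>) (f3 b)"
proof -
  obtain p where p: "\<theta> = theta x y p"
    using assms unfolding F2_eq by (auto simp: poly_prod prod_zero_iff)
  have base: "base_field \<subseteq> root_field \<theta>" and self: "\<theta> \<in> root_field \<theta>"
    unfolding root_field_def by (auto intro: generate_field.incl)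
  have perm: "root_perm y \<sigma> * p = p * root_perm x \<sigma>"
    if \<sigma>: "base_hom UNIV \<sigma>" "\<sigma> \<theta> = \<theta>" for \<sigma>
  proof -
    have "\<sigma> (theta x y p) = theta x y (root_perm y \<sigma> * p * inv3 (root_perm x \<sigma>))"
      by (rule theta_image[OF \<sigma>(1)]) (rule root_perm[OF x \<sigma>(1)], rule root_perm[OF y \<sigma>(1)])
    then have "root_perm y \<sigma> * p * inv3 (root_perm x \<sigma>) = p"
      using \<sigma>(2) theta_inj by (simp add: p inj_eq)
    then have "root_perm y \<sigma> * p * inv3 (root_perm x \<sigma>) * root_perm x \<sigma> = p * root_perm x \<sigma>"
      by simp
    then show ?thesis by (simp add: mult.assoc)
  qed
  have perm_triv: "root_perm y \<sigma> = Id3 \<longleftrightarrow> root_perm x \<sigma> = Id3"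
    if \<sigma>: "base_hom UNIV \<sigma>" "\<sigma> \<theta> = \<theta>" for \<sigma>
  proof -
    have "root_perm y \<sigma> * p * inv3 p = p * root_perm x \<sigma> * inv3 p"
      "inv3 p * (root_perm y \<sigma> * p) = inv3 p * (p * root_perm x \<sigma>)"
      unfolding perm[OF \<sigma>] by simp_all
    then have "root_perm y \<sigma> = p * root_perm x \<sigma> * inv3 p"
      "inv3 p * (root_perm y \<sigma> * p) = root_perm x \<sigma>"
      by (simp add: mult.assoc, simp flip: mult.assoc)
    then show ?thesis by auto
  qed
  let ?N = "root_field \<theta>"
  have Ra: "intermediate_ring (Spl ?N (f3 a))" and Rb: "intermediate_ring (Spl ?N (f3 b))"
    by (rule intermediate_ring_Spl[OF base])+
  have NS: "?N \<subseteq> Spl ?N g" for g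
    unfolding Spl_def using subset_generate_field by (rule order_trans[rotated]) simp
  \<comment> \<open>A map that fixes this field fixes \<open>\<theta>\<close> and every
    \<open>x i\<close>, hence by \<open>perm_triv\<close> every \<open>y i\<close>.\<close>
  have "y i \<in> Spl ?N (f3 a)" for i
  proof (rule fixed_in[OF Ra])
    show "y i \<in> generate_field Cl (Spl ?N (f3 a) \<union> range x \<union> range y)"
      by (rule generate_field.incl) simp
    fix \<sigma> assume \<sigma>: "base_hom UNIV \<sigma>" "\<forall>z\<in>Spl ?N (f3 a). \<sigma> z = z"
    then have "\<sigma> \<theta> = \<theta>" using NS self by blast
    moreover have "root_perm x \<sigma> = Id3"
      using \<sigma>(2) roots_in_Spl(1) by (intro root_perm_unique[OF x(2)]) auto
    ultimately show "\<sigma> (y i) = y i" using root_perm[OF y \<sigma>(1), of i] perm_triv[OF \<sigma>(1)] by simp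
  qed
  then have 1: "?N \<union> roots_in_closure (f3 b) \<subseteq> Spl ?N (f3 a)"
    using NS cubic_roots_range[OF y(1)] by auto
  have "x i \<in> Spl ?N (f3 b)" for i
  proof (rule fixed_in[OF Rb])
    show "x i \<in> generate_field Cl (Spl ?N (f3 b) \<union> range x \<union> range y)"
      by (rule generate_field.incl) simp
    fix \<sigma> assume \<sigma>: "base_hom UNIV \<sigma>" "\<forall>z\<in>Spl ?N (f3 b). \<sigma> z = z"
    then have "\<sigma> \<theta> = \<theta>" using NS self by blast
    moreover have "root_perm y \<sigma> = Id3"
      using \<sigma>(2) roots_in_Spl(2) by (intro root_perm_unique[OF y(2)]) auto
    ultimately show "\<sigma> (x i) = x i" using root_perm[OF x \<sigma>(1), of i] perm_triv[OF \<sigma>(1)] by simp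
  qed
  then have 2: "?N \<union> roots_in_closure (f3 a) \<subseteq> Spl ?N (f3 b)"
    using NS cubic_roots_range[OF x(1)] by auto
  show ?thesis
    using generate_field_subset[OF Ra 1] generate_field_subset[OF Rb 2]
    by (simp only: Spl_def[symmetric] subset_antisym)
qed

end

section \<open>The characteristic and the case distinction\<close>

lemma inv_B_nonzero:
  assumes "Factorial_Ring.irreducible (f3 a)" "(3 :: 'a::field) \<noteq> 0"
  shows "inv_B (a :: 'a \<times> 'a \<times> 'a) \<noteq> 0"
proof
  assume B: "inv_B a = 0"
  obtain a1 a2 a3 where a: "a = (a1, a2, a3)" by (cases a)
  \<comment> \<open>\<open>a1 / 3\<close> is the mean of the roots, so the value is the constant
    term of the cubic after the shift that removes its square term.\<close>
  have "poly (f3 a) (a1 / 3) = - inv_B a / 27"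
  proof -
    have "(27 :: 'a) = 3 ^ 3" by simp
    then have "(27 :: 'a) \<noteq> 0" using assms(2) by (metis power_not_zero)
    moreover have "(9 :: 'a) \<noteq> 0"
    proof -
      have "(9 :: 'a) = 3 ^ 2" by simp
      then show ?thesis using assms(2) by (metis power_not_zero)
    qed
    ultimately show ?thesis using assms(2)
      by (simp add: a field_simps power2_eq_square power3_eq_cube)
  qed
  then have "[:- (a1 / 3), 1:] dvd f3 a" using B by (simp add: poly_eq_0_iff_dvd)
  then obtain g where g: "f3 a = [:- (a1 / 3), 1:] * g" by (rule dvdE)
  have "g \<noteq> 0" using g f3_nonzero[of a] by auto
  then have "Polynomial.degree (f3 a) = 1 + Polynomial.degree g"
    unfolding g by (subst degree_mult_eq) auto
  then have "Polynomial.degree g = 2" by simp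
  then have "\<not> g dvd 1" using is_unit_iff_degree[OF \<open>g \<noteq> 0\<close>] by simp
  moreover have "\<not> [:- (a1 / 3), 1:] dvd 1" by (subst is_unit_iff_degree) auto
  ultimately show False
    using Factorial_Ring.irreducibleD[OF assms(1) g] by blast
qed

text \<open>A homomorphism of fields is injective, so \<open>3 = 0\<close> in \<open>M\<close> would
  give \<open>3 = 0\<close> in \<open>k\<close>. The characteristic of \<open>k\<close> would then
  divide 3 and, not being 3, would be 1, which is impossible.\<close>

lemma three_nonzero:
  fixes \<iota> :: "'k::field \<Rightarrow> 'm::field"
  assumes "CHAR('k) \<noteq> 3" "\<iota> \<in> ring_hom ring_of_type_algebra ring_of_type_algebra"
  shows "(3 :: 'm) \<noteq> 0"
proof
  assume 3: "(3 :: 'm) = 0"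
  have hom: "\<iota> (u + v) = \<iota> u + \<iota> v" "\<iota> (u * v) = \<iota> u * \<iota> v" "\<iota> 1 = 1" for u v
    using ring_hom_add[OF assms(2), of u v] ring_hom_mult[OF assms(2), of u v] ring_hom_one[OF assms(2)]
    by (simp_all add: ring_of_type_algebra_def)
  have "\<iota> 3 = \<iota> (1 + 1 + 1)" by simp
  also have "\<dots> = 3" by (simp only: hom) simp
  finally have "\<iota> 3 = 0" using 3 by simp
  have "(3 :: 'k) = 0"
  proof (rule ccontr)
    assume "(3 :: 'k) \<noteq> 0"
    then have "\<iota> (3 * inverse 3) = 1" by (simp add: hom)
    then show False using hom(2)[of 3 "inverse 3"] \<open>\<iota> 3 = 0\<close> by simp
  qed
  then have "of_nat 3 = (0 :: 'k)" by simp
  then have "CHAR('k) dvd 3" by (simp only: of_nat_eq_0_iff_char_dvd)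
  moreover have "prime (3 :: nat)" by simp
  ultimately have "CHAR('k) = 1" using assms(1) by (metis prime_nat_iff)
  then show False using CHAR_not_1'[where 'a = 'k] by simp
qed

lemma order_eq_if_iso:
  "G \<cong> sym_group 3 \<Longrightarrow> Coset.order G = 6"
  "0 < n \<Longrightarrow> G \<cong> integer_mod_group n \<Longrightarrow> Coset.order G = n"
  "trivial_group G \<Longrightarrow> Coset.order G = 1"
proof -
  show "G \<cong> sym_group 3 \<Longrightarrow> Coset.order G = 6"
    using iso_same_card[of G "sym_group 3"] sym_group_card_carrier[of 3]
    by (simp add: Coset.order_def fact_numeral)
  show "Coset.order G = n" if "0 < n" "G \<cong> integer_mod_group n" for G
    using iso_same_card[OF that(2)] that(1) by (simp add: Coset.order_def carrier_integer_mod_group)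
  show "trivial_group G \<Longrightarrow> Coset.order G = 1"
    by (simp add: Coset.order_def trivial_group_def)
qed

theorem theorem4p5:
  fixes \<iota> :: "'k::field \<Rightarrow> 'm::field"
    and a b :: "'m \<times> 'm \<times> 'm"
  defines "La \<equiv> Spl base_field (f3 a)"
    and "Lb \<equiv> Spl base_field (f3 b)"
  defines "Ga \<equiv> Gal La"
    and "Gb \<equiv> Gal Lb"
  assumes char_k: "CHAR('k) \<noteq> 3"
    and k_in_M: "\<iota> \<in> ring_hom ring_of_type_algebra ring_of_type_algebra"
    and infinite_M: "infinite (UNIV :: 'm set)"
    and disc: "inv_D a * inv_D b \<noteq> 0"
    and order_le: "Coset.order Ga \<ge> Coset.order Gb"
    and irred: "Factorial_Ring.irreducible (f3 a)"
    and A_nz: "inv_A a * inv_A b \<noteq> 0"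
    and AB_nz: "inv_A a ^ 3 * inv_B b ^ 2 - 27 * inv_A b ^ 3 * inv_D a \<noteq> 0"
  shows
    "(Ga \<cong> sym_group 3 \<longrightarrow>
        (Gb \<cong> sym_group 3 \<longrightarrow>
           (La \<inter> Lb = base_field \<longrightarrow> has_factor_degrees (F2 a b) {#6#}) \<and>
           (ring.dimension Cl 2 base_field (La \<inter> Lb) \<longrightarrow> has_factor_degrees (F2 a b) {#3, 3#}) \<and>
           (La = Lb \<longrightarrow> has_factor_degrees (F2 a b) {#1, 2, 3#})) \<and>
        (Gb \<cong> integer_mod_group 3 \<longrightarrow>
           La \<inter> Lb = base_field \<and> has_factor_degrees (F2 a b) {#6#}) \<and>
        (Gb \<cong> integer_mod_group 2 \<longrightarrow>
           (\<not> Lb \<subseteq> La \<longrightarrow> has_factor_degrees (F2 a b) {#6#}) \<and>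
           (Lb \<subseteq> La \<longrightarrow> has_factor_degrees (F2 a b) {#3, 3#})) \<and>
        (trivial_group Gb \<longrightarrow> has_factor_degrees (F2 a b) {#6#})) \<and>
     (Ga \<cong> integer_mod_group 3 \<longrightarrow>
        (Gb \<cong> integer_mod_group 3 \<longrightarrow>
           (La \<noteq> Lb \<longrightarrow> has_factor_degrees (F2 a b) {#3, 3#}) \<and>
           (La = Lb \<longrightarrow> has_factor_degrees (F2 a b) {#1, 1, 1, 3#})) \<and>
        (Gb \<cong> integer_mod_group 2 \<longrightarrow>
           La \<inter> Lb = base_field \<and> has_factor_degrees (F2 a b) {#6#}) \<and>
        (trivial_group Gb \<longrightarrow> has_factor_degrees (F2 a b) {#3, 3#})) \<and>
     (\<forall>h \<theta>. Factorial_Ring.irreducible h \<and> h dvd F2 a b \<and> \<theta> \<in> roots_in_closure h \<longrightarrow>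
        Spl (root_field \<theta>) (f3 a) = Spl (root_field \<theta>) (f3 b))"
proof -
  obtain x where roots_x: "cubic_roots a x" using cubic_roots_exist by blast
  obtain y where roots_y: "cubic_roots b y" using cubic_roots_exist by blast
  have D: "inv_D a \<noteq> 0" "inv_D b \<noteq> 0" using disc by auto
  have B: "inv_B a \<noteq> 0"
    by (rule inv_B_nonzero[OF irred three_nonzero[OF char_k k_in_M]])
  note inj_x = cubic_roots_inj[OF roots_x D(1)] and inj_y = cubic_roots_inj[OF roots_y D(2)]
  interpret cubic_pair_resolvent a b x y
    using roots_x roots_y inj_x inj_y theta_inj[OF roots_x D(1) roots_y D(2) B AB_nz]
      F2_eq_prod_theta[OF roots_x D(1) roots_y]
    by unfold_locales
  \<comment> \<open>Exchanging the cubics replaces \<open>H\<close> by its converse and turns the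
    criterion for \<open>Lb \<subseteq> La\<close> into the one for
    \<open>La \<subseteq> Lb\<close>.\<close>
  interpret swap: cubic_pair b a y x
    using roots_x roots_y inj_x inj_y by unfold_locales
  have swap_H: "swap.H = H\<inverse>"
    unfolding swap.H_def H_def by auto
  have La_subset_Lb_iff: "La \<subseteq> Lb \<longleftrightarrow> (\<forall>p. (p, Id3) \<in> H \<longrightarrow> p = Id3)"
    using swap.Spl_b_subset_Spl_a_iff unfolding swap_H La_def Lb_def by simp
  note Lb_subset_La_iff = Spl_b_subset_Spl_a_iff[folded La_def Lb_def]
  note Int_eq = Times_imp_Int[folded La_def Lb_def]
  note ord = order_Gal[folded La_def Lb_def, folded Ga_def Gb_def]
  note H = subgroup33_H
  note order_6 = order_eq_if_iso(1) and order_3 = order_eq_if_iso(2)[of 3, simplified]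
    and order_2 = order_eq_if_iso(2)[of 2, simplified] and order_1 = order_eq_if_iso(3)
  \<comment> \<open>The isomorphism types enter through the group orders, which determine the
    projections of \<open>H\<close> up to the choice of a transposition.\<close>
  have Ga: "Ga \<cong> sym_group 3 \<Longrightarrow> fst ` H = UNIV" "Ga \<cong> integer_mod_group 3 \<Longrightarrow> fst ` H = even3"
    by (rule fst_H_cases(1), simp only: ord(1)[symmetric] order_6)
      (rule fst_H_cases(2), simp only: ord(1)[symmetric] order_3)
  have Gb: "Gb \<cong> sym_group 3 \<Longrightarrow> snd ` H = UNIV" "Gb \<cong> integer_mod_group 3 \<Longrightarrow> snd ` H = even3"
    "Gb \<cong> integer_mod_group 2 \<Longrightarrow> \<exists>t. t \<notin> even3 \<and> snd ` H = {Id3, t}"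
    "trivial_group Gb \<Longrightarrow> snd ` H = {Id3}"
    by (rule snd_H_cases(1), simp only: ord(2)[symmetric] order_6)
      (rule snd_H_cases(2), simp only: ord(2)[symmetric] order_3,
        rule snd_H_cases(3), simp only: ord(2)[symmetric] order_2,
        rule snd_H_cases(4), simp only: ord(2)[symmetric] order_1)
  have S3_S3:
    "(La \<inter> Lb = base_field \<longrightarrow> has_factor_degrees (F2 a b) {#6#}) \<and>
     (ring.dimension Cl 2 base_field (La \<inter> Lb) \<longrightarrow> has_factor_degrees (F2 a b) {#3, 3#}) \<and>
     (La = Lb \<longrightarrow> has_factor_degrees (F2 a b) {#1, 2, 3#})"
    if G: "Ga \<cong> sym_group 3" "Gb \<cong> sym_group 3"
  proof (intro conjI impI)
    note fst = Ga(1)[OF G(1)] and snd = Gb(1)[OF G(2)]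
    show "has_factor_degrees (F2 a b) {#6#}" if int: "La \<inter> Lb = base_field"
    proof -
      obtain t where "(Id3, t) \<in> H" "t \<notin> even3"
        using Int_base_imp_odd[folded La_def Lb_def, OF int snd] by blast
      then have "H = UNIV" by (rule subgroup33_full[OF H _ _ fst snd])
      then show ?thesis using orbit33_UNIV(1) has_factor_degrees_6 by simp
    qed
    show "has_factor_degrees (F2 a b) {#3, 3#}" if "ring.dimension Cl 2 base_field (La \<inter> Lb)"
    proof -
      note dim = dimension_2_imp[folded La_def Lb_def, OF snd fst that]
      obtain q where q: "(Id3, q) \<in> H" "q \<noteq> Id3" using dim(2) by blast
      have "H = {(p, q). p \<in> even3 \<longleftrightarrow> q \<in> even3}"
        by (rule subgroup33_same_parity[OF H fst snd dim(1) q])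
      then show ?thesis by (intro has_factor_degrees_33 orbit33_even_odd) simp_all
    qed
    show "has_factor_degrees (F2 a b) {#1, 2, 3#}" if "La = Lb"
    proof -
      have "\<exists>r. H = {(p, q). q = r * p * inv3 r}"
        using La_subset_Lb_iff Lb_subset_La_iff that by (intro subgroup33_conj[OF H fst]) auto
      then show ?thesis using has_factor_degrees_123 by blast
    qed
  qed
  have S3_C3: "La \<inter> Lb = base_field \<and> has_factor_degrees (F2 a b) {#6#}"
    if G: "Ga \<cong> sym_group 3" "Gb \<cong> integer_mod_group 3"
  proof -
    note fst = Ga(1)[OF G(1)] and snd = Gb(2)[OF G(2)]
    have "H = UNIV \<times> even3" by (rule subgroup33_UNIV_even[OF H fst snd])
    then show ?thesis
      using Int_eq fst snd orbit33_UNIV(2) has_factor_degrees_6 by simp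
  qed
  have S3_C2: "(\<not> Lb \<subseteq> La \<longrightarrow> has_factor_degrees (F2 a b) {#6#}) \<and>
      (Lb \<subseteq> La \<longrightarrow> has_factor_degrees (F2 a b) {#3, 3#})"
    if G: "Ga \<cong> sym_group 3" "Gb \<cong> integer_mod_group 2"
  proof -
    obtain t where t: "t \<notin> even3" and snd: "snd ` H = {Id3, t}" using Gb(3)[OF G(2)] by blast
    note cases = subgroup33_UNIV_swap[OF H Ga(1)[OF G(1)] snd t]
    have "q = Id3 \<or> q = t" if "(p, q) \<in> H" for p q using snd that by force
    \<comment> \<open>\<open>t\<close> is the only nontrivial element that the kernel of the first
      projection can contain.\<close>
    then have iff: "Lb \<subseteq> La \<longleftrightarrow> (Id3, t) \<notin> H"
      unfolding Lb_subset_La_iff using t even3_iff(1) by metis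
    show ?thesis
    proof (cases "(Id3, t) \<in> H")
      case True
      have "H = UNIV \<times> {Id3, t}" using cases unfolding if_P[OF True] .
      then have "has_factor_degrees (F2 a b) {#6#}"
        by (intro has_factor_degrees_6) (simp only: orbit33_UNIV)
      then show ?thesis using iff True by simp
    next
      case False
      have "H = {(p, q). q = (if p \<in> even3 then Id3 else t)}"
        using cases unfolding if_not_P[OF False] .
      then have "has_factor_degrees (F2 a b) {#3, 3#}"
        using t by (intro has_factor_degrees_33 orbit33_even_odd) blast+
      then show ?thesis using iff False by simp
    qed
  qed
  have C3_C3: "(La \<noteq> Lb \<longrightarrow> has_factor_degrees (F2 a b) {#3, 3#}) \<and>
      (La = Lb \<longrightarrow> has_factor_degrees (F2 a b) {#1, 1, 1, 3#})"
    if G: "Ga \<cong> integer_mod_group 3" "Gb \<cong> integer_mod_group 3"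
  proof -
    note cases = subgroup33_even_even[OF H Ga(2)[OF G(1)] Gb(2)[OF G(2)]]
    have iff: "La = Lb \<longleftrightarrow> (\<forall>b. (Id3, b) \<in> H \<longrightarrow> b = Id3) \<and> (\<forall>a. (a, Id3) \<in> H \<longrightarrow> a = Id3)"
      using La_subset_Lb_iff Lb_subset_La_iff by blast
    show ?thesis
    proof (cases "La = Lb")
      case True
      then show ?thesis using cases iff has_factor_degrees_1113 by simp
    next
      case False
      then have "H = even3 \<times> even3" using cases iff by metis
      then show ?thesis using False by (auto intro!: has_factor_degrees_33 orbit33_even_odd)
    qed
  qed
  have C3_C2: "La \<inter> Lb = base_field \<and> has_factor_degrees (F2 a b) {#6#}"
    if G: "Ga \<cong> integer_mod_group 3" "Gb \<cong> integer_mod_group 2"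
  proof -
    obtain t where t: "t \<notin> even3" and snd: "snd ` H = {Id3, t}" using Gb(3)[OF G(2)] by blast
    have eq: "H = even3 \<times> {Id3, t}" by (rule subgroup33_even_swap[OF H Ga(2)[OF G(1)] snd t])
    have "has_factor_degrees (F2 a b) {#6#}"
      using orbit33_UNIV(5)[OF t, folded eq] by (rule has_factor_degrees_6)
    then show ?thesis using Int_eq eq Ga(2)[OF G(1)] snd by metis
  qed
  have trivial: "H = fst ` H \<times> {Id3}" if "trivial_group Gb"
    by (rule subgroup33_trivial[OF H Gb(4)[OF that]])
  have S3_1: "has_factor_degrees (F2 a b) {#6#}" if G: "Ga \<cong> sym_group 3" "trivial_group Gb"
  proof -
    have "H = UNIV \<times> {Id3}" using trivial[OF G(2)] Ga(1)[OF G(1)] by simp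
    then show ?thesis by (intro has_factor_degrees_6) (simp only: orbit33_UNIV)
  qed
  have C3_1: "has_factor_degrees (F2 a b) {#3, 3#}" if G: "Ga \<cong> integer_mod_group 3" "trivial_group Gb"
  proof -
    have "H = even3 \<times> {Id3}" using trivial[OF G(2)] Ga(2)[OF G(1)] by simp
    then show ?thesis by (intro has_factor_degrees_33 orbit33_even_odd) simp_all
  qed
  have root_fields: "Spl (root_field \<theta>) (f3 a) = Spl (root_field \<theta>) (f3 b)"
    if h: "h dvd F2 a b" "\<theta> \<in> roots_in_closure h" for h \<theta>
  proof (rule Spl_root_field_eq)
    obtain g where "F2 a b = h * g" using h(1) by (rule dvdE)
    then show "\<theta> \<in> roots_in_closure (F2 a b)" using h(2) by (simp add: map_poly_to_ac_mult)
  qed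
  show ?thesis
    by (rule conjI, rule impI)
      (intro conjI[OF impI[OF S3_S3] conjI[OF impI[OF S3_C3] conjI[OF impI[OF S3_C2] impI[OF S3_1]]]],
        assumption+, rule conjI, rule impI,
        intro conjI[OF impI[OF C3_C3] conjI[OF impI[OF C3_C2] impI[OF C3_1]]],
        assumption+, use root_fields in blast)
qed

end
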